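(* Let $K$ be any field and $f\in\mathfrak m\subset R$. 1. $f$ is finitely contact determined if and only if $\tau(f)<\infty$. 2. $f$ is finitely right determined if and only if $\mu(f)<\infty$. Moreover, if $\tau(f)<\infty$ then $f$ is contact $(2\tau(f)-\mathrm{ord}(f)+2)$-determined, and if $\mu(f)<\infty$ then $f$ is right $(2\mu(f)-\mathrm{ord}(f)+2)$-determined.
   Context: $R=K[[x_1,\dots,x_s]]$, $\mathfrak m=\langle x_1,\dots,x_s\rangle$, $Aut(R)$ the group of $K$-algebra automorphisms of $R$. $f$ is right equivalent to $g$ if $\phi(f)=g$ for some $\phi\in Aut(R)$; $f$ is right $k$-determined if every $g$ with $f-g\in\mathfrak m^{k+1}$ is right equivalent to $f$. $f$ is contact $k$-determined if every $g$ with $f-g\in\mathfrak m^{k+1}$ satisfies $R/\langle f\rangle\cong R/\langle g\rangle$ as local $K$-algebras. "Finitely (contact/right) determined" means $k$-determined for some $k$. $\tau(f)=\dim_K R/\langle f,\partial f/\partial x_1,\dots,\partial f/\partial x_s\rangle$ (Tjurina number), $\mu(f)=\dim_K R/\langle\partial f/\partial x_1,\dots,\partial f/\partial x_s\rangle$ (Milnor number), and $\mathrm{ord}(f)$ is the lowest degree of a nonzero homogeneous part of $f$. *)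

theory Defs
  imports Main "HOL-Library.Extended_Nat"
begin

text \<open>Formal power series ring R = K[[x_0,...,x_(s-1)]] over a field K (type 'a).
  A monomial (exponent vector) is a function nat => nat vanishing at indices >= s;
  a power series is a coefficient function on exponent vectors, zero outside monomials.\<close>

type_synonym 'a ps = "(nat \<Rightarrow> nat) \<Rightarrow> 'a"

definition mons :: "nat \<Rightarrow> (nat \<Rightarrow> nat) set" where
  "mons s = {\<alpha>. \<forall>i\<ge>s. \<alpha> i = 0}"

definition PS :: "nat \<Rightarrow> ('a::field) ps set" where
  "PS s = {f. \<forall>\<alpha>. f \<alpha> \<noteq> 0 \<longrightarrow> \<alpha> \<in> mons s}"

definition deg :: "nat \<Rightarrow> (nat \<Rightarrow> nat) \<Rightarrow> nat" where
  "deg s \<alpha> = (\<Sum>i<s. \<alpha> i)"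

definition ps_zero :: "('a::field) ps" where "ps_zero = (\<lambda>\<alpha>. 0)"
definition ps_one :: "('a::field) ps" where
  "ps_one = (\<lambda>\<alpha>. if \<alpha> = (\<lambda>_. 0) then 1 else 0)"
definition ps_add :: "('a::field) ps \<Rightarrow> 'a ps \<Rightarrow> 'a ps" where
  "ps_add f g = (\<lambda>\<alpha>. f \<alpha> + g \<alpha>)"
definition ps_sub :: "('a::field) ps \<Rightarrow> 'a ps \<Rightarrow> 'a ps" where
  "ps_sub f g = (\<lambda>\<alpha>. f \<alpha> - g \<alpha>)"
definition ps_smult :: "'a::field \<Rightarrow> 'a ps \<Rightarrow> 'a ps" where
  "ps_smult c f = (\<lambda>\<alpha>. c * f \<alpha>)"
definition ps_mult :: "('a::field) ps \<Rightarrow> 'a ps \<Rightarrow> 'a ps" where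
  "ps_mult f g = (\<lambda>\<gamma>. \<Sum>\<alpha>\<in>{\<alpha>. \<alpha> \<le> \<gamma>}. f \<alpha> * g (\<lambda>i. \<gamma> i - \<alpha> i))"

definition ps_deriv :: "nat \<Rightarrow> ('a::field) ps \<Rightarrow> 'a ps" where
  "ps_deriv i f = (\<lambda>\<alpha>. of_nat (\<alpha> i + 1) * f (\<alpha>(i := \<alpha> i + 1)))"

definition ps_max :: "nat \<Rightarrow> ('a::field) ps set" where
  "ps_max s = {f \<in> PS s. f (\<lambda>_. 0) = 0}"

definition ps_max_pow :: "nat \<Rightarrow> nat \<Rightarrow> ('a::field) ps set" where
  "ps_max_pow s k = {f \<in> PS s. \<forall>\<alpha>. deg s \<alpha> < k \<longrightarrow> f \<alpha> = 0}"

definition ps_ord :: "nat \<Rightarrow> ('a::field) ps \<Rightarrow> nat" where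
  "ps_ord s f = (LEAST d. \<exists>\<alpha>\<in>mons s. deg s \<alpha> = d \<and> f \<alpha> \<noteq> 0)"

definition ideal_gen :: "nat \<Rightarrow> nat \<Rightarrow> (nat \<Rightarrow> ('a::field) ps) \<Rightarrow> 'a ps set" where
  "ideal_gen s n g = {h \<in> PS s. \<exists>a. (\<forall>i<n. a i \<in> PS s) \<and>
      h = (\<lambda>\<alpha>. \<Sum>i<n. ps_mult (a i) (g i) \<alpha>)}"

definition spans_mod :: "nat \<Rightarrow> ('a::field) ps set \<Rightarrow> 'a ps set \<Rightarrow> bool" where
  "spans_mod s I B \<longleftrightarrow> finite B \<and> B \<subseteq> PS s \<and>
     (\<forall>h\<in>PS s. \<exists>c. ps_sub h (\<lambda>\<alpha>. \<Sum>b\<in>B. c b * b \<alpha>) \<in> I)"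

definition qdim :: "nat \<Rightarrow> ('a::field) ps set \<Rightarrow> enat" where
  "qdim s I = (if \<exists>B. spans_mod s I B
      then enat (LEAST n. \<exists>B. spans_mod s I B \<and> card B = n) else \<infinity>)"

definition tjurina :: "nat \<Rightarrow> ('a::field) ps \<Rightarrow> enat" where
  "tjurina s f = qdim s (ideal_gen s (Suc s) (\<lambda>j. if j = 0 then f else ps_deriv (j - 1) f))"

definition milnor :: "nat \<Rightarrow> ('a::field) ps \<Rightarrow> enat" where
  "milnor s f = qdim s (ideal_gen s s (\<lambda>j. ps_deriv j f))"

definition is_aut :: "nat \<Rightarrow> (('a::field) ps \<Rightarrow> 'a ps) \<Rightarrow> bool" where
  "is_aut s \<phi> \<longleftrightarrow> bij_betw \<phi> (PS s) (PS s) \<and>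
     (\<forall>f\<in>PS s. \<forall>g\<in>PS s. \<phi> (ps_add f g) = ps_add (\<phi> f) (\<phi> g)
                        \<and> \<phi> (ps_mult f g) = ps_mult (\<phi> f) (\<phi> g)) \<and>
     (\<forall>c. \<forall>f\<in>PS s. \<phi> (ps_smult c f) = ps_smult c (\<phi> f)) \<and>
     \<phi> ps_one = ps_one"

definition right_equiv :: "nat \<Rightarrow> ('a::field) ps \<Rightarrow> 'a ps \<Rightarrow> bool" where
  "right_equiv s f g \<longleftrightarrow> (\<exists>\<phi>. is_aut s \<phi> \<and> \<phi> f = g)"

text \<open>R/I and R/J are isomorphic as K-algebras: psi is a lift of an isomorphism R/I -> R/J.\<close>
definition quot_iso :: "nat \<Rightarrow> ('a::field) ps set \<Rightarrow> 'a ps set \<Rightarrow> bool" where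
  "quot_iso s I J \<longleftrightarrow> (\<exists>\<psi>. (\<forall>a\<in>PS s. \<psi> a \<in> PS s) \<and>
     (\<forall>a\<in>PS s. \<forall>b\<in>PS s.
        ps_sub (\<psi> (ps_add a b)) (ps_add (\<psi> a) (\<psi> b)) \<in> J \<and>
        ps_sub (\<psi> (ps_mult a b)) (ps_mult (\<psi> a) (\<psi> b)) \<in> J) \<and>
     (\<forall>c. \<forall>a\<in>PS s. ps_sub (\<psi> (ps_smult c a)) (ps_smult c (\<psi> a)) \<in> J) \<and>
     ps_sub (\<psi> ps_one) ps_one \<in> J \<and>
     (\<forall>a\<in>PS s. \<psi> a \<in> J \<longleftrightarrow> a \<in> I) \<and>
     (\<forall>b\<in>PS s. \<exists>a\<in>PS s. ps_sub (\<psi> a) b \<in> J))"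

definition contact_equiv :: "nat \<Rightarrow> ('a::field) ps \<Rightarrow> 'a ps \<Rightarrow> bool" where
  "contact_equiv s f g \<longleftrightarrow>
     quot_iso s (ideal_gen s 1 (\<lambda>_. f)) (ideal_gen s 1 (\<lambda>_. g))"

definition right_det :: "nat \<Rightarrow> ('a::field) ps \<Rightarrow> nat \<Rightarrow> bool" where
  "right_det s f k \<longleftrightarrow>
     (\<forall>g\<in>PS s. ps_sub f g \<in> ps_max_pow s (k + 1) \<longrightarrow> right_equiv s f g)"

definition contact_det :: "nat \<Rightarrow> ('a::field) ps \<Rightarrow> nat \<Rightarrow> bool" where
  "contact_det s f k \<longleftrightarrow>
     (\<forall>g\<in>PS s. ps_sub f g \<in> ps_max_pow s (k + 1) \<longrightarrow> contact_equiv s f g)"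

definition fin_right_det :: "nat \<Rightarrow> ('a::field) ps \<Rightarrow> bool" where
  "fin_right_det s f \<longleftrightarrow> (\<exists>k. right_det s f k)"

definition fin_contact_det :: "nat \<Rightarrow> ('a::field) ps \<Rightarrow> bool" where
  "fin_contact_det s f \<longleftrightarrow> (\<exists>k. contact_det s f k)"

end

(* If the ideal T of f (generated by the partial derivatives, and by f in the contact case) contains
   m^k, where k is its codimension, then g with f - g of order at least 2k + 3 - ord f has the form
   g = (1 + a) f(x + b): the power series a (which is 0 in the right case) and b are found by
   successive approximation, the linear part of the equation being solvable because m^k lies in T and
   the Taylor remainder being of higher order. Working with f itself instead of a path from f to g
   keeps the argument independent of the characteristic.

   Conversely, a finitely determined f is equivalent to a polynomial g = f_0 + sum x_i^N with N
   invertible in K, which has finite Milnor number; finiteness is carried back to f along the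
   isomorphism by the chain rule. *)

theory Submission
  imports Defs
begin

text \<open>The constant is forced by one estimate. Let m be the order of f and T the ideal. Since T
  contains m^k, an error of order c + k is removed to first order by corrections of order c; the new
  Taylor remainder has order 2c + m - 2, which exceeds c + k as soon as c >= k + 3 - m. That T
  contains m^k holds because at most k inclusions in the chain of the T + m^n are strict, after
  which Nakayama's lemma applies.

  To stay free of division by integers, series are never expanded with factorials. They are split as
  f(0) + sum x_i q_i, and an identity is proved by showing that its defect gains one order with each
  split.

  In the converse direction the isomorphism is abstract: it is not given as a substitution, and in
  the contact case it is a map of quotients whose lift to R need not even be additive. It is first
  shown to be local. The chain rule then holds modulo T + m^N for every N, and Nakayama's lemma
  removes m^N at the end. This needs partial derivatives of positive order; outside m^2 one of them
  is a unit and T is the whole ring.\<close>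

subsection \<open>The ring of power series\<close>

text \<open>Exponents of finite support are exactly those at which the Cauchy product
  \<open>ps_mult\<close> is a genuine finite sum. Elsewhere the sum over an infinite set is 0 by
  convention, and even 1 * f = f can fail.\<close>

lemma finite_le_exponents:
  fixes \<gamma> :: "nat \<Rightarrow> nat"
  assumes "finite {i. \<gamma> i \<noteq> 0}"
  shows "finite {\<alpha>. \<alpha> \<le> \<gamma>}"
proof -
  let ?A = "{i. \<gamma> i \<noteq> 0}" and ?B = "{..Max (insert 0 (\<gamma> ` {i. \<gamma> i \<noteq> 0}))}"
  have "(x \<in> ?A \<longrightarrow> \<alpha> x \<in> ?B) \<and> (x \<notin> ?A \<longrightarrow> \<alpha> x = 0)" if "\<alpha> \<le> \<gamma>" for \<alpha> x
  proof -
    have le: "\<alpha> x \<le> \<gamma> x" using that by (auto simp: le_fun_def)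
    have "\<gamma> x \<le> Max (insert 0 (\<gamma> ` ?A))" if "x \<in> ?A"
      using assms that by (intro Max_ge) auto
    with le show ?thesis by force
  qed
  then have "{\<alpha>. \<alpha> \<le> \<gamma>} \<subseteq> {f. \<forall>x. (x \<in> ?A \<longrightarrow> f x \<in> ?B) \<and> (x \<notin> ?A \<longrightarrow> f x = 0)}"
    by blast
  moreover have "finite {f. \<forall>x. (x \<in> ?A \<longrightarrow> f x \<in> ?B) \<and> (x \<notin> ?A \<longrightarrow> f x = 0)}"
    by (rule finite_set_of_finite_funs) (use assms in auto)
  ultimately show ?thesis by (rule finite_subset)
qed

text \<open>Series in all variables at once, restricted to exponents of finite support; the ring of
  the theorem is the subring \<open>R s\<close> below. This makes the ring operations total.\<close>

typedef (overloaded) 'a mps =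
    "{f :: ('a::field) ps. \<forall>\<alpha>. f \<alpha> \<noteq> 0 \<longrightarrow> finite {i. \<alpha> i \<noteq> 0}}"
  morphisms coeff Mps
  by (rule exI[of _ "\<lambda>_. 0"]) auto

setup_lifting type_definition_mps

lemma mps_eqI: "(\<And>\<alpha>. coeff f \<alpha> = coeff g \<alpha>) \<Longrightarrow> f = g"
  by (metis coeff_inject ext)

lemma coeff_infinite: "infinite {i. \<alpha> i \<noteq> 0} \<Longrightarrow> coeff f \<alpha> = 0"
  using coeff[of f] by blast

lemma le_mult_supp:
  fixes f g :: "('a::field) ps"
  assumes f: "\<forall>\<alpha>. f \<alpha> \<noteq> 0 \<longrightarrow> finite {i. \<alpha> i \<noteq> 0}"
    and g: "\<forall>\<alpha>. g \<alpha> \<noteq> 0 \<longrightarrow> finite {i. \<alpha> i \<noteq> 0}"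
    and nz: "ps_mult f g \<gamma> \<noteq> 0"
  shows "finite {i. \<gamma> i \<noteq> 0}"
proof -
  from nz obtain \<alpha> where "\<alpha> \<le> \<gamma>" "f \<alpha> \<noteq> 0" "g (\<lambda>i. \<gamma> i - \<alpha> i) \<noteq> 0"
    unfolding ps_mult_def by (metis (mono_tags, lifting) mem_Collect_eq mult_eq_0_iff sum.neutral)
  then have "finite ({i. \<alpha> i \<noteq> 0} \<union> {i. \<gamma> i - \<alpha> i \<noteq> 0})" using f g by blast
  then show ?thesis by (rule rev_finite_subset) auto
qed

lemma supp_add:
  assumes "\<And>\<alpha>. f \<alpha> \<noteq> 0 \<Longrightarrow> finite {i. \<alpha> i \<noteq> 0}" "\<And>\<alpha>. g \<alpha> \<noteq> 0 \<Longrightarrow> finite {i. \<alpha> i \<noteq> (0::nat)}"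
    and "ps_add f g \<alpha> \<noteq> 0"
  shows "finite {i. \<alpha> i \<noteq> (0::nat)}"
proof -
  have "f \<alpha> \<noteq> 0 \<or> g \<alpha> \<noteq> 0" using assms(3) by (auto simp: ps_add_def)
  then show ?thesis using assms(1,2) by blast
qed

lemma supp_sub:
  assumes "\<And>\<alpha>. f \<alpha> \<noteq> 0 \<Longrightarrow> finite {i. \<alpha> i \<noteq> 0}" "\<And>\<alpha>. g \<alpha> \<noteq> 0 \<Longrightarrow> finite {i. \<alpha> i \<noteq> (0::nat)}"
    and "ps_sub f g \<alpha> \<noteq> 0"
  shows "finite {i. \<alpha> i \<noteq> (0::nat)}"
proof -
  have "f \<alpha> \<noteq> 0 \<or> g \<alpha> \<noteq> 0" using assms(3) by (auto simp: ps_sub_def)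
  then show ?thesis using assms(1,2) by blast
qed

instantiation mps :: (field) comm_ring_1
begin

lift_definition zero_mps :: "'a mps" is ps_zero by (simp add: ps_zero_def)
lift_definition one_mps :: "'a mps" is ps_one by (auto simp: ps_one_def split: if_splits)
lift_definition plus_mps :: "'a mps \<Rightarrow> 'a mps \<Rightarrow> 'a mps" is ps_add
  using supp_add by blast
lift_definition minus_mps :: "'a mps \<Rightarrow> 'a mps \<Rightarrow> 'a mps" is ps_sub
  using supp_sub by blast
lift_definition uminus_mps :: "'a mps \<Rightarrow> 'a mps" is "\<lambda>f \<alpha>. - f \<alpha>" by auto
lift_definition times_mps :: "'a mps \<Rightarrow> 'a mps \<Rightarrow> 'a mps" is ps_mult
  using le_mult_supp by blast

instance
proof
  fix a b c :: "'a mps"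
  show "a + b + c = a + (b + c)" by (rule mps_eqI, transfer) (simp add: ps_add_def)
  show "a + b = b + a" by (rule mps_eqI, transfer) (simp add: ps_add_def)
  show "0 + a = a" by (rule mps_eqI, transfer) (simp add: ps_add_def ps_zero_def)
  show "- a + a = 0" by (rule mps_eqI, transfer) (simp add: ps_add_def ps_zero_def)
  show "a - b = a + - b" by (rule mps_eqI, transfer) (simp add: ps_add_def ps_sub_def)
  show "(0::'a mps) \<noteq> 1"
    by (auto simp: coeff_inject[symmetric] zero_mps.rep_eq one_mps.rep_eq ps_zero_def ps_one_def
        dest: fun_cong[where x = "\<lambda>_. 0"])
  show "(a + b) * c = a * c + b * c"
    by (rule mps_eqI) (simp add: times_mps.rep_eq plus_mps.rep_eq ps_add_def ps_mult_def
        distrib_right sum.distrib)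
  show "a * b = b * a"
  proof (rule mps_eqI)
    fix \<gamma>
    show "coeff (a * b) \<gamma> = coeff (b * a) \<gamma>"
      unfolding times_mps.rep_eq ps_mult_def
      by (rule sum.reindex_bij_witness[where i = "\<lambda>\<alpha> i. \<gamma> i - \<alpha> i" and j = "\<lambda>\<alpha> i. \<gamma> i - \<alpha> i"])
        (auto simp: le_fun_def mult.commute)
  qed
  show "1 * a = a"
  proof (rule mps_eqI)
    fix \<gamma>
    show "coeff (1 * a) \<gamma> = coeff a \<gamma>"
    proof (cases "finite {i. \<gamma> i \<noteq> 0}")
      case True
      have "coeff (1 * a) \<gamma>
          = (\<Sum>\<alpha>\<in>{\<alpha>. \<alpha> \<le> \<gamma>}. if \<alpha> = (\<lambda>_. 0) then coeff a \<gamma> else 0)"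
        unfolding times_mps.rep_eq one_mps.rep_eq ps_mult_def ps_one_def
        by (rule sum.cong) auto
      also have "\<dots> = coeff a \<gamma>" using finite_le_exponents[OF True]
        by (subst sum.delta) (auto simp: le_fun_def)
      finally show ?thesis .
    qed (simp add: coeff_infinite)
  qed
  show "a * b * c = a * (b * c)"
  proof (rule mps_eqI)
    fix \<gamma>
    show "coeff (a * b * c) \<gamma> = coeff (a * (b * c)) \<gamma>"
    proof (cases "finite {i. \<gamma> i \<noteq> 0}")
      case True
      have fin: "finite {\<alpha>. \<alpha> \<le> \<beta>}" if "\<beta> \<le> \<gamma>" for \<beta>
        by (rule finite_subset[OF _ finite_le_exponents[OF True]]) (use that in auto)
      have "coeff (a * b * c) \<gamma> = (\<Sum>\<alpha> | \<alpha> \<le> \<gamma>. \<Sum>\<beta> | \<beta> \<le> \<alpha>.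
               coeff a \<beta> * coeff b (\<lambda>i. \<alpha> i - \<beta> i) * coeff c (\<lambda>i. \<gamma> i - \<alpha> i))"
        unfolding times_mps.rep_eq ps_mult_def by (simp add: sum_distrib_right)
      also have "\<dots> = (\<Sum>(\<alpha>, \<beta>)\<in>(SIGMA \<alpha>:{\<alpha>. \<alpha> \<le> \<gamma>}. {\<beta>. \<beta> \<le> \<alpha>}).
               coeff a \<beta> * coeff b (\<lambda>i. \<alpha> i - \<beta> i) * coeff c (\<lambda>i. \<gamma> i - \<alpha> i))"
        by (rule sum.Sigma) (use fin in auto)
      also have "\<dots> = (\<Sum>(\<beta>, \<delta>)\<in>(SIGMA \<beta>:{\<beta>. \<beta> \<le> \<gamma>}. {\<delta>. \<delta> \<le> (\<lambda>i. \<gamma> i - \<beta> i)}).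
               coeff a \<beta> * (coeff b \<delta> * coeff c (\<lambda>i. \<gamma> i - \<beta> i - \<delta> i)))"
        apply (rule sum.reindex_bij_witness[where i = "\<lambda>(\<beta>, \<delta>). (\<lambda>i. \<beta> i + \<delta> i, \<beta>)"
              and j = "\<lambda>(\<alpha>, \<beta>). (\<beta>, \<lambda>i. \<alpha> i - \<beta> i)"])
        by (auto simp: le_fun_def le_diff_conv2 add.commute mult.assoc diff_le_mono
              intro!: ext intro: le_trans)
      also have "\<dots> = (\<Sum>\<beta> | \<beta> \<le> \<gamma>. \<Sum>\<delta> | \<delta> \<le> (\<lambda>i. \<gamma> i - \<beta> i).
               coeff a \<beta> * (coeff b \<delta> * coeff c (\<lambda>i. \<gamma> i - \<beta> i - \<delta> i)))"
        by (rule sum.Sigma[symmetric]) (auto intro!: fin le_funI)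
      also have "\<dots> = coeff (a * (b * c)) \<gamma>"
        unfolding times_mps.rep_eq ps_mult_def by (simp add: sum_distrib_left)
      finally show ?thesis .
    qed (simp add: coeff_infinite)
  qed
qed

end

section \<open>Constants, variables, partial derivatives and division by a variable\<close>

lift_definition Const :: "'a::field \<Rightarrow> 'a mps" is "\<lambda>c \<alpha>. if \<alpha> = (\<lambda>_. 0) then c else 0"
  by (auto split: if_splits)
lift_definition Var :: "nat \<Rightarrow> 'a::field mps" is "\<lambda>i \<alpha>. if \<alpha> = (\<lambda>_. 0)(i := 1) then 1 else 0"
  by (auto split: if_splits)
lemma supp_upd:
  assumes "\<And>\<alpha>. f \<alpha> \<noteq> 0 \<Longrightarrow> finite {i. \<alpha> i \<noteq> 0}" "f (\<alpha>(i := \<alpha> i + 1)) \<noteq> 0"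
  shows "finite {i. \<alpha> i \<noteq> (0::nat)}"
proof -
  have "finite {j. (\<alpha>(i := \<alpha> i + 1)) j \<noteq> 0}" using assms by blast
  then show ?thesis by (rule rev_finite_subset) auto
qed

lift_definition deriv :: "nat \<Rightarrow> 'a::field mps \<Rightarrow> 'a mps" is ps_deriv
  subgoal for i f \<alpha> using supp_upd[of f \<alpha> i] by (auto simp: ps_deriv_def)
  done
text \<open>The part of \<open>f\<close> whose monomials have \<open>x\<^sub>i\<close> as first variable, divided by \<open>x\<^sub>i\<close>.\<close>
lift_definition quot :: "nat \<Rightarrow> 'a::field mps \<Rightarrow> 'a mps"
  is "\<lambda>i f \<alpha>. if \<forall>j<i. \<alpha> j = 0 then f (\<alpha>(i := \<alpha> i + 1)) else 0"
  subgoal for i f \<alpha> using supp_upd[of f \<alpha> i] by (auto split: if_splits)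
  done

lemma coeff_zero [simp]: "coeff 0 \<alpha> = 0"
  by transfer (simp add: ps_zero_def)
lemma coeff_add [simp]: "coeff (f + g) \<alpha> = coeff f \<alpha> + coeff g \<alpha>"
  by transfer (simp add: ps_add_def)
lemma coeff_diff [simp]: "coeff (f - g) \<alpha> = coeff f \<alpha> - coeff g \<alpha>"
  by transfer (simp add: ps_sub_def)
lemma coeff_uminus [simp]: "coeff (- f) \<alpha> = - coeff f \<alpha>"
  by transfer simp
lemma coeff_sum [simp]: "coeff (sum f A) \<alpha> = (\<Sum>x\<in>A. coeff (f x) \<alpha>)"
  by (induction A rule: infinite_finite_induct) auto
lemma coeff_deriv: "coeff (deriv i f) \<alpha> = of_nat (\<alpha> i + 1) * coeff f (\<alpha>(i := \<alpha> i + 1))"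
  by transfer (simp add: ps_deriv_def)
lemma coeff_Const: "coeff (Const c) \<alpha> = (if \<alpha> = (\<lambda>_. 0) then c else 0)"
  by transfer simp
lemma coeff_mult: "coeff (f * g) \<gamma> = (\<Sum>\<alpha> | \<alpha> \<le> \<gamma>. coeff f \<alpha> * coeff g (\<lambda>i. \<gamma> i - \<alpha> i))"
  by transfer (simp add: ps_mult_def)

lemma coeff_Const_mult [simp]: "coeff (Const c * f) \<gamma> = c * coeff f \<gamma>"
proof (cases "finite {i. \<gamma> i \<noteq> 0}")
  case True
  have "coeff (Const c * f) \<gamma>
      = (\<Sum>\<alpha>\<in>{\<alpha>. \<alpha> \<le> \<gamma>}. if \<alpha> = (\<lambda>_. 0) then c * coeff f \<gamma> else 0)"
    unfolding coeff_mult coeff_Const by (rule sum.cong) auto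
  also have "\<dots> = c * coeff f \<gamma>" using finite_le_exponents[OF True]
    by (subst sum.delta) (auto simp: le_fun_def)
  finally show ?thesis .
qed (simp add: coeff_infinite)

lemma coeff_Var_mult:
  "coeff (Var i * f) \<gamma> = (if \<gamma> i = 0 then 0 else coeff f (\<gamma>(i := \<gamma> i - 1)))"
proof (cases "finite {i. \<gamma> i \<noteq> 0}")
  case True
  have "coeff (Var i * f) \<gamma>
      = (\<Sum>\<alpha>\<in>{\<alpha>. \<alpha> \<le> \<gamma>}. if \<alpha> = (\<lambda>_. 0)(i := 1) then coeff f (\<gamma>(i := \<gamma> i - 1)) else 0)"
    unfolding coeff_mult Var.rep_eq by (rule sum.cong) (auto intro!: arg_cong[where f = "coeff f"])
  also have "\<dots> = (if \<gamma> i = 0 then 0 else coeff f (\<gamma>(i := \<gamma> i - 1)))"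
    using finite_le_exponents[OF True] by (subst sum.delta) (auto simp: le_fun_def)
  finally show ?thesis .
next
  case False
  have "{j. \<gamma> j \<noteq> 0} \<subseteq> insert i {j. (\<gamma>(i := \<gamma> i - 1)) j \<noteq> 0}" by auto
  with False have "infinite {j. (\<gamma>(i := \<gamma> i - 1)) j \<noteq> 0}"
    by (meson finite_insert finite_subset)
  with False show ?thesis by (metis coeff_infinite)
qed

lemma Const_add: "Const (a + b) = Const a + Const b"
  by (rule mps_eqI) (simp add: coeff_Const)
lemma Const_mult: "Const (a * b) = Const a * Const b"
  by (rule mps_eqI) (simp add: coeff_Const)
lemma Const_0 [simp]: "Const 0 = 0"
  by (rule mps_eqI) (simp add: coeff_Const)
lemma Const_1 [simp]: "Const 1 = 1"
  by (rule mps_eqI) (simp add: coeff_Const one_mps.rep_eq ps_one_def)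

lemma deriv_add: "deriv i (f + g) = deriv i f + deriv i g"
  by (rule mps_eqI) (simp add: coeff_deriv algebra_simps)
lemma deriv_diff: "deriv i (f - g) = deriv i f - deriv i g"
  by (rule mps_eqI) (simp add: coeff_deriv algebra_simps)
lemma deriv_zero [simp]: "deriv i 0 = 0"
  by (rule mps_eqI) (simp add: coeff_deriv)
lemma deriv_sum: "deriv i (sum f A) = (\<Sum>x\<in>A. deriv i (f x))"
  by (induction A rule: infinite_finite_induct) (auto simp: deriv_add)
lemma deriv_Const_mult: "deriv i (Const c * f) = Const c * deriv i f"
  by (rule mps_eqI) (simp add: coeff_deriv distrib_left distrib_right mult.left_commute)
lemma deriv_Const [simp]: "deriv i (Const c) = 0"
proof (rule mps_eqI)
  fix \<alpha> :: "nat \<Rightarrow> nat"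
  have "\<alpha>(i := Suc (\<alpha> i)) \<noteq> (\<lambda>_. 0)" by (metis fun_upd_same nat.distinct(1))
  then show "coeff (deriv i (Const c)) \<alpha> = coeff 0 \<alpha>" by (simp add: coeff_deriv coeff_Const)
qed
lemma deriv_Var_mult:
  "deriv i (Var j * f) = (if i = j then f else 0) + Var j * deriv i f"
proof (rule mps_eqI)
  fix \<alpha> :: "nat \<Rightarrow> nat"
  show "coeff (deriv i (Var j * f)) \<alpha> = coeff ((if i = j then f else 0) + Var j * deriv i f) \<alpha>"
    by (cases "\<alpha> j"; cases "i = j")
      (auto simp: coeff_deriv coeff_Var_mult distrib_left distrib_right fun_upd_twist fun_upd_idem)
qed
lemma deriv_Var: "deriv i (Var j :: 'a::field mps) = (if i = j then 1 else 0)"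
  using deriv_Var_mult[of i j "1::'a mps"] deriv_Const[of i "1::'a::field"] by simp

subsection \<open>Order filtration and coefficient ring\<close>

text \<open>The power m^n of the theorem is \<open>R s \<inter> M s n\<close>. Order and membership
  in \<open>R s\<close> are kept apart so that order estimates need no membership conditions. As
  \<open>deg s \<alpha>\<close> is a natural number for every \<alpha>, the filtration is separated
  on the whole type.\<close>

definition M :: "nat \<Rightarrow> nat \<Rightarrow> ('a::field) mps set" where
  "M s n = {f. \<forall>\<alpha>. deg s \<alpha> < n \<longrightarrow> coeff f \<alpha> = 0}"

definition R :: "nat \<Rightarrow> ('a::field) mps set" where
  "R s = {f. \<forall>\<alpha>. coeff f \<alpha> \<noteq> 0 \<longrightarrow> \<alpha> \<in> mons s}"

lemma M_zero_idx [simp]: "M s 0 = UNIV" by (auto simp: M_def)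
lemma M_0 [simp]: "0 \<in> M s n" by (auto simp: M_def)
lemma M_add: "f \<in> M s n \<Longrightarrow> g \<in> M s n \<Longrightarrow> f + g \<in> M s n" by (auto simp: M_def)
lemma M_diff: "f \<in> M s n \<Longrightarrow> g \<in> M s n \<Longrightarrow> f - g \<in> M s n" by (auto simp: M_def)
lemma M_uminus: "f \<in> M s n \<Longrightarrow> - f \<in> M s n" by (auto simp: M_def)
lemma M_sum: "(\<And>x. x \<in> A \<Longrightarrow> f x \<in> M s n) \<Longrightarrow> sum f A \<in> M s n"
  by (auto simp: M_def intro!: sum.neutral)
lemma M_antimono: "f \<in> M s n \<Longrightarrow> m \<le> n \<Longrightarrow> f \<in> M s m" by (auto simp: M_def)
lemma M_separated: "(\<And>n. f \<in> M s n) \<Longrightarrow> f = 0"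
  by (rule mps_eqI) (auto simp: M_def)

lemma deg_diff: "\<alpha> \<le> \<gamma> \<Longrightarrow> deg s \<gamma> = deg s \<alpha> + deg s (\<lambda>i. \<gamma> i - \<alpha> i)"
  by (auto simp: deg_def le_fun_def sum.distrib[symmetric])

lemma M_mult:
  assumes "f \<in> M s m" "g \<in> M s n"
  shows "f * g \<in> M s (m + n)"
proof -
  have "coeff f \<alpha> * coeff g (\<lambda>i. \<gamma> i - \<alpha> i) = 0" if "deg s \<gamma> < m + n" "\<alpha> \<le> \<gamma>" for \<alpha> \<gamma>
  proof -
    have "deg s \<alpha> < m \<or> deg s (\<lambda>i. \<gamma> i - \<alpha> i) < n" using deg_diff[OF that(2), of s] that by linarith
    with assms show ?thesis by (auto simp: M_def)
  qed
  then show ?thesis by (auto simp: M_def coeff_mult intro!: sum.neutral)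
qed

lemma M_multI: "f \<in> M s m \<Longrightarrow> g \<in> M s n \<Longrightarrow> k \<le> m + n \<Longrightarrow> f * g \<in> M s k"
  using M_mult M_antimono by blast
lemma M_mult_right: "f \<in> M s m \<Longrightarrow> f * g \<in> M s m" by (rule M_multI[where n = 0]) auto
lemma M_mult_left: "g \<in> M s m \<Longrightarrow> f * g \<in> M s m" by (rule M_multI[where m = 0]) auto
lemma M_power: "f \<in> M s 1 \<Longrightarrow> f ^ n \<in> M s n"
  by (induction n) (auto intro: M_multI)

lemma R_0 [simp]: "0 \<in> R s" by (auto simp: R_def)
lemma R_Const [simp]: "Const c \<in> R s" by (auto simp: R_def coeff_Const mons_def split: if_splits)
lemma R_1 [simp]: "1 \<in> R s" using R_Const[of 1 s] by simp
lemma R_add: "f \<in> R s \<Longrightarrow> g \<in> R s \<Longrightarrow> f + g \<in> R s"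
  unfolding R_def mem_Collect_eq coeff_add by (metis add_0 diff_self)
lemma R_diff: "f \<in> R s \<Longrightarrow> g \<in> R s \<Longrightarrow> f - g \<in> R s"
  unfolding R_def mem_Collect_eq coeff_diff by (metis add_0 diff_self)
lemma R_uminus: "f \<in> R s \<Longrightarrow> - f \<in> R s" by (auto simp: R_def)
lemma R_sum: "(\<And>x. x \<in> A \<Longrightarrow> f x \<in> R s) \<Longrightarrow> sum f A \<in> R s"
  by (induction A rule: infinite_finite_induct) (auto intro: R_add)
lemma R_mult: "f \<in> R s \<Longrightarrow> g \<in> R s \<Longrightarrow> f * g \<in> R s"
proof -
  assume f: "f \<in> R s" and g: "g \<in> R s"
  have "\<gamma> \<in> mons s" if "coeff (f * g) \<gamma> \<noteq> 0" for \<gamma>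
  proof -
    from that obtain \<alpha> where a: "\<alpha> \<le> \<gamma>" "coeff f \<alpha> \<noteq> 0" "coeff g (\<lambda>i. \<gamma> i - \<alpha> i) \<noteq> 0"
      unfolding coeff_mult by (metis (mono_tags, lifting) mem_Collect_eq mult_eq_0_iff sum.neutral)
    then have "\<alpha> \<in> mons s" "(\<lambda>i. \<gamma> i - \<alpha> i) \<in> mons s" using f g by (auto simp: R_def)
    then show ?thesis using a(1) by (auto simp: mons_def le_fun_def)
  qed
  then show ?thesis by (auto simp: R_def)
qed
lemma R_power: "f \<in> R s \<Longrightarrow> f ^ n \<in> R s" by (induction n) (auto intro: R_mult)
lemma R_prod: "(\<And>x. x \<in> A \<Longrightarrow> f x \<in> R s) \<Longrightarrow> prod f A \<in> R s"
  by (induction A rule: infinite_finite_induct) (auto intro: R_mult)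
lemma R_Var [simp]: "i < s \<Longrightarrow> Var i \<in> R s"
  by (auto simp: R_def Var.rep_eq mons_def split: if_splits)
lemma R_deriv: "i < s \<Longrightarrow> f \<in> R s \<Longrightarrow> deriv i f \<in> R s"
  by (fastforce simp: R_def coeff_deriv mons_def)

lemmas R_intros = R_add R_diff R_uminus R_sum R_mult R_power R_prod R_deriv

lemma deg_upd: "i < s \<Longrightarrow> deg s (\<alpha>(i := Suc (\<alpha> i))) = Suc (deg s \<alpha>)"
  by (simp add: deg_def sum.remove[of "{..<s}" i])

lemma R_quot: "i < s \<Longrightarrow> f \<in> R s \<Longrightarrow> quot i f \<in> R s"
  by (fastforce simp: R_def quot.rep_eq mons_def split: if_splits)
lemma M_quot: "i < s \<Longrightarrow> f \<in> M s (Suc n) \<Longrightarrow> quot i f \<in> M s n"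
  by (auto simp: M_def quot.rep_eq deg_upd)
lemma M_deriv: "i < s \<Longrightarrow> f \<in> M s (Suc n) \<Longrightarrow> deriv i f \<in> M s n"
  by (auto simp: M_def coeff_deriv deg_upd)
lemma M_Var: "i < s \<Longrightarrow> Var i \<in> M s 1"
  by (auto simp: M_def Var.rep_eq deg_def)
lemmas M_Var' = M_Var[unfolded One_nat_def]
lemma M_1_iff: "f \<in> R s \<Longrightarrow> f \<in> M s 1 \<longleftrightarrow> coeff f (\<lambda>_. 0) = 0"
proof -
  assume f: "f \<in> R s"
  have "\<alpha> = (\<lambda>_. 0)" if "deg s \<alpha> = 0" "coeff f \<alpha> \<noteq> 0" for \<alpha>
  proof
    fix i
    have "\<alpha> \<in> mons s" using that f by (auto simp: R_def)
    then show "\<alpha> i = 0" using that by (cases "i < s") (auto simp: deg_def mons_def)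
  qed
  then have "coeff f \<alpha> = 0" if "coeff f (\<lambda>_. 0) = 0" "deg s \<alpha> = 0" for \<alpha> using that by blast
  moreover have "deg s (\<lambda>_. 0) = 0" by (simp add: deg_def)
  ultimately show ?thesis by (auto simp: M_def)
qed

text \<open>Each nonconstant monomial is accounted for once, at its first variable. This is the
  induction step for claims about all power series: a claim to order n + 1 about \<open>f\<close> is
  reduced to order n for the \<open>quot i f\<close>.\<close>

lemma expand:
  assumes f: "f \<in> R s"
  shows "f = Const (coeff f (\<lambda>_. 0)) + (\<Sum>i<s. Var i * quot i f)"
proof (rule mps_eqI)
  fix \<gamma> :: "nat \<Rightarrow> nat"
  have co: "coeff (\<Sum>i<s. Var i * quot i f) \<gamma>
      = (\<Sum>i<s. if \<gamma> i \<noteq> 0 \<and> (\<forall>j<i. \<gamma> j = 0) then coeff f \<gamma> else 0)"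
    unfolding coeff_sum by (rule sum.cong) (auto simp: coeff_Var_mult quot.rep_eq)
  show "coeff f \<gamma> = coeff (Const (coeff f (\<lambda>_. 0)) + (\<Sum>i<s. Var i * quot i f)) \<gamma>"
  proof (cases "\<gamma> = (\<lambda>_. 0)")
    case True
    then show ?thesis unfolding coeff_add co by (simp add: coeff_Const)
  next
    case False
    define k where "k = (LEAST i. \<gamma> i \<noteq> 0)"
    have "\<exists>i. \<gamma> i \<noteq> 0" using False by (simp add: fun_eq_iff)
    then have k: "\<gamma> k \<noteq> 0" unfolding k_def by (rule LeastI_ex)
    have k': "\<gamma> j = 0" if "j < k" for j
      using not_less_Least[OF that[unfolded k_def]] by simp
    have *: "(\<gamma> i \<noteq> 0 \<and> (\<forall>j<i. \<gamma> j = 0)) \<longleftrightarrow> i = k" for i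
      by (metis k k' linorder_neqE_nat)
    have "coeff (\<Sum>i<s. Var i * quot i f) \<gamma> = (if k < s then coeff f \<gamma> else 0)"
      unfolding co * by (subst sum.delta) auto
    moreover have "coeff f \<gamma> = 0" if "\<not> k < s"
    proof -
      have "\<gamma> \<notin> mons s"
      proof
        assume "\<gamma> \<in> mons s"
        moreover have "s \<le> k" using that by (rule leI)
        ultimately have "\<gamma> k = 0" unfolding mons_def by blast
        with k show False by blast
      qed
      then show ?thesis using f unfolding R_def by blast
    qed
    ultimately show ?thesis using False unfolding coeff_add coeff_Const by auto
  qed
qed

lemma expand_M:
  assumes "f \<in> R s" "f \<in> M s (Suc n)"
  shows "f = (\<Sum>i<s. Var i * quot i f)"
proof -
  have "coeff f (\<lambda>_. 0) = 0" using assms(2) by (auto simp: M_def deg_def)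
  with expand[OF assms(1)] show ?thesis by simp
qed

text \<open>An additive map that multiplies \<open>x\<^sub>j h\<close> by something of positive order
  is determined by its values on constants; this replaces arguments by continuity.\<close>

lemma deriv_mult:
  assumes "f \<in> R s" "g \<in> R s"
  shows "deriv i (f * g) = f * deriv i g + deriv i f * g"
proof -
  \<comment> \<open>The defect of the product rule, additive in \<open>f\<close> for fixed
    \<open>g\<close>. It vanishes on constants and satisfies L (Var j * q) = Var j * L q, so every
    use of \<open>expand\<close> raises its order by one.\<close>
  define L where "L f = deriv i (f * g) - f * deriv i g - deriv i f * g" for f
  have "\<forall>f\<in>R s. L f \<in> M s n" for n
  proof (induction n)
    case (Suc n)
    show ?case
    proof
      fix f :: "'a mps" assume f: "f \<in> R s"
      have "L f = L (Const (coeff f (\<lambda>_. 0)) + (\<Sum>j<s. Var j * quot j f))"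
        using expand[OF f] by simp
      also have "\<dots> = L (Const (coeff f (\<lambda>_. 0))) + (\<Sum>j<s. L (Var j * quot j f))"
        by (simp add: L_def deriv_add deriv_sum distrib_right sum_distrib_right sum_subtractf)
      also have "\<dots> = (\<Sum>j<s. Var j * L (quot j f))"
      proof -
        have "L (Const c) = 0" for c by (simp add: L_def deriv_Const_mult)
        moreover have "L (Var j * q) = Var j * L q" for j q
        proof -
          have "Var j * q * g = Var j * (q * g)" by (rule mult.assoc)
          then show ?thesis unfolding L_def deriv_Var_mult
            by (simp add: deriv_Var_mult distrib_right right_diff_distrib mult.assoc)
        qed
        ultimately show ?thesis by simp
      qed
      also have "\<dots> \<in> M s (Suc n)"
        using Suc f by (intro M_sum M_multI[OF M_Var]) (auto intro: R_quot)
      finally show "L f \<in> M s (Suc n)" .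
    qed
  qed simp
  then have "L f = 0" using assms(1) by (intro M_separated) blast
  then show ?thesis by (simp add: L_def algebra_simps)
qed

section \<open>Limits and inverses of units\<close>

definition lim :: "nat \<Rightarrow> (nat \<Rightarrow> ('a::field) mps) \<Rightarrow> 'a mps" where
  "lim s u = Mps (\<lambda>\<gamma>. coeff (u (Suc (deg s \<gamma>))) \<gamma>)"

lemma coeff_lim: "coeff (lim s u) \<gamma> = coeff (u (Suc (deg s \<gamma>))) \<gamma>"
  unfolding lim_def using coeff_infinite by (subst Mps_inverse) auto

text \<open>The hypothesis fixes all coefficients of degree below n from \<open>u n\<close> on. A
  coefficient of degree d is therefore stable from index d + 1, which is the index that
  \<open>lim\<close> reads off.\<close>

lemma lim_diff:
  assumes u: "\<And>n. u (Suc n) - u n \<in> M s n"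
  shows "lim s u - u n \<in> M s n"
proof -
  have *: "u n - u m \<in> M s m" if "m \<le> n" for m n
    using that
  proof (induction n rule: dec_induct)
    case (step n)
    have "u (Suc n) - u n \<in> M s m" using u step.hyps(1) M_antimono by blast
    from M_add[OF this step.IH] show ?case by simp
  qed simp
  show ?thesis unfolding M_def
  proof safe
    fix \<gamma> assume "deg s \<gamma> < n"
    then have "u n - u (Suc (deg s \<gamma>)) \<in> M s (Suc (deg s \<gamma>))" by (intro *) simp
    then show "coeff (lim s u - u n) \<gamma> = 0" by (auto simp: M_def coeff_lim)
  qed
qed

lemma lim_R: "(\<And>n. u n \<in> R s) \<Longrightarrow> lim s u \<in> R s"
  by (auto simp: R_def coeff_lim)

lemma one_minus_inverse:
  assumes "f \<in> R s" "f \<in> M s 1"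
  shows "\<exists>u\<in>R s. (1 - f) * u = 1"
proof
  define u where "u n = (\<Sum>i<n. f ^ i)" for n
  have "lim s u - u n \<in> M s n" for n
    by (rule lim_diff) (use assms in \<open>simp add: u_def M_power\<close>)
  then have *: "(1 - f) * (lim s u - u n) \<in> M s n" for n by (rule M_mult_left)
  have "(1 - f) * lim s u - 1 \<in> M s n" for n
  proof -
    have "(1 - f) * u n = 1 - f ^ n" by (simp add: u_def one_diff_power_eq)
    then have "(1 - f) * lim s u - 1 = (1 - f) * (lim s u - u n) - f ^ n"
      by (simp add: right_diff_distrib)
    then show ?thesis using *[of n] M_power[OF assms(2)] by (auto intro: M_diff)
  qed
  then have "(1 - f) * lim s u - 1 = 0" by (rule M_separated)
  then show "(1 - f) * lim s u = 1" by simp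
  show "lim s u \<in> R s" by (rule lim_R) (auto simp: u_def intro!: R_intros assms)
qed

lemma unit_inverse:
  assumes f: "f \<in> R s" and nz: "coeff f (\<lambda>_. 0) \<noteq> 0"
  shows "\<exists>u\<in>R s. f * u = 1"
proof -
  define c where "c = coeff f (\<lambda>_. 0)"
  define h where "h = 1 - Const (1 / c) * f"
  have h: "h \<in> R s" unfolding h_def by (intro R_intros f R_1 R_Const)
  have "coeff h (\<lambda>_. 0) = 0"
    using nz by (simp add: h_def c_def one_mps.rep_eq ps_one_def)
  then have "h \<in> M s 1" using M_1_iff[OF h] by simp
  from one_minus_inverse[OF h this] obtain u where u: "u \<in> R s" "(1 - h) * u = 1" by blast
  then have "f * (Const (1 / c) * u) = 1" by (simp add: h_def mult_ac)
  moreover have "Const (1 / c) * u \<in> R s" by (intro R_intros u R_Const)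
  ultimately show ?thesis by blast
qed

subsection \<open>Ideals\<close>

definition idl :: "nat \<Rightarrow> ('a::field) mps set \<Rightarrow> bool" where
  "idl s I \<longleftrightarrow> I \<subseteq> R s \<and> 0 \<in> I \<and> (\<forall>f\<in>I. \<forall>g\<in>I. f + g \<in> I) \<and> (\<forall>r\<in>R s. \<forall>f\<in>I. r * f \<in> I)"

lemma idl_R: "idl s I \<Longrightarrow> f \<in> I \<Longrightarrow> f \<in> R s" by (auto simp: idl_def)
lemma idl_0: "idl s I \<Longrightarrow> 0 \<in> I" by (auto simp: idl_def)
lemma idl_add: "idl s I \<Longrightarrow> f \<in> I \<Longrightarrow> g \<in> I \<Longrightarrow> f + g \<in> I" by (auto simp: idl_def)
lemma idl_mult: "idl s I \<Longrightarrow> r \<in> R s \<Longrightarrow> f \<in> I \<Longrightarrow> r * f \<in> I" by (auto simp: idl_def)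
lemma idl_mult': "idl s I \<Longrightarrow> r \<in> R s \<Longrightarrow> f \<in> I \<Longrightarrow> f * r \<in> I"
  using idl_mult by (metis mult.commute)
lemma idl_uminus: "idl s I \<Longrightarrow> f \<in> I \<Longrightarrow> - f \<in> I"
  using idl_mult[of s I "-1" f] by (simp add: R_uminus)
lemma idl_diff: "idl s I \<Longrightarrow> f \<in> I \<Longrightarrow> g \<in> I \<Longrightarrow> f - g \<in> I"
  using idl_add[of s I f "-g"] idl_uminus by auto
lemma idl_sum: "idl s I \<Longrightarrow> (\<And>x. x \<in> A \<Longrightarrow> f x \<in> I) \<Longrightarrow> sum f A \<in> I"
  by (induction A rule: infinite_finite_induct) (auto intro: idl_0 idl_add)
lemma idl_unit: "idl s I \<Longrightarrow> 1 \<in> I \<Longrightarrow> f \<in> R s \<Longrightarrow> f \<in> I"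
  using idl_mult[of s I f 1] by simp

text \<open>The ideal I + m^n. Limit arguments yield membership only in these ideals, one n at a
  time; \<open>nakayama_M\<close> is the means of getting back to I itself.\<close>

definition plusM :: "nat \<Rightarrow> ('a::field) mps set \<Rightarrow> nat \<Rightarrow> 'a mps set" where
  "plusM s I n = {f + g |f g. f \<in> I \<and> g \<in> R s \<inter> M s n}"

lemma plusMI: "f \<in> I \<Longrightarrow> g \<in> R s \<Longrightarrow> g \<in> M s n \<Longrightarrow> f + g \<in> plusM s I n"
  by (auto simp: plusM_def)
lemma plusM_I: "f \<in> I \<Longrightarrow> f \<in> plusM s I n"
  using plusMI[of f I 0] by simp
lemma plusM_M: "idl s I \<Longrightarrow> f \<in> R s \<Longrightarrow> f \<in> M s n \<Longrightarrow> f \<in> plusM s I n"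
  using plusMI[of 0 I f] by (simp add: idl_0)
lemma plusM_diff_iff:
  "idl s I \<Longrightarrow> f - g \<in> I \<Longrightarrow> g \<in> plusM s I n \<Longrightarrow> f \<in> plusM s I n"
proof -
  assume I: "idl s I" "f - g \<in> I" and "g \<in> plusM s I n"
  then obtain a b where "g = a + b" "a \<in> I" "b \<in> R s" "b \<in> M s n" by (auto simp: plusM_def)
  moreover from this have "f = (f - g + a) + b" by simp
  moreover have "f - g + a \<in> I" by (rule idl_add) (use I \<open>a \<in> I\<close> in auto)
  ultimately show ?thesis using plusMI by metis
qed

lemma idl_plusM:
  assumes I: "idl s I"
  shows "idl s (plusM s I n)"
  unfolding idl_def
proof (intro conjI ballI subsetI)
  show "f \<in> R s" if "f \<in> plusM s I n" for f
    using that idl_R[OF I] by (auto simp: plusM_def intro: R_add)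
  show "0 \<in> plusM s I n" by (rule plusM_I[OF idl_0[OF I]])
  fix f assume f: "f \<in> plusM s I n"
  then obtain a b where ab: "f = a + b" "a \<in> I" "b \<in> R s" "b \<in> M s n"
    by (auto simp: plusM_def)
  show "r * f \<in> plusM s I n" if "r \<in> R s" for r
    unfolding ab distrib_left using ab that I by (intro plusMI) (auto intro: idl_mult R_mult M_mult_left)
  fix g assume "g \<in> plusM s I n"
  then obtain c d where cd: "g = c + d" "c \<in> I" "d \<in> R s" "d \<in> M s n"
    by (auto simp: plusM_def)
  have "f + g = (a + c) + (b + d)" by (simp add: ab cd)
  then show "f + g \<in> plusM s I n"
    using plusMI[OF idl_add[OF I ab(2) cd(2)] R_add[OF ab(3) cd(3)] M_add[OF ab(4) cd(4)]] by simp
qed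

lemma plusM_mult_Suc:
  assumes J: "idl s J" and "r \<in> R s" "r \<in> M s 1" "x \<in> plusM s J n"
  shows "r * x \<in> plusM s J (Suc n)"
proof -
  obtain p q where "x = p + q" "p \<in> J" "q \<in> R s" "q \<in> M s n" using assms by (auto simp: plusM_def)
  then show ?thesis using assms
    by (auto simp: distrib_left intro!: plusMI idl_mult R_mult M_multI[where m = 1 and n = n])
qed

section \<open>Nakayama's lemma for powers of the maximal ideal\<close>

text \<open>Nakayama's lemma, by successive elimination of the \<open>x\<^sub>k\<close>.\<close>

lemma nakayama_family:
  assumes I: "idl s I" and "finite F"
    and "\<And>k. k \<in> F \<Longrightarrow> x k - (\<Sum>l\<in>F. m k l * x l) \<in> I"
    and "\<And>k l. k \<in> F \<Longrightarrow> l \<in> F \<Longrightarrow> m k l \<in> R s \<inter> M s 1"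
    and "k \<in> F"
  shows "x k \<in> I"
  using assms(2-)
proof (induction F arbitrary: m k rule: finite_induct)
  case (insert k0 F)
  note rel = insert.prems(1) and mR = insert.prems(2)
  obtain u where u: "u \<in> R s" "(1 - m k0 k0) * u = 1"
    using one_minus_inverse mR[of k0 k0] by auto
  define i0 where "i0 = x k0 - (\<Sum>l\<in>insert k0 F. m k0 l * x l)"
  have i0: "i0 \<in> I" unfolding i0_def by (rule rel) simp
  have x0: "x k0 = u * i0 + (\<Sum>l\<in>F. u * m k0 l * x l)"
  proof -
    have "(1 - m k0 k0) * x k0 = i0 + (\<Sum>l\<in>F. m k0 l * x l)"
      using insert.hyps by (simp add: i0_def algebra_simps)
    then have "((1 - m k0 k0) * u) * x k0 = u * (i0 + (\<Sum>l\<in>F. m k0 l * x l))"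
      by (metis mult.assoc mult.commute)
    then show ?thesis by (simp add: u distrib_left sum_distrib_left mult.assoc)
  qed
  have inF: "x k \<in> I" if "k \<in> F" for k
  \<comment> \<open>The matrix obtained by substituting the formula \<open>x0\<close> for
    \<open>x k0\<close> into the remaining relations. Its entries still have positive order.\<close>
  proof (rule insert.IH[of "\<lambda>k l. m k l + m k k0 * (u * m k0 l)"])
    fix k assume k: "k \<in> F"
    define i where "i = x k - (\<Sum>l\<in>insert k0 F. m k l * x l)"
    have "i \<in> I" unfolding i_def by (rule rel) (use k in simp)
    have "x k - (\<Sum>l\<in>F. (m k l + m k k0 * (u * m k0 l)) * x l)
        = i + m k k0 * x k0 - m k k0 * (\<Sum>l\<in>F. u * m k0 l * x l)"
      using insert.hyps
      by (simp add: i_def distrib_right sum.distrib sum_distrib_left mult.assoc algebra_simps)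
    also have "\<dots> = i + m k k0 * (u * i0)" by (subst x0) (simp add: algebra_simps)
    finally show "x k - (\<Sum>l\<in>F. (m k l + m k k0 * (u * m k0 l)) * x l) \<in> I"
      using mR[of k k0] k \<open>i \<in> I\<close> i0 u I by (auto intro!: idl_add idl_mult)
    fix l assume l: "l \<in> F"
    show "m k l + m k k0 * (u * m k0 l) \<in> R s \<inter> M s 1"
      using mR[of k k0] mR[of k l] mR[of k0 l] k l u
      by (auto intro!: R_intros M_add M_mult_left)
  qed (use that in auto)
  have "x k0 \<in> I"
    unfolding x0 using mR u i0 I inF by (auto intro!: idl_add idl_mult idl_sum R_mult)
  with inF insert.prems(3) show ?case by auto
qed simp

text \<open>Finite generation of m^n, as needed for \<open>nakayama_family\<close>. Multiplying
  generators of m^n by the variables gives generators of m^(n+1), by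
  \<open>expand_M\<close>.\<close>

lemma M_generators:
  "\<exists>G. finite G \<and> G \<subseteq> R s \<inter> M s n \<and> (\<forall>f \<in> R s \<inter> M s n. \<exists>r. (\<forall>g\<in>G. r g \<in> R s) \<and>
     f = (\<Sum>g\<in>G. r g * (g :: 'a::field mps)))"
proof (induction n)
  case 0
  show ?case by (rule exI[of _ "{1}"]) auto
next
  case (Suc n)
  then obtain G where G: "finite G" "G \<subseteq> R s \<inter> M s n"
    "\<And>f. f \<in> R s \<inter> M s n \<Longrightarrow> \<exists>r. (\<forall>g\<in>G. r g \<in> R s) \<and> f = (\<Sum>g\<in>G. r g * (g :: 'a mps))"
    by blast
  let ?H = "(\<lambda>(i, g). Var i * g) ` ({..<s} \<times> G)"
  show ?case
  proof (intro exI[of _ ?H] conjI ballI)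
    show "finite ?H" using G by auto
    show "?H \<subseteq> R s \<inter> M s (Suc n)"
      using G(2) by (auto intro!: R_mult M_multI[OF M_Var])
    fix f :: "'a mps" assume f: "f \<in> R s \<inter> M s (Suc n)"
    then have "\<forall>i<s. \<exists>r. (\<forall>g\<in>G. r g \<in> R s) \<and> quot i f = (\<Sum>g\<in>G. r g * g)"
      by (auto intro!: G(3) intro: R_quot M_quot)
    then obtain r where r: "\<And>i g. i < s \<Longrightarrow> g \<in> G \<Longrightarrow> r i g \<in> R s"
      "\<And>i. i < s \<Longrightarrow> quot i f = (\<Sum>g\<in>G. r i g * g)" by metis
    have "f = (\<Sum>i<s. \<Sum>g\<in>G. r i g * (Var i * g))"
      using f by (subst expand_M[of f s n]) (auto simp: r sum_distrib_left mult_ac intro!: sum.cong)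
    also have "\<dots> = (\<Sum>(i, g)\<in>{..<s} \<times> G. r i g * (Var i * g))"
      by (rule sum.cartesian_product)
    \<comment> \<open>Different pairs (i, g) may have the same product, so their coefficients are
      collected over the fibres of the product map.\<close>
    also have "\<dots> = (\<Sum>h\<in>?H. \<Sum>p\<in>{p \<in> {..<s} \<times> G. (\<lambda>(i, g). Var i * g) p = h}.
        (\<lambda>(i, g). r i g * (Var i * g)) p)"
      by (rule sum.image_gen) (use G in auto)
    also have "\<dots> = (\<Sum>h\<in>?H. (\<Sum>p\<in>{p \<in> {..<s} \<times> G. (\<lambda>(i, g). Var i * g) p = h}.
        (\<lambda>(i, g). r i g) p) * h)"
      by (rule sum.cong) (auto simp: sum_distrib_right intro!: sum.cong)
    finally have "f = (\<Sum>h\<in>?H. (\<Sum>p\<in>{p \<in> {..<s} \<times> G. (\<lambda>(i, g). Var i * g) p = h}.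
        (\<lambda>(i, g). r i g) p) * h)" .
    then show "\<exists>r. (\<forall>g\<in>?H. r g \<in> R s) \<and> f = (\<Sum>g\<in>?H. r g * g)"
      using r(1) by (intro exI conjI) (auto intro!: R_sum)
  qed
qed

text \<open>Since m^(n+1) is m times m^n, each generator of m^n is congruent modulo \<open>I\<close>
  to a combination of the generators with coefficients in m, which is the situation of
  \<open>nakayama_family\<close>.\<close>

lemma nakayama_M:
  assumes I: "idl s (I :: 'a::field mps set)" and sub: "R s \<inter> M s n \<subseteq> plusM s I (Suc n)"
  shows "R s \<inter> M s n \<subseteq> I"
proof -
  obtain G where G: "finite G" "G \<subseteq> R s \<inter> M s n"
    "\<And>f. f \<in> R s \<inter> M s n \<Longrightarrow> \<exists>r. (\<forall>g\<in>G. r g \<in> R s) \<and> f = (\<Sum>g\<in>G. r g * (g :: 'a mps))"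
    using M_generators[of s n] by (elim exE conjE) blast
  have "\<exists>m. (\<forall>l\<in>G. m l \<in> R s \<inter> M s 1) \<and> k - (\<Sum>l\<in>G. m l * l) \<in> I" if "k \<in> G" for k
  proof -
    obtain a b where ab: "k = a + b" "a \<in> I" "b \<in> R s" "b \<in> M s (Suc n)"
      using subsetD[OF sub subsetD[OF G(2) \<open>k \<in> G\<close>]] by (auto simp: plusM_def)
    have "\<forall>i<s. \<exists>r. (\<forall>g\<in>G. r g \<in> R s) \<and> quot i b = (\<Sum>g\<in>G. r g * g)"
      using ab by (auto intro!: G(3) intro: R_quot M_quot)
    then obtain r where r: "\<And>i g. i < s \<Longrightarrow> g \<in> G \<Longrightarrow> r i g \<in> R s"
      "\<And>i. i < s \<Longrightarrow> quot i b = (\<Sum>g\<in>G. r i g * g)" by metis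
    have "b = (\<Sum>i<s. \<Sum>g\<in>G. Var i * r i g * g)"
      using ab by (subst expand_M[of b s n]) (auto simp: r sum_distrib_left mult_ac intro!: sum.cong)
    also have "\<dots> = (\<Sum>g\<in>G. (\<Sum>i<s. Var i * r i g) * g)"
      by (subst sum.swap) (simp add: sum_distrib_right)
    finally have "k - (\<Sum>g\<in>G. (\<Sum>i<s. Var i * r i g) * g) = a" using ab by simp
    then show ?thesis using ab r
      by (intro exI[of _ "\<lambda>g. \<Sum>i<s. Var i * r i g"])
        (auto intro!: R_intros M_sum M_mult_right M_Var')
  qed
  then obtain m where m: "\<And>k l. k \<in> G \<Longrightarrow> l \<in> G \<Longrightarrow> m k l \<in> R s \<inter> M s 1"
    "\<And>k. k \<in> G \<Longrightarrow> k - (\<Sum>l\<in>G. m k l * l) \<in> I" by metis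
  have GI: "k \<in> I" if "k \<in> G" for k
    using nakayama_family[OF I G(1), of "\<lambda>k. k" m k] m that by auto
  show ?thesis
  proof
    fix f :: "'a mps" assume "f \<in> R s \<inter> M s n"
    then obtain r where "\<forall>g\<in>G. r g \<in> R s" "f = (\<Sum>g\<in>G. r g * g)" using G(3) by blast
    then show "f \<in> I" using GI I by (auto intro!: idl_sum idl_mult)
  qed
qed

subsection \<open>Substitution\<close>

definition exps :: "nat \<Rightarrow> nat \<Rightarrow> (nat \<Rightarrow> nat) set" where
  "exps s N = {\<alpha> \<in> mons s. deg s \<alpha> < N}"

lemma finite_exps: "finite (exps s N)"
proof -
  have "\<alpha> x \<le> N" if "\<alpha> \<in> exps s N" "x < s" for \<alpha> x
    using that member_le_sum[of x "{..<s}" \<alpha>] by (auto simp: exps_def deg_def)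
  then have "exps s N \<subseteq> {f. \<forall>x. (x \<in> {..<s} \<longrightarrow> f x \<in> {..N}) \<and> (x \<notin> {..<s} \<longrightarrow> f x = 0)}"
    by (auto simp: exps_def mons_def)
  moreover have "finite \<dots>" by (rule finite_set_of_finite_funs) auto
  ultimately show ?thesis by (rule finite_subset)
qed

definition ymon :: "nat \<Rightarrow> (nat \<Rightarrow> 'a::field mps) \<Rightarrow> (nat \<Rightarrow> nat) \<Rightarrow> 'a mps" where
  "ymon s y \<alpha> = (\<Prod>i<s. y i ^ \<alpha> i)"

text \<open>The partial sum of f(y) over the monomials of degree below \<open>N\<close>. For
  \<open>y = Var\<close> and \<open>f\<close> in \<open>R s\<close> it is the truncation of
  \<open>f\<close>, and is reused as such in the codimension arguments.\<close>

definition psub :: "nat \<Rightarrow> (nat \<Rightarrow> 'a::field mps) \<Rightarrow> nat \<Rightarrow> 'a mps \<Rightarrow> 'a mps" where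
  "psub s y N f = (\<Sum>\<alpha>\<in>exps s N. Const (coeff f \<alpha>) * ymon s y \<alpha>)"

definition subst :: "nat \<Rightarrow> (nat \<Rightarrow> 'a::field mps) \<Rightarrow> 'a mps \<Rightarrow> 'a mps" where
  "subst s y f = lim s (\<lambda>N. psub s y N f)"

lemma ymon_upd:
  assumes "j < s"
  shows "ymon s y (\<alpha>(j := Suc (\<alpha> j))) = y j * ymon s y \<alpha>"
proof -
  have "(\<Prod>i\<in>{..<s} - {j}. y i ^ (\<alpha>(j := Suc (\<alpha> j))) i) = (\<Prod>i\<in>{..<s} - {j}. y i ^ \<alpha> i)"
    by (rule prod.cong) auto
  then show ?thesis unfolding ymon_def
    using assms by (simp add: prod.remove[of "{..<s}" j] mult_ac)
qed

lemma ymon_M: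
  assumes "\<And>i. i < s \<Longrightarrow> y i \<in> M s 1"
  shows "ymon s y \<alpha> \<in> M s (deg s \<alpha>)"
proof -
  have "(\<Prod>i<n. y i ^ \<alpha> i) \<in> M s (\<Sum>i<n. \<alpha> i)" if "n \<le> s" for n
    using that by (induction n) (auto intro!: M_mult M_power assms)
  then show ?thesis by (auto simp: ymon_def deg_def)
qed

context
  fixes s :: nat and y :: "nat \<Rightarrow> 'a::field mps"
  assumes y: "\<And>i. i < s \<Longrightarrow> y i \<in> R s \<inter> M s 1"
begin

lemma subst_psub: "subst s y f - psub s y N f \<in> M s N"
  unfolding subst_def
proof (rule lim_diff)
  fix n
  have "psub s y (Suc n) f - psub s y n f
      = (\<Sum>\<alpha>\<in>exps s (Suc n) - exps s n. Const (coeff f \<alpha>) * ymon s y \<alpha>)"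
    unfolding psub_def by (rule sum_diff[symmetric]) (auto simp: finite_exps, auto simp: exps_def)
  also have "\<dots> \<in> M s n"
  proof (rule M_sum)
    fix \<alpha> assume "\<alpha> \<in> exps s (Suc n) - exps s n"
    then have "deg s \<alpha> = n" by (auto simp: exps_def)
    then show "Const (coeff f \<alpha>) * ymon s y \<alpha> \<in> M s n"
      using ymon_M[of s y \<alpha>] y by (auto intro: M_mult_left)
  qed
  finally show "psub s y (Suc n) f - psub s y n f \<in> M s n" .
qed

text \<open>Index and precision of the approximation are separate because multiplication by a
  variable shifts them against each other: in \<open>subst_Var_mult\<close>, partial sum N + 1 gives
  precision N.\<close>

lemma subst_eqI:
  assumes "\<And>N. \<exists>n m. N \<le> m \<and> psub s y n f - g \<in> M s m \<and> N \<le> n"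
  shows "subst s y f = g"
proof -
  have "subst s y f - g \<in> M s N" for N
  proof -
    obtain n m where "N \<le> m" "N \<le> n" "psub s y n f - g \<in> M s m" using assms by blast
    then have "(subst s y f - psub s y n f) + (psub s y n f - g) \<in> M s N"
      using subst_psub by (intro M_add) (auto intro: M_antimono)
    then show ?thesis by simp
  qed
  then have "subst s y f - g = 0" by (rule M_separated)
  then show ?thesis by simp
qed

lemma subst_add: "subst s y (f + g) = subst s y f + subst s y g"
proof (rule subst_eqI)
  fix N
  have "psub s y N (f + g) = psub s y N f + psub s y N g"
    by (simp add: psub_def Const_add distrib_right sum.distrib)
  then have "psub s y N (f + g) - (subst s y f + subst s y g)
      = - (subst s y f - psub s y N f) - (subst s y g - psub s y N g)" by simp
  also have "\<dots> \<in> M s N" by (intro M_diff M_uminus subst_psub)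
  finally show "\<exists>n m. N \<le> m \<and> psub s y n (f + g) - (subst s y f + subst s y g) \<in> M s m \<and> N \<le> n"
    by blast
qed

lemma subst_Const_mult: "subst s y (Const c * f) = Const c * subst s y f"
proof (rule subst_eqI)
  fix N
  have "psub s y N (Const c * f) = Const c * psub s y N f"
    by (simp add: psub_def Const_mult sum_distrib_left mult.assoc)
  then have "psub s y N (Const c * f) - Const c * subst s y f
      = Const c * (- (subst s y f - psub s y N f))" by (simp add: right_diff_distrib)
  also have "\<dots> \<in> M s N" by (intro M_mult_left M_uminus subst_psub)
  finally show "\<exists>n m. N \<le> m \<and> psub s y n (Const c * f) - Const c * subst s y f \<in> M s m \<and> N \<le> n"
    by blast
qed

lemma subst_zero [simp]: "subst s y 0 = 0"
  using subst_add[of 0 0] by simp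

lemma subst_uminus: "subst s y (- f) = - subst s y f"
  using subst_add[of f "-f"] by (simp add: eq_neg_iff_add_eq_0 add.commute)

lemma subst_diff: "subst s y (f - g) = subst s y f - subst s y g"
  using subst_add[of f "-g"] subst_uminus by simp

lemma subst_sum: "subst s y (sum f I) = (\<Sum>i\<in>I. subst s y (f i))"
  by (induction I rule: infinite_finite_induct) (auto simp: subst_add)

lemma subst_one [simp]: "subst s y 1 = 1"
proof (rule subst_eqI)
  fix N
  have "psub s y (Suc N) 1
      = (\<Sum>\<alpha>\<in>exps s (Suc N). if \<alpha> = (\<lambda>_. 0) then 1 else 0)"
    unfolding psub_def one_mps.rep_eq ps_one_def ymon_def by (rule sum.cong) auto
  also have "\<dots> = 1" using finite_exps
    by (subst sum.delta) (auto simp: exps_def mons_def deg_def)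
  finally show "\<exists>n m. N \<le> m \<and> psub s y n 1 - 1 \<in> M s m \<and> N \<le> n"
    by (intro exI[of _ "Suc N"]) auto
qed

lemma subst_Const [simp]: "subst s y (Const c) = Const c"
  using subst_Const_mult[of c 1] by simp

lemma subst_Var_mult:
  assumes j: "j < s"
  shows "subst s y (Var j * f) = y j * subst s y f"
proof (rule subst_eqI)
  fix N
  have "psub s y (Suc N) (Var j * f)
      = (\<Sum>\<alpha>\<in>{\<alpha> \<in> exps s (Suc N). \<alpha> j \<noteq> 0}. Const (coeff f (\<alpha>(j := \<alpha> j - 1))) * ymon s y \<alpha>)"
    unfolding psub_def coeff_Var_mult
    by (rule sum.mono_neutral_cong_right) (auto simp: finite_exps)
  also have "\<dots> = (\<Sum>\<beta>\<in>exps s N. Const (coeff f \<beta>) * ymon s y (\<beta>(j := Suc (\<beta> j))))"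
  proof (rule sum.reindex_bij_witness[where i = "\<lambda>\<beta>. \<beta>(j := Suc (\<beta> j))"
        and j = "\<lambda>\<alpha>. \<alpha>(j := \<alpha> j - 1)"])
    fix \<alpha> assume a: "\<alpha> \<in> {\<alpha> \<in> exps s (Suc N). \<alpha> j \<noteq> 0}"
    let ?b = "\<alpha>(j := \<alpha> j - 1)"
    show up: "?b(j := Suc (?b j)) = \<alpha>" using a by auto
    have "deg s \<alpha> = Suc (deg s ?b)" using deg_upd[OF j, of ?b] unfolding up .
    then show "?b \<in> exps s N" using a by (auto simp: exps_def mons_def)
    show "Const (coeff f ?b) * ymon s y (?b(j := Suc (?b j)))
        = Const (coeff f ?b) * ymon s y \<alpha>" unfolding up ..
  qed (use j in \<open>auto simp: exps_def mons_def deg_upd\<close>)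
  also have "\<dots> = y j * psub s y N f"
    by (simp add: psub_def ymon_upd[OF j] sum_distrib_left mult_ac)
  finally have "psub s y (Suc N) (Var j * f) - y j * subst s y f
      = y j * (- (subst s y f - psub s y N f))" by (simp add: right_diff_distrib)
  also have "\<dots> \<in> M s N" by (intro M_mult_left M_uminus subst_psub)
  finally show "\<exists>n m. N \<le> m \<and> psub s y n (Var j * f) - y j * subst s y f \<in> M s m \<and> N \<le> n"
    by (intro exI[of _ "Suc N"] exI[of _ N]) auto
qed

lemma subst_expand:
  assumes "f \<in> R s"
  shows "subst s y f = Const (coeff f (\<lambda>_. 0)) + (\<Sum>j<s. y j * subst s y (quot j f))"
  by (subst expand[OF assms]) (simp add: subst_add subst_sum subst_Var_mult)

lemma subst_M: "f \<in> M s n \<Longrightarrow> subst s y f \<in> M s n"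
proof -
  assume "f \<in> M s n"
  then have "psub s y n f = 0" by (auto simp: psub_def M_def exps_def intro!: sum.neutral)
  then show ?thesis using subst_psub[of f n] by simp
qed

lemma subst_R: "subst s y f \<in> R s"
  unfolding subst_def psub_def ymon_def using y by (intro lim_R R_intros) auto

text \<open>Only the left factor is expanded. The defect of multiplicativity, for fixed
  \<open>g\<close>, vanishes on constants and turns x_j q into y_j times the defect of q; as y_j has
  positive order, the defect is 0.\<close>

lemma subst_mult:
  assumes "f \<in> R s"
  shows "subst s y (f * g) = subst s y f * subst s y g"
proof -
  have "\<forall>f\<in>R s. subst s y (f * g) - subst s y f * subst s y g \<in> M s n" for n
  proof (induction n)
    case (Suc n)
    show ?case
    proof
      fix f :: "'a mps" assume f: "f \<in> R s"
      have "f * g = Const (coeff f (\<lambda>_. 0)) * g + (\<Sum>j<s. Var j * (quot j f * g))"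
        by (subst expand[OF f]) (simp add: distrib_right sum_distrib_right mult.assoc)
      then have "subst s y (f * g) - subst s y f * subst s y g
          = (\<Sum>j<s. y j * (subst s y (quot j f * g) - subst s y (quot j f) * subst s y g))"
        by (simp add: subst_expand[OF f] subst_add subst_sum subst_Var_mult subst_Const_mult
            distrib_right sum_distrib_right right_diff_distrib sum_subtractf mult.assoc)
      also have "\<dots> \<in> M s (Suc n)"
        using Suc f y by (intro M_sum M_multI[where m = 1 and n = n]) (auto intro: R_quot)
      finally show "subst s y (f * g) - subst s y f * subst s y g \<in> M s (Suc n)" .
    qed
  qed simp
  then have "subst s y (f * g) - subst s y f * subst s y g = 0"
    using assms by (intro M_separated) blast
  then show ?thesis by simp
qed

end

lemma subst_ident:
  fixes f :: "'a::field mps"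
  assumes "f \<in> R s"
  shows "subst s Var f = f"
proof -
  have "\<forall>f\<in>R s. subst s Var f - f \<in> (M s n :: 'a mps set)" for n
  proof (induction n)
    case (Suc n)
    show ?case
    proof
      fix f :: "'a mps" assume f: "f \<in> R s"
      have "subst s Var f - f = (\<Sum>j<s. Var j * (subst s Var (quot j f) - quot j f))"
        using expand[OF f] subst_expand[OF _ f, of Var]
        by (simp add: M_Var' right_diff_distrib sum_subtractf algebra_simps)
      also have "\<dots> \<in> M s (Suc n)"
        using Suc f by (intro M_sum M_multI[OF M_Var]) (auto intro: R_quot)
      finally show "subst s Var f - f \<in> M s (Suc n)" .
    qed
  qed simp
  then have "subst s Var f - f = 0" using assms by (intro M_separated) blast
  then show ?thesis by simp
qed

section \<open>Order estimates for differences and first-order Taylor expansion\<close>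

text \<open>The next two estimates are proved to precision \<open>N\<close>, by induction on \<open>N\<close> for all
  series and all orders at once.\<close>

lemma subst_difference:
  assumes u: "\<And>i. i < s \<Longrightarrow> u i \<in> R s \<inter> M s 1" and v: "\<And>i. i < s \<Longrightarrow> v i \<in> R s \<inter> M s 1"
    and uv: "\<And>i. i < s \<Longrightarrow> u i - v i \<in> M s e" and e: "e \<ge> 1"
    and f: "f \<in> R s" "f \<in> M s n"
  shows "subst s u f - subst s v f \<in> M s (e + n - 1)"
proof -
  have "\<forall>n. \<forall>f \<in> R s \<inter> M s n. subst s u f - subst s v f \<in> M s (min N (e + n - 1))" for N
  proof (induction N)
    case (Suc N)
    show ?case
    proof (intro allI ballI)
      fix n and f :: "'a mps" assume f: "f \<in> R s \<inter> M s n"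
      have q: "quot j f \<in> R s \<inter> M s (n - 1)" if "j < s" for j
        using f that by (cases n) (auto intro: R_quot M_quot)
      \<comment> \<open>This is uU - vV = (u - v)U + v(U - V). The first summand has order e + (n -
        1); in the second, the order lost by passing to \<open>quot j f\<close> is regained from
        v_j. For n = 0, truncated subtraction makes the hypothesis on \<open>quot j f\<close>
        vacuous, as it should be.\<close>
      have "subst s u f - subst s v f = (\<Sum>j<s. (u j - v j) * subst s u (quot j f)
          + v j * (subst s u (quot j f) - subst s v (quot j f)))"
        using f subst_expand[of s u f] subst_expand[of s v f] u v
        by (simp add: sum_subtractf[symmetric] algebra_simps)
      also have "\<dots> \<in> M s (min (Suc N) (e + n - 1))"
      proof (intro M_sum M_add)
        fix j assume "j \<in> {..<s}"
        then have j: "j < s" by simp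
        show "(u j - v j) * subst s u (quot j f) \<in> M s (min (Suc N) (e + n - 1))"
          by (rule M_multI[OF uv[OF j] subst_M[OF u]]) (use q[OF j] in auto)
        have "subst s u (quot j f) - subst s v (quot j f) \<in> M s (min N (e + (n - 1) - 1))"
          using Suc q[OF j] by blast
        then show "v j * (subst s u (quot j f) - subst s v (quot j f))
            \<in> M s (min (Suc N) (e + n - 1))"
          by (rule M_multI[rotated, where m = 1]) (use v[OF j] e in auto)
      qed
      finally show "subst s u f - subst s v f \<in> M s (min (Suc N) (e + n - 1))" .
    qed
  qed simp
  then have "subst s u f - subst s v f \<in> M s (min (e + n - 1) (e + n - 1))" using f by blast
  then show ?thesis by simp
qed

lemma subst_taylor:
  assumes b: "\<And>i. i < s \<Longrightarrow> b i \<in> R s \<inter> M s c" and h: "\<And>i. i < s \<Longrightarrow> h i \<in> R s \<inter> M s e"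
    and ce: "1 \<le> c" "c \<le> e" and f: "f \<in> R s" "f \<in> M s n"
  shows "subst s (\<lambda>i. Var i + b i + h i) f - subst s (\<lambda>i. Var i + b i) f
      - (\<Sum>i<s. h i * deriv i f) \<in> M s (e + c + n - 2)"
proof -
  let ?u = "\<lambda>i. Var i + b i + h i" and ?v = "\<lambda>i. Var i + b i"
  \<comment> \<open>The derivative is taken at x and not at x + b, so T f starts with terms h_i b_j
    times second-order Taylor coefficients of f, of order e + c + n - 2. The terms h_i h_j have
    order 2e + n - 2, which is no smaller since c \<le> e. The recursion \<open>T_Var\<close>
    produces these orders without second derivatives.\<close>
  define T where "T f = subst s ?u f - subst s ?v f - (\<Sum>i<s. h i * deriv i f)" for f
  have v: "?v i \<in> R s \<inter> M s 1" if "i < s" for i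
    using b[OF that] that ce by (auto intro!: R_add M_add M_Var' intro: M_antimono)
  have u: "?u i \<in> R s \<inter> M s 1" if "i < s" for i
    using v[OF that] h[OF that] ce by (auto intro!: R_add M_add intro: M_antimono)
  have T_add: "T (f + g) = T f + T g" for f g
    by (simp add: T_def subst_add[OF u] subst_add[OF v] deriv_add distrib_left sum.distrib)
  have T_0: "T 0 = 0" by (simp add: T_def subst_zero[OF u] subst_zero[OF v])
  have T_sum: "T (sum g I) = (\<Sum>i\<in>I. T (g i))" for g and I :: "nat set"
    by (induction I rule: infinite_finite_induct) (auto simp: T_add T_0)
  have T_Const: "T (Const k) = 0" for k
    by (simp add: T_def subst_Const[OF u] subst_Const[OF v])
  have T_Var: "T (Var j * g) = Var j * T g + (b j + h j) * (subst s ?u g - subst s ?v g)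
      + h j * (subst s ?v g - g)" if "j < s" for j g
  proof -
    have "(\<Sum>i<s. h i * deriv i (Var j * g)) = (\<Sum>i<s. (if i = j then h j * g else 0)
        + Var j * (h i * deriv i g))"
      unfolding deriv_Var_mult by (rule sum.cong) (auto simp: algebra_simps)
    also have "\<dots> = h j * g + Var j * (\<Sum>i<s. h i * deriv i g)"
      using that by (simp add: sum.distrib sum_distrib_left)
    finally have *: "(\<Sum>i<s. h i * deriv i (Var j * g))
        = h j * g + Var j * (\<Sum>i<s. h i * deriv i g)" .
    have alg: "(x + b + h) * U - (x + b) * V - (h * g + x * S)
        = x * (U - V - S) + (b + h) * (U - V) + h * (V - g)" for x b h U V S g :: "'a mps"
      by (simp add: algebra_simps)
    have "subst s ?u (Var j * g) = (Var j + b j + h j) * subst s ?u g"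
      and "subst s ?v (Var j * g) = (Var j + b j) * subst s ?v g"
      using subst_Var_mult[OF u that] subst_Var_mult[OF v that] by auto
    then show ?thesis by (simp only: T_def * alg)
  qed
  have "\<forall>n. \<forall>f \<in> R s \<inter> M s n. T f \<in> M s (min N (e + c + n - 2))" for N
  proof (induction N)
    case (Suc N)
    show ?case
    proof (intro allI ballI)
      fix n and f :: "'a mps" assume f: "f \<in> R s \<inter> M s n"
      have q: "quot j f \<in> R s" "quot j f \<in> M s (n - 1)" if "j < s" for j
        using f that by (cases n; auto intro: R_quot M_quot)+
      have "T f = (\<Sum>j<s. T (Var j * quot j f))"
        using f by (subst expand[of f s]) (simp_all add: T_add T_Const T_sum)
      also have "\<dots> = (\<Sum>j<s. Var j * T (quot j f)
          + (b j + h j) * (subst s ?u (quot j f) - subst s ?v (quot j f))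
          + h j * (subst s ?v (quot j f) - quot j f))"
        by (rule sum.cong) (auto simp: T_Var)
      also have "\<dots> \<in> M s (min (Suc N) (e + c + n - 2))"
      proof (intro M_sum M_add)
        fix j assume "j \<in> {..<s}"
        then have j: "j < s" by simp
        have "T (quot j f) \<in> M s (min N (e + c + (n - 1) - 2))"
          using Suc q[OF j] by blast
        then show "Var j * T (quot j f) \<in> M s (min (Suc N) (e + c + n - 2))"
          by (rule M_multI[OF M_Var[OF j]]) (use ce in auto)
        have 1: "subst s ?u (quot j f) - subst s ?v (quot j f) \<in> M s (e + (n - 1) - 1)"
          by (rule subst_difference[OF u v]) (use h ce q[OF j] in auto)
        have 2: "b j + h j \<in> M s c"
          using b[OF j] h[OF j] ce by (auto intro!: M_add intro: M_antimono)
        show "(b j + h j) * (subst s ?u (quot j f) - subst s ?v (quot j f))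
            \<in> M s (min (Suc N) (e + c + n - 2))"
          by (rule M_multI[OF 2 1]) (use ce in auto)
        have "subst s ?v (quot j f) - subst s Var (quot j f) \<in> M s (c + (n - 1) - 1)"
          by (rule subst_difference[OF v]) (use b ce q[OF j] M_Var' in auto)
        then have "subst s ?v (quot j f) - quot j f \<in> M s (c + (n - 1) - 1)"
          using subst_ident q[OF j] by metis
        then show "h j * (subst s ?v (quot j f) - quot j f) \<in> M s (min (Suc N) (e + c + n - 2))"
          by (rule M_multI[rotated, where m = e]) (use h[OF j] ce in auto)
      qed
      finally show "T f \<in> M s (min (Suc N) (e + c + n - 2))" .
    qed
  qed simp
  then have "T f \<in> M s (min (e + c + n - 2) (e + c + n - 2))" using f by blast
  then show ?thesis by (simp add: T_def)
qed

section \<open>Substitutions tangent to the identity are automorphisms\<close>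

context
  fixes s :: nat and b :: "nat \<Rightarrow> 'a::field mps"
  assumes b: "\<And>i. i < s \<Longrightarrow> b i \<in> R s \<inter> M s 2"
begin

lemma perturbed_Var: "i < s \<Longrightarrow> Var i + b i \<in> R s \<inter> M s 1"
  using b[of i] M_antimono[of "b i" s 2 1] by (auto intro!: R_add M_add M_Var')

lemma subst_near_ident:
  assumes "f \<in> R s" "f \<in> M s n"
  shows "subst s (\<lambda>i. Var i + b i) f - f \<in> M s (Suc n)"
proof -
  have "subst s (\<lambda>i. Var i + b i) f - subst s Var f \<in> M s (2 + n - 1)"
    by (rule subst_difference[OF perturbed_Var]) (use b assms M_Var' in auto)
  then show ?thesis using subst_ident[OF assms(1)] by simp
qed

text \<open>The substitution changes a series of order n only from order n + 1 on. Hence an element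
  of the kernel has arbitrarily high order, and a preimage of g is the limit of the iteration that
  adds the current error g - \<sigma>(p) to p.\<close>

lemma subst_bij: "bij_betw (subst s (\<lambda>i. Var i + b i)) (R s) (R s)"
  (is "bij_betw ?\<sigma> _ _")
  unfolding bij_betw_def
proof
  show "inj_on ?\<sigma> (R s)"
  proof (rule inj_onI)
    fix f g assume fg: "f \<in> R s" "g \<in> R s" and eq: "?\<sigma> f = ?\<sigma> g"
    have z: "?\<sigma> (f - g) = 0" using eq by (simp add: subst_diff[OF perturbed_Var])
    have "f - g \<in> M s n" for n
    proof (induction n)
      case (Suc n)
      from subst_near_ident[OF R_diff[OF fg] this] M_uminus show ?case unfolding z by fastforce
    qed simp
    then have "f - g = 0" by (rule M_separated)
    then show "f = g" by simp
  qed
  show "?\<sigma> ` R s = R s"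
  proof (intro equalityI subsetI)
    show "g \<in> R s" if "g \<in> ?\<sigma> ` R s" for g using that subst_R[OF perturbed_Var] by auto
    fix g :: "'a mps" assume g: "g \<in> R s"
    define u where "u = rec_nat (0 :: 'a mps) (\<lambda>_ p. p + (g - ?\<sigma> p))"
    have u0: "u 0 = 0" and uS: "u (Suc n) = u n + (g - ?\<sigma> (u n))" for n by (simp_all add: u_def)
    have uR: "u n \<in> R s" for n
      by (induction n) (auto simp: u0 uS intro!: R_intros g subst_R[OF perturbed_Var])
    have def: "g - ?\<sigma> (u n) \<in> M s n" for n
    proof (induction n)
      case (Suc n)
      have "g - ?\<sigma> (u (Suc n)) = - (?\<sigma> (g - ?\<sigma> (u n)) - (g - ?\<sigma> (u n)))"
        by (simp add: uS subst_add[OF perturbed_Var])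
      also have "\<dots> \<in> M s (Suc n)"
        by (intro M_uminus subst_near_ident Suc R_diff g subst_R[OF perturbed_Var])
      finally show ?case .
    qed simp
    have lim: "lim s u - u n \<in> M s n" for n
      by (rule lim_diff) (use def in \<open>simp add: uS\<close>)
    have "g - ?\<sigma> (lim s u) \<in> M s n" for n
    proof -
      have "g - ?\<sigma> (lim s u) = (g - ?\<sigma> (u n)) - ?\<sigma> (lim s u - u n)"
        by (simp add: subst_diff[OF perturbed_Var])
      also have "\<dots> \<in> M s n" by (intro M_diff def subst_M[OF perturbed_Var] lim)
      finally show ?thesis .
    qed
    then have "g - ?\<sigma> (lim s u) = 0" by (rule M_separated)
    then have "g = ?\<sigma> (lim s u)" by simp
    then show "g \<in> ?\<sigma> ` R s" using lim_R[of u s] uR by blast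
  qed
qed

end

section \<open>Jacobian and Tjurina ideals, with control of the coefficients\<close>

text \<open>The Tjurina ideal for \<open>z = 1\<close> and the Jacobian ideal for \<open>z = 0\<close>.\<close>

definition tjid :: "nat \<Rightarrow> 'a::field mps \<Rightarrow> 'a mps \<Rightarrow> 'a mps set" where
  "tjid s z f = {a * (z * f) + (\<Sum>i<s. b i * deriv i f) |a b. a \<in> R s \<and> (\<forall>i<s. b i \<in> R s)}"

lemma tjidI:
  "a \<in> R s \<Longrightarrow> (\<And>i. i < s \<Longrightarrow> b i \<in> R s) \<Longrightarrow> a * (z * f) + (\<Sum>i<s. b i * deriv i f) \<in> tjid s z f"
  unfolding tjid_def by blast

lemma idl_tjid:
  assumes f: "f \<in> R s" and z: "z \<in> R s"
  shows "idl s (tjid s z f)"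
  unfolding idl_def
proof (intro conjI ballI subsetI)
  show "x \<in> R s" if "x \<in> tjid s z f" for x
    using that f z by (auto simp: tjid_def intro!: R_intros)
  show "0 \<in> tjid s z f" using tjidI[of 0 s "\<lambda>_. 0" z f] by simp
  fix x assume "x \<in> tjid s z f"
  then obtain a b where x: "x = a * (z * f) + (\<Sum>i<s. b i * deriv i f)" "a \<in> R s"
    "\<And>i. i < s \<Longrightarrow> b i \<in> R s" by (auto simp: tjid_def)
  show "r * x \<in> tjid s z f" if "r \<in> R s" for r
    using tjidI[of "r * a" s "\<lambda>i. r * b i" z f] that x
    by (simp add: R_mult distrib_left sum_distrib_left mult.assoc)
  fix y assume "y \<in> tjid s z f"
  then obtain a' b' where y: "y = a' * (z * f) + (\<Sum>i<s. b' i * deriv i f)" "a' \<in> R s"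
    "\<And>i. i < s \<Longrightarrow> b' i \<in> R s" by (auto simp: tjid_def)
  show "x + y \<in> tjid s z f"
    using tjidI[of "a + a'" s "\<lambda>i. b i + b' i" z f] x y
    by (simp add: R_add distrib_right sum.distrib algebra_simps)
qed

lemma tjid_f: "z * f \<in> tjid s z f"
  using tjidI[of 1 s "\<lambda>_. 0" z f] by simp

lemma tjid_deriv: "i < s \<Longrightarrow> deriv i f \<in> tjid s z f"
proof -
  assume "i < s"
  then have "(\<Sum>j<s. (if j = i then 1 else 0) * deriv j f) = deriv i f"
    by (simp add: if_distrib[of "\<lambda>x. x * _"] cong: if_cong)
  then show ?thesis using tjidI[of 0 s "\<lambda>j. if j = i then 1 else 0" z f] by simp
qed

text \<open>Uses m^(n+k) = m^n m^k: peeling off n variables leaves an element of m^k, which lies in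
  the ideal, and multiplying back puts the coefficients into m^n. The successive approximation
  depends on this order of the coefficients.\<close>

lemma tjid_decompose:
  assumes sub: "R s \<inter> M s k \<subseteq> tjid s z f" and h: "h \<in> R s" "h \<in> M s (n + k)"
  shows "\<exists>a b. a \<in> R s \<inter> M s n \<and> (\<forall>i<s. b i \<in> R s \<inter> M s n) \<and>
    h = a * (z * f) + (\<Sum>i<s. b i * deriv i f)"
  using h
proof (induction n arbitrary: h)
  case 0
  then have "h \<in> tjid s z f" using sub by auto
  then show ?case unfolding tjid_def by auto
next
  case (Suc n)
  define Q where "Q j a b \<longleftrightarrow> a \<in> R s \<inter> M s n \<and> (\<forall>i<s. b i \<in> R s \<inter> M s n) \<and>
    quot j h = a * (z * f) + (\<Sum>i<s. b i * deriv i f)" for j a b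
  have "\<forall>j. \<exists>a b. j < s \<longrightarrow> Q j a b"
  proof
    fix j
    have "\<exists>a b. Q j a b" if "j < s"
      unfolding Q_def by (rule Suc.IH) (use that Suc.prems in \<open>auto intro: R_quot M_quot\<close>)
    then show "\<exists>a b. j < s \<longrightarrow> Q j a b" by blast
  qed
  then obtain a b where "\<And>j. j < s \<Longrightarrow> Q j (a j) (b j)" by metis
  then have ab: "\<And>j. j < s \<Longrightarrow> a j \<in> R s \<inter> M s n"
    "\<And>j i. j < s \<Longrightarrow> i < s \<Longrightarrow> b j i \<in> R s \<inter> M s n"
    "\<And>j. j < s \<Longrightarrow> quot j h = a j * (z * f) + (\<Sum>i<s. b j i * deriv i f)"
    unfolding Q_def by auto
  have "h = (\<Sum>j<s. Var j * quot j h)" using Suc.prems by (intro expand_M) auto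
  also have "\<dots> = (\<Sum>j<s. Var j * a j * (z * f) + (\<Sum>i<s. Var j * b j i * deriv i f))"
    by (rule sum.cong) (auto simp: ab distrib_left sum_distrib_left mult.assoc)
  also have "\<dots> = (\<Sum>j<s. Var j * a j) * (z * f) + (\<Sum>j<s. \<Sum>i<s. Var j * b j i * deriv i f)"
    by (simp add: sum.distrib sum_distrib_right)
  also have "\<dots> = (\<Sum>j<s. Var j * a j) * (z * f) + (\<Sum>i<s. (\<Sum>j<s. Var j * b j i) * deriv i f)"
    by (subst sum.swap) (simp add: sum_distrib_right)
  finally have h: "h = (\<Sum>j<s. Var j * a j) * (z * f) + (\<Sum>i<s. (\<Sum>j<s. Var j * b j i) * deriv i f)" .
  have "(\<Sum>j<s. Var j * a j) \<in> R s \<inter> M s (Suc n)"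
    using ab(1) by (auto intro!: R_intros M_sum M_multI[OF M_Var])
  moreover have "(\<Sum>j<s. Var j * b j i) \<in> R s \<inter> M s (Suc n)" if "i < s" for i
    using ab(2) that by (auto intro!: R_intros M_sum M_multI[OF M_Var])
  ultimately show ?case
    by (intro exI[of _ "\<Sum>j<s. Var j * a j"] exI[of _ "\<lambda>i. \<Sum>j<s. Var j * b j i"] conjI allI impI h)
qed

subsection \<open>Finite codimension implies determinacy\<close>

text \<open>Solves \<open>g = (1 + z a) f(x + b)\<close> by successive approximation of \<open>a\<close> and \<open>b\<close>: an error of order
  \<open>2k + 3 - m + t\<close> is written as a combination of \<open>z f\<close> and the partial derivatives with
  coefficients of order \<open>k + 3 - m + t\<close>, and adding these to \<open>a, b\<close> raises the order of the
  error.\<close>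

lemma determinacy:
  fixes f g z :: "'a::field mps"
  assumes f: "f \<in> R s" "f \<in> M s m" and m: "1 \<le> m" "m \<le> k + 1" and z: "z \<in> R s"
    and sub: "R s \<inter> M s k \<subseteq> tjid s z f" and g: "g \<in> R s" "f - g \<in> M s (2 * k + 3 - m)"
  shows "\<exists>a b. a \<in> R s \<inter> M s 2 \<and> (\<forall>i<s. b i \<in> R s \<inter> M s 2) \<and>
    g = (1 + z * a) * subst s (\<lambda>i. Var i + b i) f"
proof -
  \<comment> \<open>The least c with 2c + m - 2 \<ge> c + k + 1, so that the Taylor remainder
    improves on the error; the other two remainder terms have one order to spare. The bound m \<le>
    k + 1 keeps the subtraction exact and gives c \<ge> 2, so that the substitutions are tangent to
    the identity.\<close>
  define c where "c = k + 3 - m"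
  have c: "2 \<le> c" using m by (simp add: c_def)
  have ck: "2 * k + 3 - m = c + k" using m by (simp add: c_def)
  define \<Phi> where "\<Phi> p = (1 + z * fst p) * subst s (\<lambda>i. Var i + snd p i) f" for p :: "'a mps \<times> (nat \<Rightarrow> 'a mps)"
  define good where "good t p \<longleftrightarrow> fst p \<in> R s \<inter> M s c \<and> (\<forall>i<s. snd p i \<in> R s \<inter> M s c) \<and>
    g - \<Phi> p \<in> M s (c + k + t)" for t and p :: "'a mps \<times> (nat \<Rightarrow> 'a mps)"
  have M2: "x \<in> M s 2" if "x \<in> M s c" for x using M_antimono[OF that c] .
  have perturbed: "Var i + b i \<in> R s \<inter> M s 1"
    if "i < s" and "\<And>i. i < s \<Longrightarrow> b i \<in> R s \<inter> M s c" for b i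
    by (rule perturbed_Var) (use that M2 in auto)
  \<comment> \<open>The choice records that consecutive approximations differ in order t. They
    actually differ in order c + t; t is what \<open>lim_diff\<close> asks for.\<close>
  have "\<exists>u. \<forall>t. good t (u t) \<and> (fst (u (Suc t)) - fst (u t) \<in> M s t \<and>
      (\<forall>i<s. snd (u (Suc t)) i - snd (u t) i \<in> M s t))"
  proof (rule dependent_nat_choice)
    have "\<Phi> (0, \<lambda>_. 0) = f" using f by (simp add: \<Phi>_def subst_ident)
    then have "good 0 (0, \<lambda>_. 0)" using M_uminus[OF g(2)] by (simp add: good_def ck)
    then show "\<exists>p. good 0 p" by blast
    fix p t assume p: "good t p"
    obtain a b where ab: "p = (a, b)" by (cases p)
    have a: "a \<in> R s \<inter> M s c" and b: "\<And>i. i < s \<Longrightarrow> b i \<in> R s \<inter> M s c"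
      and e: "g - \<Phi> (a, b) \<in> M s (c + k + t)" using p by (auto simp: ab good_def)
    note v = perturbed[of _ b, OF _ b]
    have "\<Phi> (a, b) \<in> R s" using a z by (auto simp: \<Phi>_def intro!: R_intros subst_R[OF v])
    then have "g - \<Phi> (a, b) \<in> R s" by (rule R_diff[OF g(1)])
    moreover have "g - \<Phi> (a, b) \<in> M s (c + t + k)" using e by (simp add: ac_simps)
    ultimately obtain \<alpha> \<beta> where al: "\<alpha> \<in> R s \<inter> M s (c + t)"
      and be: "\<And>i. i < s \<Longrightarrow> \<beta> i \<in> R s \<inter> M s (c + t)"
      and eq: "g - \<Phi> (a, b) = \<alpha> * (z * f) + (\<Sum>i<s. \<beta> i * deriv i f)"
      using tjid_decompose[OF sub, of "g - \<Phi> (a, b)" "c + t"] by blast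
    have a': "a + \<alpha> \<in> R s \<inter> M s c"
      using a al by (auto intro!: R_add M_add intro: M_antimono)
    have b': "b i + \<beta> i \<in> R s \<inter> M s c" if "i < s" for i
      using b[OF that] be[OF that] by (auto intro!: R_add M_add intro: M_antimono)
    note u = perturbed[of _ "\<lambda>i. b i + \<beta> i", OF _ b']
    define U V D where "U = subst s (\<lambda>i. Var i + (b i + \<beta> i)) f"
      and "V = subst s (\<lambda>i. Var i + b i) f" and "D = (\<Sum>i<s. \<beta> i * deriv i f)"
    have "U - subst s Var f \<in> M s (c + m - 1)"
      unfolding U_def by (rule subst_difference[OF u]) (use b' f c in \<open>auto intro!: M_Var'\<close>)
    then have 1: "U - f \<in> M s (c + m - 1)" using f by (simp add: subst_ident)
    have "subst s (\<lambda>i. Var i + b i + \<beta> i) f - V - D \<in> M s ((c + t) + c + m - 2)"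
      unfolding V_def D_def by (rule subst_taylor) (use b be c f in auto)
    then have 2: "U - V - D \<in> M s ((c + t) + c + m - 2)" by (simp add: U_def add.assoc)
    have 3: "D \<in> M s (c + t + (m - 1))"
    proof (unfold D_def, rule M_sum)
      fix i assume "i \<in> {..<s}"
      then show "\<beta> i * deriv i f \<in> M s (c + t + (m - 1))"
        using be f m by (auto intro!: M_multI[where m = "c + t" and n = "m - 1"] M_deriv)
    qed
    have "g - \<Phi> (a + \<alpha>, \<lambda>i. b i + \<beta> i)
        = (g - \<Phi> (a, b)) - ((1 + z * (a + \<alpha>)) * U - (1 + z * a) * V)"
      by (simp add: \<Phi>_def U_def V_def)
    \<comment> \<open>The linear part of the change of \<Phi> is \<alpha> z f + D, which is exactly
      the old error and cancels. There remain \<alpha> times the displacement U - f, the Taylor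
      remainder, and the cross term a D.\<close>
    also have "\<dots> = - (\<alpha> * (U - f)) * z - (1 + z * a) * (U - V - D) - z * (a * D)"
      unfolding eq D_def[symmetric] by (simp add: algebra_simps)
    also have "\<dots> \<in> M s (c + k + Suc t)"
    proof -
      have e1: "\<alpha> * (U - f) \<in> M s (c + k + Suc t)"
        by (rule M_multI[OF _ 1]) (use al m in \<open>auto simp: c_def\<close>)
      have e2: "U - V - D \<in> M s (c + k + Suc t)"
        by (rule M_antimono[OF 2]) (use m in \<open>auto simp: c_def\<close>)
      have e3: "a * D \<in> M s (c + k + Suc t)"
        by (rule M_multI[OF _ 3]) (use a m in \<open>auto simp: c_def\<close>)
      show ?thesis
        by (intro M_diff M_mult_right[OF M_uminus[OF e1]] M_mult_left[OF e2] M_mult_left[OF e3])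
    qed
    finally have "good (Suc t) (a + \<alpha>, \<lambda>i. b i + \<beta> i)" using a' b' by (auto simp: good_def)
    moreover have "x \<in> M s t" if "x \<in> R s \<inter> M s (c + t)" for x
      using that by (auto intro: M_antimono)
    ultimately show "\<exists>q. good (Suc t) q \<and> (fst q - fst p \<in> M s t \<and> (\<forall>i<s. snd q i - snd p i \<in> M s t))"
      using al be by (intro exI[of _ "(a + \<alpha>, \<lambda>i. b i + \<beta> i)"])
        (auto simp: ab)
  qed
  then obtain u where u: "\<forall>t. good t (u t) \<and> (fst (u (Suc t)) - fst (u t) \<in> M s t \<and>
      (\<forall>i<s. snd (u (Suc t)) i - snd (u t) i \<in> M s t))" by (rule exE)
  have good: "good t (u t)" for t using u by blast
  have du: "fst (u (Suc t)) - fst (u t) \<in> M s t"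
      "i < s \<Longrightarrow> snd (u (Suc t)) i - snd (u t) i \<in> M s t" for t i using u by simp_all
  define a where "a = lim s (\<lambda>t. fst (u t))"
  define b where "b i = lim s (\<lambda>t. snd (u t) i)" for i
  have la: "a - fst (u t) \<in> M s t" for t unfolding a_def by (rule lim_diff) (rule du)
  have lb: "b i - snd (u t) i \<in> M s t" if "i < s" for i t
    unfolding b_def by (rule lim_diff[of "\<lambda>t. snd (u t) i"]) (rule du(2)[OF that])
  have uc: "fst (u t) \<in> R s \<inter> M s c" "\<And>i. i < s \<Longrightarrow> snd (u t) i \<in> R s \<inter> M s c"
    "g - \<Phi> (u t) \<in> M s (c + k + t)" for t
    using good[of t] by (auto simp: good_def)
  have a: "a \<in> R s \<inter> M s c"
    using M_add[OF la[of c], of "fst (u c)"] uc lim_R[of "\<lambda>t. fst (u t)" s] by (auto simp: a_def)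
  have b: "b i \<in> R s \<inter> M s c" if "i < s" for i
    using M_add[OF lb[OF that, of c], of "snd (u c) i"] uc that lim_R[of "\<lambda>t. snd (u t) i" s]
    by (auto simp: b_def)
  have "g - \<Phi> (a, b) \<in> M s n" for n
  proof -
    \<comment> \<open>One step beyond n, because \<open>subst_difference\<close> applied with order
      0 for \<open>f\<close> loses one order.\<close>
    let ?t = "Suc n"
    let ?U = "subst s (\<lambda>i. Var i + b i) f" and ?V = "subst s (\<lambda>i. Var i + snd (u ?t) i) f"
    have "?U - ?V \<in> M s (?t + 0 - 1)"
      by (rule subst_difference) (use perturbed[of _ b] b perturbed[of _ "snd (u ?t)"] uc(2) lb f in auto)
    then have 1: "?U - ?V \<in> M s n" by simp
    have "g - \<Phi> (a, b) = (g - \<Phi> (u ?t)) - z * ((a - fst (u ?t)) * ?U)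
        - (1 + z * fst (u ?t)) * (?U - ?V)"
      by (simp add: \<Phi>_def algebra_simps)
    also have "\<dots> \<in> M s n"
    proof -
      have e1: "g - \<Phi> (u ?t) \<in> M s n" by (rule M_antimono[OF uc(3)]) simp
      have e2: "a - fst (u ?t) \<in> M s n" by (rule M_antimono[OF la]) simp
      show ?thesis
        by (intro M_diff e1 M_mult_left[OF 1] M_mult_left[OF M_mult_right[OF e2]])    qed
    finally show ?thesis .
  qed
  then have "g - \<Phi> (a, b) = 0" by (rule M_separated)
  then have "g = (1 + z * a) * subst s (\<lambda>i. Var i + b i) f" by (simp add: \<Phi>_def)
  then show ?thesis using a b M2 by blast
qed

subsection \<open>Homomorphisms modulo an ideal\<close>

text \<open>Congruence modulo \<open>I\<close>. The ideal property and membership in R are part of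
  the relation, so that chains of congruences carry their side conditions along.\<close>

definition ceq :: "nat \<Rightarrow> 'a::field mps set \<Rightarrow> 'a mps \<Rightarrow> 'a mps \<Rightarrow> bool" where
  "ceq s I x y \<longleftrightarrow> idl s I \<and> x \<in> R s \<and> y \<in> R s \<and> x - y \<in> I"

lemma ceq_refl: "idl s I \<Longrightarrow> x \<in> R s \<Longrightarrow> ceq s I x x"
  by (simp add: ceq_def idl_0)
lemma ceq_sym: "ceq s I x y \<Longrightarrow> ceq s I y x"
  using idl_uminus[of s I "x - y"] by (simp add: ceq_def)
lemma ceq_trans [trans]: "ceq s I x y \<Longrightarrow> ceq s I y w \<Longrightarrow> ceq s I x w"
  using idl_add[of s I "x - y" "y - w"] by (simp add: ceq_def)
lemma ceq_add: "ceq s I x y \<Longrightarrow> ceq s I x' y' \<Longrightarrow> ceq s I (x + x') (y + y')"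
  using idl_add[of s I "x - y" "x' - y'"] by (simp add: ceq_def R_add algebra_simps)
lemma ceq_diff: "ceq s I x y \<Longrightarrow> ceq s I x' y' \<Longrightarrow> ceq s I (x - x') (y - y')"
  using idl_diff[of s I "x - y" "x' - y'"] by (simp add: ceq_def R_diff algebra_simps)
lemma ceq_mult: "ceq s I x y \<Longrightarrow> ceq s I x' y' \<Longrightarrow> ceq s I (x * x') (y * y')"
  using idl_add[of s I "x' * (x - y)" "y * (x' - y')"] idl_mult[of s I x' "x - y"]
    idl_mult[of s I y "x' - y'"]
  by (simp add: ceq_def R_mult algebra_simps)
lemma ceq_sum: "idl s I \<Longrightarrow> (\<And>i. i \<in> A \<Longrightarrow> ceq s I (f i) (g i)) \<Longrightarrow> ceq s I (sum f A) (sum g A)"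
  by (induction A rule: infinite_finite_induct) (auto intro: ceq_add ceq_refl)
lemma ceq_mono: "ceq s I x y \<Longrightarrow> I \<subseteq> J \<Longrightarrow> idl s J \<Longrightarrow> ceq s J x y"
  by (auto simp: ceq_def)
lemma ceq_mem: "ceq s I x y \<Longrightarrow> y \<in> I \<Longrightarrow> x \<in> I"
  using idl_add[of s I "x - y" y] by (simp add: ceq_def)
lemma ceq_0: "idl s I \<Longrightarrow> x \<in> I \<Longrightarrow> ceq s I x 0"
  by (simp add: ceq_def idl_R)

text \<open>A set-theoretic lift of a K-algebra homomorphism from R to R/I; the map itself need not
  be additive. Linearity over K follows from multiplicativity and the clause on constants. For I =
  {0} these are the K-algebra endomorphisms.\<close>

definition homod :: "nat \<Rightarrow> 'a::field mps set \<Rightarrow> ('a mps \<Rightarrow> 'a mps) \<Rightarrow> bool" where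
  "homod s I \<chi> \<longleftrightarrow> idl s I \<and> (\<forall>a\<in>R s. \<chi> a \<in> R s) \<and>
     (\<forall>a\<in>R s. \<forall>b\<in>R s. \<chi> (a + b) - (\<chi> a + \<chi> b) \<in> I \<and> \<chi> (a * b) - \<chi> a * \<chi> b \<in> I) \<and>
     (\<forall>c. \<chi> (Const c) - Const c \<in> I)"

context
  fixes s :: nat and I :: "'a::field mps set" and \<chi>
  assumes hom: "homod s I \<chi>" and I1: "I \<subseteq> M s 1"
begin

lemma homod_idl: "idl s I" using hom by (simp add: homod_def)
lemma homod_R: "a \<in> R s \<Longrightarrow> \<chi> a \<in> R s" using hom by (simp add: homod_def)
lemma homod_add: "a \<in> R s \<Longrightarrow> b \<in> R s \<Longrightarrow> ceq s I (\<chi> (a + b)) (\<chi> a + \<chi> b)"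
  using hom by (simp add: homod_def ceq_def R_add)
lemma homod_mult: "a \<in> R s \<Longrightarrow> b \<in> R s \<Longrightarrow> ceq s I (\<chi> (a * b)) (\<chi> a * \<chi> b)"
  using hom by (simp add: homod_def ceq_def R_mult)
lemma homod_Const: "ceq s I (\<chi> (Const c)) (Const c)"
  using hom by (simp add: homod_def ceq_def)
lemma homod_0: "ceq s I (\<chi> 0) 0" using homod_Const[of 0] by simp
lemma homod_1: "ceq s I (\<chi> 1) 1" using homod_Const[of 1] by simp
lemma homod_diff: "a \<in> R s \<Longrightarrow> b \<in> R s \<Longrightarrow> ceq s I (\<chi> (a - b)) (\<chi> a - \<chi> b)"
  using ceq_sym[OF ceq_diff[OF homod_add[of "a - b" b] ceq_refl[of s I "\<chi> b"]]]
  by (simp add: R_diff homod_idl homod_R)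
lemma homod_sum:
  "(\<And>i. i \<in> A \<Longrightarrow> a i \<in> R s) \<Longrightarrow> ceq s I (\<chi> (sum a A)) (\<Sum>i\<in>A. \<chi> (a i))"
proof (induction A rule: infinite_finite_induct)
  case (insert x F)
  have "ceq s I (\<chi> (a x + sum a F)) (\<chi> (a x) + \<chi> (sum a F))"
    by (rule homod_add) (use insert.prems in \<open>auto intro: R_sum\<close>)
  also have "ceq s I (\<chi> (a x) + \<chi> (sum a F)) (\<chi> (a x) + (\<Sum>i\<in>F. \<chi> (a i)))"
    using insert by (intro ceq_add ceq_refl homod_idl homod_R insert.IH) auto
  finally show ?case using insert.hyps by simp
qed (auto intro: homod_0)

text \<open>If \<chi>(a) had constant term c \<noteq> 0, then a - c would be a unit, so \<chi>(a) -
  c would be invertible modulo \<open>I\<close>. But \<chi>(a) - c lies in m, and so does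
  \<open>I\<close>, which would put 1 into m.\<close>

lemma homod_local:
  assumes a: "a \<in> R s" "a \<in> M s 1"
  shows "\<chi> a \<in> M s 1"
proof (rule ccontr)
  assume n: "\<chi> a \<notin> M s 1"
  define c where "c = coeff (\<chi> a) (\<lambda>_. 0)"
  have c0: "c \<noteq> 0" using n M_1_iff[OF homod_R[OF a(1)]] by (simp add: c_def)
  have d: "a - Const c \<in> R s" using a by (intro R_diff) auto
  have "coeff a (\<lambda>_. 0) = 0" using M_1_iff[OF a(1)] a(2) by simp
  then have "coeff (a - Const c) (\<lambda>_. 0) \<noteq> 0" using c0 by (simp add: coeff_Const)
  from unit_inverse[OF d this] obtain w where w: "w \<in> R s" "(a - Const c) * w = 1" by blast
  have "ceq s I (\<chi> ((a - Const c) * w)) (\<chi> (a - Const c) * \<chi> w)"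
    by (rule homod_mult[OF d w(1)])
  also have "ceq s I (\<chi> (a - Const c) * \<chi> w) ((\<chi> a - \<chi> (Const c)) * \<chi> w)"
    using a w by (intro ceq_mult homod_diff ceq_refl homod_idl homod_R) auto
  also have "ceq s I \<dots> ((\<chi> a - Const c) * \<chi> w)"
    using a w by (intro ceq_mult ceq_diff homod_Const ceq_refl homod_idl homod_R) auto
  finally have "ceq s I 1 ((\<chi> a - Const c) * \<chi> w)"
    using ceq_trans[OF ceq_sym[OF homod_1]] by (simp add: w)
  then have "1 - (\<chi> a - Const c) * \<chi> w \<in> M s 1" using I1 by (auto simp: ceq_def)
  moreover have "(\<chi> a - Const c) * \<chi> w \<in> M s 1"
  proof (rule M_mult_right)
    have "\<chi> a - Const c \<in> R s" using a by (intro R_diff homod_R) auto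
    from M_1_iff[OF this] show "\<chi> a - Const c \<in> M s 1" by (simp add: c_def coeff_Const)
  qed
  ultimately have "1 - (\<chi> a - Const c) * \<chi> w + (\<chi> a - Const c) * \<chi> w \<in> M s 1" by (rule M_add)
  then show False using M_1_iff[of "1 :: 'a mps" s] by (simp add: one_mps.rep_eq ps_one_def)
qed

lemma homod_Var_mult_sum:
  assumes "\<And>j. j < s \<Longrightarrow> q j \<in> R s"
  shows "ceq s I (\<chi> (\<Sum>j<s. Var j * q j)) (\<Sum>j<s. \<chi> (Var j) * \<chi> (q j))"
proof -
  have "ceq s I (\<chi> (\<Sum>j<s. Var j * q j)) (\<Sum>j<s. \<chi> (Var j * q j))"
    using assms by (intro homod_sum R_mult) auto
  also have "ceq s I \<dots> (\<Sum>j<s. \<chi> (Var j) * \<chi> (q j))"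
    using assms by (intro ceq_sum homod_idl homod_mult) auto
  finally show ?thesis .
qed

text \<open>Continuity of \<chi> modulo \<open>I\<close> in the m-adic sense, deduced from locality
  by peeling off one variable at a time.\<close>

lemma homod_M:
  assumes "a \<in> R s" "a \<in> M s n"
  shows "\<chi> a \<in> plusM s I n"
  using assms
proof (induction n arbitrary: a)
  case 0
  then show ?case by (intro plusM_M homod_idl homod_R) auto
next
  case (Suc n)
  have "ceq s I (\<chi> (\<Sum>j<s. Var j * quot j a)) (\<Sum>j<s. \<chi> (Var j) * \<chi> (quot j a))"
    using Suc.prems by (intro homod_Var_mult_sum) (auto intro: R_quot)
  moreover have "(\<Sum>j<s. \<chi> (Var j) * \<chi> (quot j a)) \<in> plusM s I (Suc n)"
    using Suc by (auto intro!: idl_sum[OF idl_plusM] plusM_mult_Suc Suc.IH homod_idl homod_R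
        homod_local[simplified] M_Var' R_quot M_quot)
  ultimately show ?case
    unfolding expand_M[OF Suc.prems, symmetric] using plusM_diff_iff by (auto simp: ceq_def)
qed

text \<open>The chain rule: \<open>\<partial>\<^sub>i \<circ> \<chi>\<close> is a derivation modulo \<open>T\<close>.\<close>

lemma homod_chain_rule:
  assumes T: "idl s T" "I \<subseteq> T" "\<And>x i. x \<in> I \<Longrightarrow> i < s \<Longrightarrow> deriv i x \<in> T" and i: "i < s"
    and a: "a \<in> R s"
  shows "deriv i (\<chi> a) - (\<Sum>l<s. deriv i (\<chi> (Var l)) * \<chi> (deriv l a)) \<in> plusM s T N"
proof -
  define P where "P l = deriv i (\<chi> (Var l))" for l
  \<comment> \<open>The defect of the chain rule. Modulo \<open>T\<close> it is additive, kills
    constants and turns x_j q into \<chi>(x_j) times the defect of q; as \<chi>(x_j) lies in m, each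
    split gains one order. The derivatives of elements of \<open>I\<close> must lie in
    \<open>T\<close> for a congruence modulo \<open>I\<close> to survive differentiation
    (\<open>dI\<close>).\<close>
  define D where "D a = deriv i (\<chi> a) - (\<Sum>l<s. P l * \<chi> (deriv l a))" for a
  have PR: "P l \<in> R s" if "l < s" for l unfolding P_def using that i by (auto intro!: R_deriv homod_R)
  have up: "ceq s T x y" if "ceq s I x y" for x y by (rule ceq_mono[OF that T(2,1)])
  have dI: "ceq s T (deriv i x) (deriv i y)" if "ceq s I x y" for x y
    using that T(1) T(3)[of "x - y" i] i by (auto simp: ceq_def deriv_diff intro: R_deriv)
  have DR: "D a \<in> R s" if "a \<in> R s" for a
    unfolding D_def using that i PR by (auto intro!: R_intros homod_R)
  have D_add: "ceq s T (D (a + b)) (D a + D b)" if "a \<in> R s" "b \<in> R s" for a b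
  proof -
    have "ceq s T (D (a + b))
        (deriv i (\<chi> a + \<chi> b) - (\<Sum>l<s. P l * (\<chi> (deriv l a) + \<chi> (deriv l b))))"
      unfolding D_def deriv_add[of _ a b] using that PR
      by (intro ceq_diff dI homod_add ceq_sum ceq_mult up T ceq_refl) (auto intro: R_deriv)
    also have "\<dots> = D a + D b"
      by (simp add: D_def deriv_add distrib_left sum.distrib)
    finally show ?thesis .
  qed
  have D_Const: "ceq s T (D (Const c)) 0" for c
  proof -
    have "ceq s T (deriv i (\<chi> (Const c))) 0" using dI[OF homod_Const[of c]] by simp
    then have "ceq s T (D (Const c)) (0 - (\<Sum>l<s. P l * 0))"
      unfolding D_def deriv_Const[of _ c]
      by (intro ceq_diff ceq_sum T ceq_mult up[OF homod_0] ceq_refl) (auto intro: PR)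
    then show ?thesis by simp
  qed
  have D_sum: "ceq s T (D (sum q J)) (\<Sum>j\<in>J. D (q j))" if "\<And>j. j \<in> J \<Longrightarrow> q j \<in> R s"
    for q and J :: "nat set"
    using that
  proof (induction J rule: infinite_finite_induct)
    case (insert x F)
    have "ceq s T (D (q x + sum q F)) (D (q x) + D (sum q F))"
      by (rule D_add) (use insert.prems in \<open>auto intro: R_sum\<close>)
    also have "ceq s T \<dots> (D (q x) + (\<Sum>i\<in>F. D (q i)))"
      using insert by (intro ceq_add ceq_refl T DR insert.IH) auto
    finally show ?case using insert.hyps by simp
  qed (use D_Const[of 0] in auto)
  have D_Var: "ceq s T (D (Var j * q)) (\<chi> (Var j) * D q)" if "j < s" "q \<in> R s" for j q
  proof -
    have x: "Var j \<in> R s" using that by simp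
    have "ceq s T (D (Var j * q)) (deriv i (\<chi> (Var j) * \<chi> q)
        - (\<Sum>l<s. P l * ((if l = j then \<chi> q else 0) + \<chi> (Var j) * \<chi> (deriv l q))))"
      unfolding D_def
    proof (intro ceq_diff ceq_sum ceq_mult T dI homod_mult ceq_refl)
      fix l assume "l \<in> {..<s}"
      then have l: "l < s" by simp
      show "P l \<in> R s" by (rule PR[OF l])
      have "ceq s I (\<chi> ((if l = j then q else 0) + Var j * deriv l q))
          (\<chi> (if l = j then q else 0) + \<chi> (Var j * deriv l q))"
        using that l by (intro homod_add) (auto intro!: R_mult R_deriv)
      also have "ceq s I \<dots> ((if l = j then \<chi> q else 0) + \<chi> (Var j) * \<chi> (deriv l q))"
        using that l homod_0 homod_idl
        by (intro ceq_add homod_mult) (auto intro!: R_deriv ceq_refl homod_R)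
      finally show "ceq s T (\<chi> (deriv l (Var j * q)))
          ((if l = j then \<chi> q else 0) + \<chi> (Var j) * \<chi> (deriv l q))"
        unfolding deriv_Var_mult by (rule up)
    qed (use that in auto)
    also have "deriv i (\<chi> (Var j) * \<chi> q)
        - (\<Sum>l<s. P l * ((if l = j then \<chi> q else 0) + \<chi> (Var j) * \<chi> (deriv l q)))
        = \<chi> (Var j) * D q"
    proof -
      have "(\<Sum>l<s. P l * ((if l = j then \<chi> q else 0) + \<chi> (Var j) * \<chi> (deriv l q)))
          = (\<Sum>l<s. (if l = j then P j * \<chi> q else 0)) + \<chi> (Var j) * (\<Sum>l<s. P l * \<chi> (deriv l q))"
        unfolding sum_distrib_left sum.distrib[symmetric]
        by (rule sum.cong) (auto simp: distrib_left mult_ac)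
      also have "\<dots> = P j * \<chi> q + \<chi> (Var j) * (\<Sum>l<s. P l * \<chi> (deriv l q))" using that by simp
      finally show ?thesis
        unfolding D_def deriv_mult[OF homod_R[OF x] homod_R[OF that(2)]]
        by (simp add: P_def right_diff_distrib)
    qed
    finally show ?thesis .
  qed
  have "\<forall>a\<in>R s. D a \<in> plusM s T N"
  proof (induction N)
    case 0
    show ?case by (auto intro!: plusM_M T DR)
  next
    case (Suc N)
    show ?case
    proof
      fix a :: "'a mps" assume a: "a \<in> R s"
      have q: "quot j a \<in> R s" if "j < s" for j using a that by (rule R_quot[rotated])
      have "ceq s T (D a) (D (Const (coeff a (\<lambda>_. 0))) + D (\<Sum>j<s. Var j * quot j a))"
        by (subst expand[OF a]) (intro D_add R_Const R_sum R_mult R_Var q, auto)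
      also have "ceq s T \<dots> (0 + (\<Sum>j<s. D (Var j * quot j a)))"
        by (intro ceq_add D_Const D_sum) (auto intro!: R_mult q)
      also have "ceq s T \<dots> (0 + (\<Sum>j<s. \<chi> (Var j) * D (quot j a)))"
        by (intro ceq_add ceq_sum T D_Var ceq_refl) (auto intro!: q)
      finally have "ceq s T (D a) (\<Sum>j<s. \<chi> (Var j) * D (quot j a))" by simp
      moreover have "(\<Sum>j<s. \<chi> (Var j) * D (quot j a)) \<in> plusM s T (Suc N)"
        using Suc q by (auto intro!: idl_sum[OF idl_plusM] plusM_mult_Suc T homod_R
            homod_local[simplified] M_Var')
      ultimately show "D a \<in> plusM s T (Suc N)"
        using plusM_diff_iff by (auto simp: ceq_def)
    qed
  qed
  then show ?thesis using a by (simp add: D_def P_def)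
qed

end

section \<open>Transport of finite codimension along an isomorphism of quotients\<close>

text \<open>An isomorphism \<open>R/I\<^sub>f \<cong> R/I\<^sub>g\<close> carries finite codimension of the ideal of \<open>g\<close> over to \<open>f\<close>. With
  \<open>P\<close> the Jacobian matrix of \<open>\<chi>\<close> and \<open>V\<^sub>j = \<chi> (\<partial>\<^sub>j g)\<close>, the chain rule gives \<open>P V \<equiv> 0\<close>, and the chain rule
  for \<open>\<psi>\<close> shows that \<open>P\<close> has a left inverse \<open>Q\<close> up to multiples of the \<open>V\<^sub>j\<close>. As the \<open>V\<^sub>j\<close> have
  positive order, Nakayama's lemma yields \<open>V \<equiv> 0\<close>.\<close>

lemma transport:
  fixes f g z :: "'a::field mps"
  assumes f: "f \<in> R s" and g: "g \<in> R s" "g \<in> M s 2" and z: "z \<in> R s"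
    and If: "I\<^sub>f \<subseteq> M s 1" "I\<^sub>f \<subseteq> tjid s z f" "\<And>x i. x \<in> I\<^sub>f \<Longrightarrow> i < s \<Longrightarrow> deriv i x \<in> tjid s z f"
    and Ig: "I\<^sub>g \<subseteq> M s 1" "I\<^sub>g \<subseteq> tjid s z g" "\<And>x i. x \<in> I\<^sub>g \<Longrightarrow> i < s \<Longrightarrow> deriv i x \<in> tjid s z g"
    and \<psi>: "homod s I\<^sub>g \<psi>" and \<chi>: "homod s I\<^sub>f \<chi>"
    and \<chi>\<psi>: "\<And>a. a \<in> R s \<Longrightarrow> \<chi> (\<psi> a) - a \<in> I\<^sub>f" and \<psi>\<chi>: "\<And>a. a \<in> R s \<Longrightarrow> \<psi> (\<chi> a) - a \<in> I\<^sub>g"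
    and \<chi>I\<^sub>g: "\<And>a. a \<in> I\<^sub>g \<Longrightarrow> \<chi> a \<in> I\<^sub>f"
    and dg: "\<And>i. i < s \<Longrightarrow> deriv i (\<chi> g) \<in> tjid s z f" and zg: "z * g \<in> I\<^sub>g"
    and sub: "R s \<inter> M s n \<subseteq> tjid s z g"
  shows "R s \<inter> M s n \<subseteq> tjid s z f"
proof (rule nakayama_M)
  let ?Tf = "tjid s z f" and ?Tg = "tjid s z g"
  note \<chi>R = homod_R[OF \<chi> If(1)] and \<psi>R = homod_R[OF \<psi> Ig(1)]
  have iTf: "idl s ?Tf" and iTg: "idl s ?Tg" using idl_tjid f g z by auto
  have idf: "idl s I\<^sub>f" and idg: "idl s I\<^sub>g" using \<chi> \<psi> by (auto simp: homod_def)
  show "idl s ?Tf" by (rule iTf)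
  \<comment> \<open>The precision to which the chain rule is used. The closing application of
    \<open>nakayama_M\<close> asks for m^n inside T_f + m^(n+1).\<close>
  define N where "N = Suc n"
  define TN where "TN = plusM s ?Tf N"
  have iTN: "idl s TN" unfolding TN_def by (rule idl_plusM[OF iTf])
  have ITN: "I\<^sub>f \<subseteq> TN" using If(2) plusM_I unfolding TN_def by blast
  define V where "V j = \<chi> (deriv j g)" for j
  define P where "P i j = deriv i (\<chi> (Var j))" for i j
  define Q where "Q l i = \<chi> (deriv l (\<psi> (Var i)))" for l i
  have dgR: "deriv j g \<in> R s" "deriv j g \<in> M s 1" if "j < s" for j
    using g that by (auto intro!: R_deriv M_deriv simp: numeral_2_eq_2)
  have V: "V j \<in> R s" "V j \<in> M s 1" if "j < s" for j
    unfolding V_def using dgR[OF that] \<chi>R homod_local[OF \<chi> If(1)] by auto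
  have P: "P i j \<in> R s" if "i < s" "j < s" for i j
    unfolding P_def using that by (auto intro!: R_deriv \<chi>R)
  have Q: "Q l i \<in> R s" if "l < s" "i < s" for l i
    unfolding Q_def using that by (auto intro!: R_deriv \<chi>R \<psi>R)
  have PV: "(\<Sum>j<s. P i j * V j) \<in> TN" if "i < s" for i
  proof -
    have 1: "deriv i (\<chi> g) - (\<Sum>j<s. P i j * V j) \<in> TN"
      unfolding TN_def P_def V_def
      by (rule homod_chain_rule[OF \<chi> If(1) iTf If(2) If(3) that g(1)])
    have "deriv i (\<chi> g) \<in> TN" using dg[OF that] plusM_I unfolding TN_def by blast
    from idl_diff[OF iTN this 1] show ?thesis by simp
  qed
  \<comment> \<open>T_f + m^N together with the V_j: an ideal that contains the image under \<chi>
    of T_g + m^N. The aim is to show that the V_j add nothing to it.\<close>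
  define K where "K = {t + (\<Sum>j<s. c j * V j) |t c. t \<in> TN \<and> (\<forall>j<s. c j \<in> R s)}"
  have KI: "t + (\<Sum>j<s. c j * V j) \<in> K" if "t \<in> TN" "\<And>j. j < s \<Longrightarrow> c j \<in> R s" for t c
    using that unfolding K_def by blast
  have TNK: "TN \<subseteq> K" using KI[of _ "\<lambda>_. 0"] by auto
  have iK: "idl s K"
    unfolding idl_def
  proof (intro conjI ballI subsetI)
    show "x \<in> R s" if "x \<in> K" for x
      using that V idl_R[OF iTN] by (auto simp: K_def intro!: R_intros)
    show "0 \<in> K" using TNK idl_0[OF iTN] by auto
    fix x assume "x \<in> K"
    then obtain t c where x: "x = t + (\<Sum>j<s. c j * V j)" "t \<in> TN" "\<And>j. j < s \<Longrightarrow> c j \<in> R s"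
      unfolding K_def by auto
    show "r * x \<in> K" if r: "r \<in> R s" for r
      using KI[of "r * t" "\<lambda>j. r * c j"] r x iTN
      by (simp add: idl_mult R_mult distrib_left sum_distrib_left mult.assoc)
    fix y assume "y \<in> K"
    then obtain t' c' where y: "y = t' + (\<Sum>j<s. c' j * V j)" "t' \<in> TN" "\<And>j. j < s \<Longrightarrow> c' j \<in> R s"
      unfolding K_def by auto
    have eq: "x + y = (t + t') + (\<Sum>j<s. (c j + c' j) * V j)"
      by (simp add: x y distrib_right sum.distrib)
    show "x + y \<in> K"
      unfolding eq by (rule KI) (use x y iTN in \<open>auto intro: idl_add R_add\<close>)
  qed
  have up: "ceq s K x y" if "ceq s I\<^sub>f x y" for x y
    by (rule ceq_mono[OF that order.trans[OF ITN TNK] iK])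
  have \<chi>Tg: "\<chi> x \<in> K" if x: "x \<in> ?Tg" for x
  proof -
    obtain a b where ab: "x = a * (z * g) + (\<Sum>i<s. b i * deriv i g)" "a \<in> R s"
      "\<And>i. i < s \<Longrightarrow> b i \<in> R s" using x by (auto simp: tjid_def)
    have zgR: "a * (z * g) \<in> R s" using ab z g by (intro R_mult)
    have S: "(\<Sum>i<s. b i * deriv i g) \<in> R s" using ab dgR by (intro R_sum R_mult) auto
    have "ceq s I\<^sub>f (\<chi> x) (\<chi> (a * (z * g)) + \<chi> (\<Sum>i<s. b i * deriv i g))"
      unfolding ab by (rule homod_add[OF \<chi> If(1) zgR S])
    also have "ceq s I\<^sub>f \<dots> (0 + (\<Sum>i<s. \<chi> (b i * deriv i g)))"
    proof (intro ceq_add homod_sum[OF \<chi> If(1)])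
      show "ceq s I\<^sub>f (\<chi> (a * (z * g))) 0"
        by (intro ceq_0 idf \<chi>I\<^sub>g idl_mult[OF idg ab(2) zg])
    qed (use ab dgR in \<open>auto intro: R_mult\<close>)
    also have "ceq s I\<^sub>f \<dots> (0 + (\<Sum>i<s. \<chi> (b i) * V i))"
      unfolding V_def using ab dgR
      by (intro ceq_add ceq_sum homod_mult[OF \<chi> If(1)] ceq_refl idf) auto
    finally have "ceq s K (\<chi> x) (\<Sum>i<s. \<chi> (b i) * V i)"
      by (intro up) simp
    moreover have "(\<Sum>i<s. \<chi> (b i) * V i) \<in> K"
      using KI[of 0 "\<lambda>i. \<chi> (b i)"] ab \<chi>R idl_0[OF iTN] by simp
    ultimately show ?thesis by (rule ceq_mem)
  qed
  have \<chi>plus: "\<chi> x \<in> K" if x: "x \<in> plusM s ?Tg N" for x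
  proof -
    obtain a b where ab: "x = a + b" "a \<in> ?Tg" "b \<in> R s" "b \<in> M s N"
      using x by (auto simp: plusM_def)
    have "\<chi> b \<in> plusM s I\<^sub>f N" by (rule homod_M[OF \<chi> If(1) ab(3,4)])
    then have "\<chi> b \<in> TN" unfolding TN_def plusM_def using If(2) by blast
    then have "\<chi> a + \<chi> b \<in> K" using \<chi>Tg[OF ab(2)] TNK by (auto intro: idl_add[OF iK])
    moreover have "ceq s I\<^sub>f (\<chi> x) (\<chi> a + \<chi> b)"
      unfolding ab by (rule homod_add[OF \<chi> If(1)]) (use ab idl_R[OF iTg] in auto)
    then have "ceq s K (\<chi> x) (\<chi> a + \<chi> b)" by (rule up)
    ultimately show ?thesis by (metis ceq_mem)
  qed
  \<comment> \<open>As \<psi>(\<chi>(x_j)) - x_j lies in I_g, its partial derivatives lie in T_g.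
    The chain rule for \<psi> then expresses the identity matrix as the product of the matrices
    \<partial>_l \<psi>(x_i) and \<psi>(P_ij), modulo T_g + m^N. Applying \<chi>, with \<chi> \<psi>
    congruent to the identity, gives QP = 1 modulo \<open>K\<close>.\<close>
  have QP: "(if l = j then 1 else 0) - (\<Sum>i<s. Q l i * P i j) \<in> K" if l: "l < s" and j: "j < s" for l j
  proof -
    define \<delta> :: "'a mps" where "\<delta> = (if l = j then 1 else 0)"
    have \<delta>R: "\<delta> \<in> R s" and \<delta>\<chi>: "ceq s I\<^sub>f (\<chi> \<delta>) \<delta>"
      using homod_1[OF \<chi> If(1)] homod_0[OF \<chi> If(1)] by (auto simp: \<delta>_def)
    define q where "q i = deriv l (\<psi> (Var i))" for i
    have qR: "q i \<in> R s" if "i < s" for i unfolding q_def using that l by (auto intro!: R_deriv \<psi>R)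
    have \<chi>x: "\<chi> (Var j) \<in> R s" using j by (auto intro!: \<chi>R)
    define e where "e = \<delta> - (\<Sum>i<s. q i * \<psi> (P i j))"
    have S: "(\<Sum>i<s. q i * \<psi> (P i j)) \<in> R s"
      using qR P j \<psi>R by (auto intro!: R_sum R_mult)
    have "deriv l (\<psi> (\<chi> (Var j))) - (\<Sum>i<s. q i * \<psi> (P i j)) \<in> plusM s ?Tg N"
      unfolding q_def P_def by (rule homod_chain_rule[OF \<psi> Ig(1) iTg Ig(2) Ig(3) l \<chi>x])
    moreover have "deriv l (\<psi> (\<chi> (Var j)) - Var j) \<in> plusM s ?Tg N"
      using Ig(3)[OF \<psi>\<chi> l] j by (auto intro: plusM_I)
    moreover have "e = (deriv l (\<psi> (\<chi> (Var j))) - (\<Sum>i<s. q i * \<psi> (P i j)))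
        - deriv l (\<psi> (\<chi> (Var j)) - Var j)"
      by (simp add: e_def deriv_diff deriv_Var \<delta>_def)
    ultimately have "e \<in> plusM s ?Tg N" using idl_diff[OF idl_plusM[OF iTg]] by metis
    then have \<chi>e: "\<chi> e \<in> K" by (rule \<chi>plus)
    have "ceq s I\<^sub>f (\<chi> e) (\<chi> \<delta> - \<chi> (\<Sum>i<s. q i * \<psi> (P i j)))"
      unfolding e_def by (rule homod_diff[OF \<chi> If(1) \<delta>R S])
    also have "ceq s I\<^sub>f \<dots> (\<delta> - (\<Sum>i<s. \<chi> (q i * \<psi> (P i j))))"
      using qR P j \<psi>R by (intro ceq_diff \<delta>\<chi> homod_sum[OF \<chi> If(1)]) (auto intro: R_mult)
    also have "ceq s I\<^sub>f \<dots> (\<delta> - (\<Sum>i<s. \<chi> (q i) * \<chi> (\<psi> (P i j))))"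
      using qR P j \<psi>R \<delta>R
      by (intro ceq_diff ceq_sum homod_mult[OF \<chi> If(1)] ceq_refl idf) auto
    also have "ceq s I\<^sub>f \<dots> (\<delta> - (\<Sum>i<s. \<chi> (q i) * P i j))"
    proof (intro ceq_diff ceq_sum ceq_mult ceq_refl idf \<delta>R \<chi>R)
      fix i assume "i \<in> {..<s}"
      then have i: "i < s" by simp
      show "q i \<in> R s" by (rule qR[OF i])
      show "ceq s I\<^sub>f (\<chi> (\<psi> (P i j))) (P i j)"
        using \<chi>\<psi>[OF P[OF i j]] P[OF i j] idf \<chi>R \<psi>R by (simp add: ceq_def)
    qed
    finally have "ceq s I\<^sub>f (\<chi> e) (\<delta> - (\<Sum>i<s. Q l i * P i j))" by (simp add: Q_def q_def)
    then have "ceq s K (\<delta> - (\<Sum>i<s. Q l i * P i j)) (\<chi> e)"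
      by (intro ceq_sym[OF up])
    then show ?thesis using \<chi>e unfolding \<delta>_def by (rule ceq_mem)
  qed
  have VTN: "V l \<in> TN" if l: "l < s" for l
  proof -
    define Z where "Z l j t c \<longleftrightarrow> t \<in> TN \<and> (\<forall>m<s. c m \<in> R s) \<and>
        (if l = j then 1 else 0) - (\<Sum>i<s. Q l i * P i j) = t + (\<Sum>m<s. c m * V m)" for l j t c
    have "\<exists>t c. Z l j t c" if "l < s" "j < s" for l j
      using QP[OF that] unfolding K_def Z_def by blast
    then have "\<forall>l j. \<exists>t c. l < s \<longrightarrow> j < s \<longrightarrow> Z l j t c" by blast
    then obtain t c where "\<And>l j. l < s \<Longrightarrow> j < s \<Longrightarrow> Z l j (t l j) (c l j)" by metis
    then have tc: "\<And>l j. l < s \<Longrightarrow> j < s \<Longrightarrow> t l j \<in> TN"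
      "\<And>l j m. l < s \<Longrightarrow> j < s \<Longrightarrow> m < s \<Longrightarrow> c l j m \<in> R s"
      "\<And>l j. l < s \<Longrightarrow> j < s \<Longrightarrow> (if l = j then 1 else 0) - (\<Sum>i<s. Q l i * P i j)
        = t l j + (\<Sum>m<s. c l j m * V m)" unfolding Z_def by auto
    show ?thesis
    \<comment> \<open>The identity matrix is QP + t + (sum of c_m V_m). Applied to the vector V, the
      parts QPV and tV fall into \<open>TN\<close>, and what remains is a matrix with entries in
      m.\<close>
    proof (rule nakayama_family[OF iTN, where F = "{..<s}" and m = "\<lambda>l j. \<Sum>m<s. c l j m * V m"])
      show "l \<in> {..<s}" using l by simp
      fix l j assume "l \<in> {..<s}" "j \<in> {..<s}"
      then show "(\<Sum>m<s. c l j m * V m) \<in> R s \<inter> M s 1"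
        using tc(2) V by (auto intro!: R_intros M_sum M_mult_left)
    next
      fix l assume "l \<in> {..<s}"
      then have l: "l < s" by simp
      have "V l = (\<Sum>j<s. (if l = j then 1 else 0) * V j)"
        using l by (simp add: if_distrib[of "\<lambda>x. x * _"] cong: if_cong)
      also have "\<dots> = (\<Sum>j<s. (\<Sum>i<s. Q l i * P i j) * V j + t l j * V j
          + (\<Sum>m<s. c l j m * V m) * V j)"
      proof (rule sum.cong)
        fix j assume "j \<in> {..<s}"
        then have "(if l = j then 1 else 0)
            = (\<Sum>i<s. Q l i * P i j) + t l j + (\<Sum>m<s. c l j m * V m)"
          using tc(3)[OF l, of j] by (simp only: lessThan_iff diff_eq_eq add_ac)
        then show "(if l = j then 1 else 0) * V j = (\<Sum>i<s. Q l i * P i j) * V j + t l j * V j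
          + (\<Sum>m<s. c l j m * V m) * V j" by (simp only: distrib_right)
      qed simp
      also have "\<dots> = (\<Sum>j<s. (\<Sum>i<s. Q l i * P i j) * V j) + (\<Sum>j<s. t l j * V j)
          + (\<Sum>j<s. (\<Sum>m<s. c l j m * V m) * V j)" by (simp only: sum.distrib)
      also have "(\<Sum>j<s. (\<Sum>i<s. Q l i * P i j) * V j) = (\<Sum>i<s. Q l i * (\<Sum>j<s. P i j * V j))"
        by (simp only: sum_distrib_left sum_distrib_right mult.assoc) (rule sum.swap)
      finally have "V l - (\<Sum>j<s. (\<Sum>m<s. c l j m * V m) * V j)
          = (\<Sum>i<s. Q l i * (\<Sum>j<s. P i j * V j)) + (\<Sum>j<s. t l j * V j)" by simp
      also have "\<dots> \<in> TN"
      proof (rule idl_add[OF iTN]; rule idl_sum[OF iTN])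
        show "Q l i * (\<Sum>j<s. P i j * V j) \<in> TN" if "i \<in> {..<s}" for i
          using that l Q PV by (intro idl_mult[OF iTN]) auto
        show "t l j * V j \<in> TN" if "j \<in> {..<s}" for j
          using that l tc(1) V by (intro idl_mult'[OF iTN]) auto
      qed
      finally show "V l - (\<Sum>j<s. (\<Sum>m<s. c l j m * V m) * V j) \<in> TN" .
    qed simp
  qed
  have KTN: "K \<subseteq> TN"
  proof
    fix x assume "x \<in> K"
    then obtain t c where "x = t + (\<Sum>j<s. c j * V j)" "t \<in> TN" "\<And>j. j < s \<Longrightarrow> c j \<in> R s"
      unfolding K_def by auto
    then show "x \<in> TN" using VTN by (auto intro!: idl_add[OF iTN] idl_sum[OF iTN] idl_mult[OF iTN])
  qed
  \<comment> \<open>By continuity \<psi>(a) lies in I_g + m^n, hence in T_g; \<chi> brings it back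
    into \<open>K\<close>, which now equals \<open>TN\<close>, and \<chi>(\<psi>(a)) agrees with a
    modulo I_f.\<close>
  show "R s \<inter> M s n \<subseteq> plusM s ?Tf (Suc n)"
  proof
    fix a :: "'a mps" assume a: "a \<in> R s \<inter> M s n"
    have "\<psi> a \<in> plusM s I\<^sub>g n" by (rule homod_M[OF \<psi> Ig(1)]) (use a in auto)
    then obtain p q where "\<psi> a = p + q" "p \<in> I\<^sub>g" "q \<in> R s \<inter> M s n" unfolding plusM_def by auto
    then have "\<psi> a \<in> ?Tg" using subsetD[OF Ig(2)] subsetD[OF sub] by (auto intro: idl_add[OF iTg])
    then have "\<chi> (\<psi> a) \<in> TN" using \<chi>Tg KTN by blast
    moreover have "\<chi> (\<psi> a) - a \<in> TN" using \<chi>\<psi> a ITN by blast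
    ultimately have "\<chi> (\<psi> a) - (\<chi> (\<psi> a) - a) \<in> TN" by (rule idl_diff[OF iTN])
    then show "a \<in> plusM s ?Tf (Suc n)" by (simp add: TN_def N_def)
  qed
qed

subsection \<open>Codimension\<close>

text \<open>Gaussian elimination: a row \<open>i0\<close> with nonzero entry in column
  \<open>b0\<close> clears that column from the other rows, which are dependent on the remaining
  columns by induction. The coefficient of \<open>i0\<close> undoes the elimination.\<close>

lemma linear_dependence:
  fixes c :: "'i \<Rightarrow> 'b \<Rightarrow> 'a::field"
  assumes "finite B" "finite I" "card B < card I"
  shows "\<exists>a. (\<exists>i\<in>I. a i \<noteq> 0) \<and> (\<forall>b\<in>B. (\<Sum>i\<in>I. a i * c i b) = 0)"
  using assms
proof (induction B arbitrary: I c rule: finite_induct)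
  case empty
  then have "I \<noteq> {}" by auto
  then show ?case by (intro exI[of _ "\<lambda>_. 1"]) auto
next
  case (insert b0 B)
  show ?case
  proof (cases "\<forall>i\<in>I. c i b0 = 0")
    case True
    then show ?thesis using insert.IH[of I c] insert by auto
  next
    case False
    then obtain i0 where i0: "i0 \<in> I" "c i0 b0 \<noteq> 0" by auto
    define r where "r i = c i b0 / c i0 b0" for i
    have "card B < card (I - {i0})" using insert i0 by auto
    with insert.IH[of "I - {i0}" "\<lambda>i b. c i b - r i * c i0 b"] insert.prems
    obtain a where a: "\<exists>i\<in>I - {i0}. a i \<noteq> 0"
      "\<And>b. b \<in> B \<Longrightarrow> (\<Sum>i\<in>I - {i0}. a i * (c i b - r i * c i0 b)) = 0" by auto
    define a' where "a' = a(i0 := - (\<Sum>i\<in>I - {i0}. a i * r i))"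
    have eq: "(\<Sum>i\<in>I. a' i * c i b) = (\<Sum>i\<in>I - {i0}. a i * (c i b - r i * c i0 b))" for b
    proof -
      have "(\<Sum>i\<in>I. a' i * c i b) = a' i0 * c i0 b + (\<Sum>i\<in>I - {i0}. a' i * c i b)"
        using insert.prems i0 by (simp add: sum.remove)
      also have "(\<Sum>i\<in>I - {i0}. a' i * c i b) = (\<Sum>i\<in>I - {i0}. a i * c i b)"
        by (rule sum.cong) (auto simp: a'_def)
      finally show ?thesis
        by (simp add: a'_def right_diff_distrib sum_subtractf sum_distrib_right mult.assoc)
    qed
    show ?thesis
    proof (intro exI[of _ a'] conjI ballI)
      show "\<exists>i\<in>I. a' i \<noteq> 0" using a(1) by (auto simp: a'_def)
      fix b assume "b \<in> insert b0 B"
      then show "(\<Sum>i\<in>I. a' i * c i b) = 0"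
        unfolding eq using a(2) i0 by (auto simp: r_def)
    qed
  qed
qed

text \<open>Elements of distinct orders that do not drop into \<open>J + M (n + 1)\<close> are independent modulo
  \<open>J\<close>, so at most \<open>card B\<close> steps of the filtration of \<open>R/J\<close> are strict.\<close>

lemma codim_bound:
  fixes J :: "'a::field mps set" and w :: "'b \<Rightarrow> 'a mps"
  assumes J: "idl s J" and B: "finite B"
    and span: "\<And>n. \<not> R s \<inter> M s n \<subseteq> plusM s J (Suc n) \<Longrightarrow>
      \<exists>v \<in> R s \<inter> M s n - plusM s J (Suc n). \<exists>c. v - (\<Sum>b\<in>B. Const (c b) * w b) \<in> J"
  shows "R s \<inter> M s (card B) \<subseteq> J"
proof -
  have "\<exists>n\<le>card B. R s \<inter> M s n \<subseteq> plusM s J (Suc n)"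
  proof (rule ccontr)
    assume "\<not> ?thesis"
    then have "\<forall>n. \<exists>v c. n \<le> card B \<longrightarrow> v \<in> R s \<inter> M s n - plusM s J (Suc n) \<and>
        v - (\<Sum>b\<in>B. Const (c b) * w b) \<in> J"
      using span by blast
    then obtain v c where v: "\<And>n. n \<le> card B \<Longrightarrow> v n \<in> R s \<inter> M s n - plusM s J (Suc n)"
      and c: "\<And>n. n \<le> card B \<Longrightarrow> v n - (\<Sum>b\<in>B. Const (c n b) * w b) \<in> J" by metis
    obtain a where a: "\<exists>n\<le>card B. a n \<noteq> 0"
      and ac: "\<And>b. b \<in> B \<Longrightarrow> (\<Sum>n\<le>card B. a n * c n b) = 0"
      using linear_dependence[OF B, of "{..card B}" c] by auto
    have "(\<Sum>n\<le>card B. Const (a n) * (\<Sum>b\<in>B. Const (c n b) * w b)) = 0"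
    proof -
      have "(\<Sum>n\<le>card B. Const (a n) * (\<Sum>b\<in>B. Const (c n b) * w b))
          = (\<Sum>b\<in>B. (\<Sum>n\<le>card B. Const (a n * c n b)) * w b)"
        by (simp only: sum_distrib_left sum_distrib_right Const_mult mult.assoc) (rule sum.swap)
      moreover have "(\<Sum>n\<le>card B. Const (a n * c n b)) = Const (\<Sum>n\<le>card B. a n * c n b)" for b
        by (rule mps_eqI) (simp add: coeff_Const)
      ultimately show ?thesis using ac by simp
    qed
    then have "(\<Sum>n\<le>card B. Const (a n) * v n)
        = (\<Sum>n\<le>card B. Const (a n) * (v n - (\<Sum>b\<in>B. Const (c n b) * w b)))"
      by (simp add: right_diff_distrib sum_subtractf)
    also have "\<dots> \<in> J" using c by (intro idl_sum[OF J] idl_mult[OF J]) auto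
    finally have inJ: "(\<Sum>n\<le>card B. Const (a n) * v n) \<in> J" .
    \<comment> \<open>The lowest order occurring in the relation. All other terms with nonzero
      coefficient have order at least m + 1, so the relation forces v_m into J + m^(m+1), contrary
      to its choice.\<close>
    define m where "m = (LEAST n. n \<le> card B \<and> a n \<noteq> 0)"
    have m: "m \<le> card B" "a m \<noteq> 0"
      using LeastI_ex[of "\<lambda>n. n \<le> card B \<and> a n \<noteq> 0"] a unfolding m_def by auto
    have m0: "a n = 0" if "n < m" for n
      using not_less_Least[of n "\<lambda>n. n \<le> card B \<and> a n \<noteq> 0"] that m(1) unfolding m_def by auto
    have rest: "(\<Sum>n\<in>{..card B} - {m}. Const (a n) * v n) \<in> R s \<inter> M s (Suc m)"
    proof -
      have "Const (a n) * v n \<in> R s \<inter> M s (Suc m)" if "n \<in> {..card B} - {m}" for n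
      proof (cases "n < m")
        case False
        then have "v n \<in> R s" "v n \<in> M s (Suc m)"
          using v[of n] that M_antimono[of "v n" s n "Suc m"] by auto
        then show ?thesis by (auto intro: R_mult M_mult_left)
      qed (simp add: m0)
      then show ?thesis by (auto intro!: R_sum M_sum)
    qed
    have "Const (a m) * v m = (\<Sum>n\<le>card B. Const (a n) * v n)
        + - (\<Sum>n\<in>{..card B} - {m}. Const (a n) * v n)"
      using m by (simp add: sum.remove[of "{..card B}" m])
    also have "\<dots> \<in> plusM s J (Suc m)"
      using inJ rest by (intro plusMI) (auto intro: R_uminus M_uminus)
    finally have "Const (1 / a m) * (Const (a m) * v m) \<in> plusM s J (Suc m)"
      by (rule idl_mult[OF idl_plusM[OF J] R_Const])
    then have "v m \<in> plusM s J (Suc m)"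
      using m(2) by (simp add: mult.assoc[symmetric] Const_mult[symmetric])
    then show False using v[OF m(1)] by blast
  qed
  then obtain n where n: "n \<le> card B" "R s \<inter> M s n \<subseteq> plusM s J (Suc n)" by blast
  have "R s \<inter> M s n \<subseteq> J" by (rule nakayama_M[OF J n(2)])
  then show ?thesis using M_antimono[OF _ n(1)] by blast
qed

section \<open>A nearby polynomial with finite Milnor number\<close>

lemma psub_Var_diff: "f \<in> R s \<Longrightarrow> f - psub s Var N f \<in> M s N"
  using subst_psub[of s Var f N] subst_ident[of f s] by (simp add: M_Var')

lemma poly_psub:
  fixes f :: "'a::field mps"
  assumes f: "f \<in> R s" and fin: "\<And>\<alpha>. N \<le> deg s \<alpha> \<Longrightarrow> coeff f \<alpha> = 0"
  shows "f = psub s Var N f"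
proof -
  have "f - psub s Var N f \<in> M s n" for n
  proof (cases "n \<le> N")
    case True
    then show ?thesis using psub_Var_diff[OF f] M_antimono by blast
  next
    case False
    have "psub s Var n f = psub s Var N f"
      unfolding psub_def using False fin
      by (intro sum.mono_neutral_right) (auto simp: finite_exps, auto simp: exps_def)
    then show ?thesis using psub_Var_diff[OF f, of n] by simp
  qed
  then have "f - psub s Var N f = 0" by (rule M_separated)
  then show ?thesis by simp
qed

lemma ymon_Var_R: "ymon s Var \<alpha> \<in> R s"
  unfolding ymon_def by (intro R_prod R_power) simp

lemma ymon_mult: "ymon s y \<alpha> * ymon s y \<beta> = ymon s y (\<lambda>i. \<alpha> i + \<beta> i)"
  by (simp add: ymon_def power_add prod.distrib)

lemma deriv_Var_power: "deriv i (Var j ^ n :: 'a::field mps)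
    = (if i = j then Const (of_nat n) * Var j ^ (n - 1) else 0)"
proof (induction n)
  case 0
  show ?case using deriv_Const[of i "1 :: 'a"] by simp
next
  case (Suc n)
  have "deriv i (Var j ^ Suc n :: 'a mps)
      = (if i = j then Var j ^ n else 0) + Var j * deriv i (Var j ^ n)"
    by (simp add: deriv_Var_mult)
  also have "Var j * (Const (of_nat n) * Var j ^ (n - 1)) = Const (of_nat n) * (Var j ^ n :: 'a mps)"
    by (cases n) (auto simp: mult_ac)
  then have "(if i = j then Var j ^ n else 0) + Var j * deriv i (Var j ^ n)
      = (if i = j then Const (of_nat (Suc n)) * Var j ^ n else 0 :: 'a mps)"
    unfolding Suc by (simp add: Const_add distrib_right)
  finally show ?case by simp
qed

text \<open>The polynomial \<open>f + \<Sum> x\<^sub>i\<^sup>N\<close> has finite Milnor number in every characteristic not dividing \<open>N\<close>: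
  the leading forms of its partial derivatives are \<open>N x\<^sub>i\<^sup>N\<^sup>-\<^sup>1\<close>, so monomials with an exponent
  \<open>\<ge> N - 1\<close> reduce to polynomials of lower degree.\<close>

lemma milnor_finite_example:
  fixes f :: "'a::field mps"
  assumes f: "f \<in> R s" and fin: "\<And>\<alpha>. N \<le> deg s \<alpha> \<Longrightarrow> coeff f \<alpha> = 0"
    and N: "1 \<le> N" "of_nat N \<noteq> (0::'a)" and g: "g = f + (\<Sum>i<s. Var i ^ N)"
    and J: "idl s J" "\<And>i. i < s \<Longrightarrow> deriv i g \<in> J"
  shows "\<exists>n. R s \<inter> M s n \<subseteq> J"
proof -
  define B where "B = {\<beta> \<in> mons s. \<forall>i<s. \<beta> i < N - 1}"
  have "B \<subseteq> {h. \<forall>x. (x \<in> {..<s} \<longrightarrow> h x \<in> {..N}) \<and> (x \<notin> {..<s} \<longrightarrow> h x = 0)}"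
    by (auto simp: B_def mons_def intro: less_imp_le less_le_trans)
  moreover have "finite \<dots>" by (rule finite_set_of_finite_funs) auto
  ultimately have finB: "finite B" by (rule finite_subset)
  \<comment> \<open>Congruence modulo \<open>J\<close> to a combination of monomials in
    \<open>B\<close>. Reduction lowers the degree, so it terminates on a monomial; nothing is
    claimed for infinite series.\<close>
  define Sp where "Sp v \<longleftrightarrow> (\<exists>c. v - (\<Sum>b\<in>B. Const (c b) * ymon s Var b) \<in> J)" for v :: "'a mps"
  have Sp_J: "Sp v" if "v \<in> J" for v
    unfolding Sp_def by (rule exI[of _ "\<lambda>_. 0"]) (use that in simp)
  have Sp_add: "Sp (v + w)" if "Sp v" "Sp w" for v w
  proof -
    obtain c d where cd: "v - (\<Sum>b\<in>B. Const (c b) * ymon s Var b) \<in> J"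
      "w - (\<Sum>b\<in>B. Const (d b) * ymon s Var b) \<in> J" using \<open>Sp v\<close> \<open>Sp w\<close> unfolding Sp_def by blast
    have "v + w - (\<Sum>b\<in>B. Const (c b + d b) * ymon s Var b)
        = (v - (\<Sum>b\<in>B. Const (c b) * ymon s Var b)) + (w - (\<Sum>b\<in>B. Const (d b) * ymon s Var b))"
      by (simp add: Const_add distrib_right sum.distrib)
    also have "\<dots> \<in> J" by (rule idl_add[OF J(1) cd])
    finally show ?thesis unfolding Sp_def by (intro exI[of _ "\<lambda>b. c b + d b"])
  qed
  have Sp_Const: "Sp (Const k * v)" if "Sp v" for k v
  proof -
    obtain c where c: "v - (\<Sum>b\<in>B. Const (c b) * ymon s Var b) \<in> J"
      using \<open>Sp v\<close> unfolding Sp_def by blast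
    have "Const k * v - (\<Sum>b\<in>B. Const (k * c b) * ymon s Var b)
        = Const k * (v - (\<Sum>b\<in>B. Const (c b) * ymon s Var b))"
      by (simp add: Const_mult right_diff_distrib sum_distrib_left mult.assoc)
    also have "\<dots> \<in> J" by (rule idl_mult[OF J(1) R_Const c])
    finally show ?thesis unfolding Sp_def by (intro exI[of _ "\<lambda>b. k * c b"])
  qed
  have Sp_sum: "Sp (sum h A)" if "\<And>x. x \<in> A \<Longrightarrow> Sp (h x)" for h and A :: "(nat \<Rightarrow> nat) set"
    using that
    by (induction A rule: infinite_finite_induct) (auto intro: Sp_add Sp_J idl_0[OF J(1)])
  have mono: "Sp (ymon s Var \<alpha>)" if "\<alpha> \<in> mons s" for \<alpha>
    using that
  proof (induction "deg s \<alpha>" arbitrary: \<alpha> rule: less_induct)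
    case less
    show ?case
    proof (cases "\<alpha> \<in> B")
      case True
      have "(\<Sum>b\<in>B. Const (if b = \<alpha> then 1 else 0) * ymon s Var b)
          = (\<Sum>b\<in>B. if b = \<alpha> then ymon s Var \<alpha> else 0 :: 'a mps)" by (rule sum.cong) auto
      then have "(\<Sum>b\<in>B. Const (if b = \<alpha> then 1 else 0) * ymon s Var b) = (ymon s Var \<alpha> :: 'a mps)"
        using True finB by simp
      then show ?thesis unfolding Sp_def
        by (intro exI[of _ "\<lambda>b. if b = \<alpha> then 1 else 0"]) (simp add: idl_0[OF J(1)])
    next
      case False
      then obtain i where i: "i < s" "N - 1 \<le> \<alpha> i" using less.prems by (auto simp: B_def)
      define \<alpha>' where "\<alpha>' = \<alpha>(i := \<alpha> i - (N - 1))"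
      have degs: "deg s \<alpha> = deg s \<alpha>' + (N - 1)"
        using i by (simp add: \<alpha>'_def deg_def sum.remove[of "{..<s}" i])
      have \<alpha>'m: "\<alpha>' \<in> mons s" using less.prems by (auto simp: \<alpha>'_def mons_def)
      have mon: "ymon s Var \<alpha> = ymon s Var \<alpha>' * (Var i ^ (N - 1) :: 'a mps)"
      proof -
        have "(\<Prod>j\<in>{..<s} - {i}. Var j ^ \<alpha>' j) = (\<Prod>j\<in>{..<s} - {i}. Var j ^ \<alpha> j :: 'a mps)"
          by (rule prod.cong) (auto simp: \<alpha>'_def)
        then have "ymon s Var \<alpha>' * Var i ^ (N - 1)
            = (Var i ^ (\<alpha> i - (N - 1)) * Var i ^ (N - 1)) * (\<Prod>j\<in>{..<s} - {i}. Var j ^ \<alpha> j :: 'a mps)"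
          unfolding ymon_def using i
          by (simp add: prod.remove[of "{..<s}" i] \<alpha>'_def mult_ac)
        also have "Var i ^ (\<alpha> i - (N - 1)) * Var i ^ (N - 1) = (Var i ^ \<alpha> i :: 'a mps)"
          using i by (simp flip: power_add)
        finally show ?thesis unfolding ymon_def using i by (simp add: prod.remove[of "{..<s}" i])
      qed
      have "(\<Sum>j<s. deriv i (Var j ^ N)) = Const (of_nat N) * (Var i ^ (N - 1) :: 'a mps)"
        unfolding deriv_Var_power using i by simp
      then have dg: "deriv i g = deriv i f + Const (of_nat N) * Var i ^ (N - 1)"
        by (simp add: g deriv_add deriv_sum)
      \<comment> \<open>As \<open>f\<close> has degree below N, its derivative has degree below N -
        1. Its monomials times x^\<alpha>' therefore have smaller degree than x^\<alpha>, and the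
        induction hypothesis applies to them.\<close>
      have df: "deriv i f = psub s Var (N - 1) (deriv i f)"
      proof (rule poly_psub)
        show "deriv i f \<in> R s" by (rule R_deriv[OF i(1) f])
        fix \<alpha> assume "N - 1 \<le> deg s \<alpha>"
        then have "N \<le> deg s (\<alpha>(i := Suc (\<alpha> i)))" using deg_upd[OF i(1), of \<alpha>] by simp
        then show "coeff (deriv i f) \<alpha> = 0" using fin by (simp add: coeff_deriv)
      qed
      have "Sp (ymon s Var \<alpha>' * deriv i f)"
      proof -
        have eq: "ymon s Var \<alpha>' * deriv i f = (\<Sum>\<beta>\<in>exps s (N - 1).
            Const (coeff (deriv i f) \<beta>) * ymon s Var (\<lambda>j. \<alpha>' j + \<beta> j))"
          by (subst df) (simp add: psub_def sum_distrib_left ymon_mult[symmetric] mult_ac)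
        have "Sp (Const (coeff (deriv i f) \<beta>) * ymon s Var (\<lambda>j. \<alpha>' j + \<beta> j))"
          if "\<beta> \<in> exps s (N - 1)" for \<beta>
        proof (rule Sp_Const, rule less.hyps)
          show "deg s (\<lambda>j. \<alpha>' j + \<beta> j) < deg s \<alpha>"
            using that degs by (simp add: exps_def deg_def sum.distrib)
          show "(\<lambda>j. \<alpha>' j + \<beta> j) \<in> mons s" using that \<alpha>'m by (auto simp: exps_def mons_def)
        qed
        then show ?thesis unfolding eq by (rule Sp_sum)
      qed
      moreover have "Sp (ymon s Var \<alpha>' * deriv i g)"
        by (intro Sp_J idl_mult[OF J(1)] ymon_Var_R J(2) i)
      ultimately have "Sp (Const (1 / of_nat N) * (ymon s Var \<alpha>' * deriv i g
          + Const (- 1) * (ymon s Var \<alpha>' * deriv i f)))"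
        by (intro Sp_Const Sp_add)
      also have "Const (1 / of_nat N) * (ymon s Var \<alpha>' * deriv i g
          + Const (- 1) * (ymon s Var \<alpha>' * deriv i f)) = ymon s Var \<alpha>"
      proof -
        have "Const (- 1) = (- 1 :: 'a mps)"
          by (rule mps_eqI) (simp add: coeff_Const one_mps.rep_eq ps_one_def)
        then have "ymon s Var \<alpha>' * deriv i g + Const (- 1) * (ymon s Var \<alpha>' * deriv i f)
            = Const (of_nat N) * ymon s Var \<alpha>"
          unfolding dg mon by (simp add: algebra_simps)
        then show ?thesis using N by (simp add: mult.assoc[symmetric] Const_mult[symmetric])
      qed
      finally show ?thesis .
    qed
  qed
  have "R s \<inter> M s (card B) \<subseteq> J"
  proof (rule codim_bound[OF J(1) finB, where w = "ymon s Var"])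
    fix n assume "\<not> R s \<inter> M s n \<subseteq> plusM s J (Suc n)"
    then obtain h where h: "h \<in> R s" "h \<in> M s n" "h \<notin> plusM s J (Suc n)" by blast
    \<comment> \<open>\<open>Sp\<close> is available for monomials only, so the witness for
      \<open>codim_bound\<close> must be one. If every monomial of degree n fell into J + m^(n+1),
      so would the degree n part of h, and h itself.\<close>
    have "\<exists>\<alpha>\<in>exps s (Suc n) - exps s n. ymon s Var \<alpha> \<notin> plusM s J (Suc n)"
    proof (rule ccontr)
      assume "\<not> ?thesis"
      then have all: "ymon s Var \<alpha> \<in> plusM s J (Suc n)" if "\<alpha> \<in> exps s (Suc n) - exps s n" for \<alpha>
        using that by blast
      have "psub s Var (Suc n) h
          = (\<Sum>\<alpha>\<in>exps s (Suc n) - exps s n. Const (coeff h \<alpha>) * ymon s Var \<alpha>)"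
        unfolding psub_def using h(2)
        by (intro sum.mono_neutral_right) (auto simp: finite_exps, auto simp: exps_def M_def)
      also have "\<dots> \<in> plusM s J (Suc n)"
        using all by (intro idl_sum[OF idl_plusM[OF J(1)]] idl_mult[OF idl_plusM[OF J(1)]] R_Const)
      finally have 1: "psub s Var (Suc n) h \<in> plusM s J (Suc n)" .
      have "psub s Var (Suc n) h \<in> R s"
        unfolding psub_def by (intro R_sum R_mult R_Const ymon_Var_R)
      then have "h - psub s Var (Suc n) h \<in> plusM s J (Suc n)"
        using psub_Var_diff[OF h(1)] h(1) by (intro plusM_M J(1) R_diff)
      from idl_add[OF idl_plusM[OF J(1)] 1 this] show False using h(3) by simp
    qed
    then obtain \<alpha> where "\<alpha> \<in> exps s (Suc n) - exps s n" "ymon s Var \<alpha> \<notin> plusM s J (Suc n)"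
      by blast
    then have \<alpha>: "\<alpha> \<in> mons s" "deg s \<alpha> = n" "ymon s Var \<alpha> \<notin> plusM s J (Suc n)"
      by (auto simp: exps_def)
    show "\<exists>v\<in>R s \<inter> M s n - plusM s J (Suc n). \<exists>c. v - (\<Sum>b\<in>B. Const (c b) * ymon s Var b) \<in> J"
    proof (rule bexI[of _ "ymon s Var \<alpha>"])
      show "\<exists>c. ymon s Var \<alpha> - (\<Sum>b\<in>B. Const (c b) * ymon s Var b) \<in> J"
        using mono[OF \<alpha>(1)] unfolding Sp_def .
      show "ymon s Var \<alpha> \<in> R s \<inter> M s n - plusM s J (Suc n)"
        using \<alpha> ymon_M[of s Var \<alpha>] ymon_Var_R by (auto simp: M_Var')
    qed
  qed
  then show ?thesis by blast
qed

subsection \<open>Translation\<close>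

lemma coeff_PS: "f \<in> R s \<Longrightarrow> coeff f \<in> PS s"
  by (auto simp: R_def PS_def)

lemma coeff_Mps:
  assumes "F \<in> PS s"
  shows "coeff (Mps F) = F"
proof (rule Mps_inverse, safe)
  fix \<alpha> assume "F \<alpha> \<noteq> 0"
  then have "\<alpha> \<in> mons s" using assms by (auto simp: PS_def)
  then have "{i. 0 < \<alpha> i} \<subseteq> {..<s}" by (auto simp: mons_def) (metis not_less less_nat_zero_code)
  then show "finite {i. \<alpha> i \<noteq> 0}" using finite_subset by auto
qed

lemma Mps_coeff: "Mps (coeff f) = f"
  by (rule coeff_inverse)

lemma Mps_R: "F \<in> PS s \<Longrightarrow> Mps F \<in> R s"
  using coeff_Mps[of F s] by (auto simp: R_def PS_def)

lemma PS_cases: "F \<in> PS s \<Longrightarrow> (\<And>f. f \<in> R s \<Longrightarrow> F = coeff f \<Longrightarrow> thesis) \<Longrightarrow> thesis"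
  using coeff_Mps[of F s] Mps_R[of F s] by metis

lemma coeff_in_image: "coeff f \<in> coeff ` J \<longleftrightarrow> f \<in> J"
  by (auto simp: coeff_inject)

lemma coeff_ps_sub: "ps_sub (coeff f) (coeff g) = coeff (f - g)"
  by (simp add: minus_mps.rep_eq)
lemma coeff_ps_add: "ps_add (coeff f) (coeff g) = coeff (f + g)"
  by (simp add: plus_mps.rep_eq)
lemma coeff_ps_mult: "ps_mult (coeff f) (coeff g) = coeff (f * g)"
  by (simp add: times_mps.rep_eq)
lemma coeff_ps_smult: "ps_smult c (coeff f) = coeff (Const c * f)"
  by (rule ext) (simp add: ps_smult_def)
lemma coeff_ps_one: "ps_one = coeff 1"
  by (simp add: one_mps.rep_eq)
lemma coeff_ps_deriv: "ps_deriv i (coeff f) = coeff (deriv i f)"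
  by (simp add: deriv.rep_eq)

lemmas coeff_simps = coeff_ps_sub coeff_ps_add coeff_ps_mult coeff_ps_smult coeff_ps_one
  coeff_ps_deriv

lemma max_pow_coeff: "f \<in> R s \<Longrightarrow> coeff f \<in> ps_max_pow s k \<longleftrightarrow> f \<in> M s k"
  using coeff_PS[of f s] by (auto simp: ps_max_pow_def M_def)

lemma ideal_gen_coeff:
  assumes G: "\<And>i. i < n \<Longrightarrow> G i \<in> R s"
  shows "ideal_gen s n (\<lambda>i. coeff (G i)) = coeff ` {\<Sum>i<n. a i * G i |a. \<forall>i<n. a i \<in> R s}"
proof (intro equalityI subsetI)
  fix h assume "h \<in> ideal_gen s n (\<lambda>i. coeff (G i))"
  then obtain a where a: "\<And>i. i < n \<Longrightarrow> a i \<in> PS s"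
    "h = (\<lambda>\<alpha>. \<Sum>i<n. ps_mult (a i) (coeff (G i)) \<alpha>)" by (auto simp: ideal_gen_def)
  have "h = coeff (\<Sum>i<n. Mps (a i) * G i)"
  proof
    fix \<alpha>
    show "h \<alpha> = coeff (\<Sum>i<n. Mps (a i) * G i) \<alpha>"
      unfolding a(2) coeff_sum
      by (rule sum.cong) (use a(1) in \<open>auto simp: times_mps.rep_eq coeff_Mps[of _ s]\<close>)
  qed
  moreover have "\<forall>i<n. Mps (a i) \<in> R s" using a(1) Mps_R by blast
  ultimately show "h \<in> coeff ` {\<Sum>i<n. a i * G i |a. \<forall>i<n. a i \<in> R s}"
    by (intro image_eqI CollectI exI[of _ "\<lambda>i. Mps (a i)"] conjI refl) auto
next
  fix h assume "h \<in> coeff ` {\<Sum>i<n. a i * G i |a. \<forall>i<n. a i \<in> R s}"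
  then obtain a where a: "\<And>i. i < n \<Longrightarrow> a i \<in> R s" "h = coeff (\<Sum>i<n. a i * G i)" by auto
  have "h \<in> PS s" unfolding a(2) by (intro coeff_PS R_sum R_mult) (use a G in auto)
  moreover have "h = (\<lambda>\<alpha>. \<Sum>i<n. ps_mult (coeff (a i)) (coeff (G i)) \<alpha>)"
    by (rule ext) (simp add: a(2) coeff_ps_mult)
  ultimately show "h \<in> ideal_gen s n (\<lambda>i. coeff (G i))"
    using a(1) coeff_PS unfolding ideal_gen_def by (auto intro!: exI[of _ "\<lambda>i. coeff (a i)"])
qed

definition prin :: "nat \<Rightarrow> 'a::field mps \<Rightarrow> 'a mps set" where
  "prin s f = {a * f |a. a \<in> R s}"

lemma prin_coeff: "f \<in> R s \<Longrightarrow> ideal_gen s 1 (\<lambda>_. coeff f) = coeff ` prin s f"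
proof -
  assume f: "f \<in> R s"
  have *: "{\<Sum>i<1::nat. a i * f |a. \<forall>i<1. a i \<in> R s} = prin s f"
  proof (intro equalityI subsetI)
    show "x \<in> prin s f" if "x \<in> {\<Sum>i<1::nat. a i * f |a. \<forall>i<1. a i \<in> R s}" for x
      using that by (auto simp: prin_def)
    show "x \<in> {\<Sum>i<1::nat. a i * f |a. \<forall>i<1. a i \<in> R s}" if x: "x \<in> prin s f" for x
    proof -
      obtain a where "x = a * f" "a \<in> R s" using x by (auto simp: prin_def)
      then show ?thesis by (intro CollectI exI[of _ "\<lambda>_. a"]) auto
    qed
  qed
  have "ideal_gen s 1 (\<lambda>i. coeff f) = coeff ` {\<Sum>i<1::nat. a i * f |a. \<forall>i<1. a i \<in> R s}"
    by (rule ideal_gen_coeff) (rule f)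
  then show ?thesis unfolding * .
qed

lemma milnor_coeff: "f \<in> R s \<Longrightarrow> milnor s (coeff f) = qdim s (coeff ` tjid s 0 f)"
proof -
  assume f: "f \<in> R s"
  have "{\<Sum>i<s. a i * deriv i f |a. \<forall>i<s. a i \<in> R s} = tjid s 0 f"
  proof (intro equalityI subsetI)
    show "x \<in> tjid s 0 f" if "x \<in> {\<Sum>i<s. a i * deriv i f |a. \<forall>i<s. a i \<in> R s}" for x
      using that tjidI[of 0 s _ 0 f] by auto
  qed (auto simp: tjid_def)
  then show ?thesis
    using ideal_gen_coeff[of s "\<lambda>i. deriv i f" s] f
    by (simp add: milnor_def coeff_ps_deriv R_deriv)
qed

lemma tjurina_coeff: "f \<in> R s \<Longrightarrow> tjurina s (coeff f) = qdim s (coeff ` tjid s 1 f)"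
proof -
  assume f: "f \<in> R s"
  define G where "G j = (if j = 0 then f else deriv (j - 1) f)" for j
  have GR: "G j \<in> R s" if "j < Suc s" for j
    using that f by (auto simp: G_def intro: R_deriv)
  have sumG: "(\<Sum>i<Suc s. a i * G i) = a 0 * (1 * f) + (\<Sum>i<s. a (Suc i) * deriv i f)" for a
    unfolding sum.lessThan_Suc_shift by (simp add: G_def)
  have "{\<Sum>i<Suc s. a i * G i |a. \<forall>i<Suc s. a i \<in> R s} = tjid s 1 f"
  proof (intro equalityI subsetI)
    fix x assume "x \<in> {\<Sum>i<Suc s. a i * G i |a. \<forall>i<Suc s. a i \<in> R s}"
    then show "x \<in> tjid s 1 f" unfolding sumG by (auto intro!: tjidI simp del: mult_1)
  next
    fix x assume "x \<in> tjid s 1 f"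
    then obtain a b where ab: "x = a * (1 * f) + (\<Sum>i<s. b i * deriv i f)" "a \<in> R s"
      "\<forall>i<s. b i \<in> R s" unfolding tjid_def by blast
    have "x = (\<Sum>i<Suc s. (case i of 0 \<Rightarrow> a | Suc i \<Rightarrow> b i) * G i)"
      unfolding sumG by (simp add: ab)
    moreover have "\<forall>i<Suc s. (case i of 0 \<Rightarrow> a | Suc i \<Rightarrow> b i) \<in> R s"
      using ab by (auto split: nat.split)
    ultimately show "x \<in> {\<Sum>i<Suc s. a i * G i |a. \<forall>i<Suc s. a i \<in> R s}" by blast
  qed
  moreover have "(\<lambda>j. if j = 0 then coeff f else ps_deriv (j - 1) (coeff f)) = (\<lambda>j. coeff (G j))"
    by (rule ext) (simp add: G_def coeff_ps_deriv)
  ultimately show ?thesis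
    using ideal_gen_coeff[of "Suc s" G s] GR by (simp add: tjurina_def)
qed

text \<open>Supplies the k of the determinacy bound: \<open>codim_bound\<close> is applied to a
  spanning set whose cardinality attains the minimum in \<open>qdim\<close>.\<close>

lemma qdim_finite_imp:
  fixes J :: "'a::field mps set"
  assumes J: "idl s J" and fin: "qdim s (coeff ` J) < \<infinity>"
  shows "R s \<inter> M s (the_enat (qdim s (coeff ` J))) \<subseteq> J"
proof -
  let ?S = "spans_mod s (coeff ` J)"
  have ex: "\<exists>n B. ?S B \<and> card B = n"
    using fin unfolding qdim_def by (auto split: if_splits)
  define d where "d = (LEAST n. \<exists>B. ?S B \<and> card B = n)"
  have "\<exists>B. ?S B \<and> card B = d" unfolding d_def by (rule LeastI_ex[OF ex])
  then obtain B where B: "?S B" "card B = d" by blast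
  have d: "the_enat (qdim s (coeff ` J)) = d"
    using B(1) unfolding qdim_def d_def by auto
  have BPS: "finite B" "B \<subseteq> PS s" using B by (auto simp: spans_mod_def)
  have "R s \<inter> M s (card B) \<subseteq> J"
  proof (rule codim_bound[OF J BPS(1), where w = Mps])
    fix n assume "\<not> R s \<inter> M s n \<subseteq> plusM s J (Suc n)"
    then obtain v where v: "v \<in> R s \<inter> M s n - plusM s J (Suc n)" by blast
    then obtain c where c: "ps_sub (coeff v) (\<lambda>\<alpha>. \<Sum>b\<in>B. c b * b \<alpha>) \<in> coeff ` J"
      using B(1) coeff_PS unfolding spans_mod_def by blast
    have "(\<lambda>\<alpha>. \<Sum>b\<in>B. c b * b \<alpha>) = coeff (\<Sum>b\<in>B. Const (c b) * Mps b)"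
    proof
      fix \<alpha>
      show "(\<Sum>b\<in>B. c b * b \<alpha>) = coeff (\<Sum>b\<in>B. Const (c b) * Mps b) \<alpha>"
        unfolding coeff_sum
        by (rule sum.cong) (use BPS in \<open>auto simp: coeff_Mps subset_eq\<close>)
    qed
    with c have "v - (\<Sum>b\<in>B. Const (c b) * Mps b) \<in> J"
      by (simp add: coeff_ps_sub coeff_in_image)
    with v show "\<exists>v\<in>R s \<inter> M s n - plusM s J (Suc n). \<exists>c. v - (\<Sum>b\<in>B. Const (c b) * Mps b) \<in> J"
      by blast
  qed
  then show ?thesis by (simp add: d B(2))
qed

lemma Const_sum: "Const (sum c I) = (\<Sum>i\<in>I. Const (c i))"
  by (rule mps_eqI) (simp add: coeff_Const)

lemma qdim_finiteI:
  fixes J :: "'a::field mps set"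
  assumes sub: "R s \<inter> M s n \<subseteq> J"
  shows "qdim s (coeff ` J) < \<infinity>"
proof -
  let ?W = "ymon s Var ` exps s n :: 'a mps set"
  have "spans_mod s (coeff ` J) (coeff ` ?W)"
    unfolding spans_mod_def
  proof (intro conjI ballI)
    show "finite (coeff ` ?W)" by (intro finite_imageI finite_exps)
    show "coeff ` ?W \<subseteq> PS s" using ymon_Var_R coeff_PS by blast
    fix h :: "'a ps" assume "h \<in> PS s"
    then obtain f where f: "f \<in> R s" "h = coeff f" by (rule PS_cases)
    \<comment> \<open>The spanning set is indexed by the monomials themselves and not by their
      exponents, so coefficients are collected over the fibres of \<open>ymon s Var\<close>.\<close>
    define c where "c w = (\<Sum>\<alpha> | \<alpha> \<in> exps s n \<and> ymon s Var \<alpha> = w. coeff f \<alpha>)" for w :: "'a mps"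
    have "psub s Var n f = (\<Sum>w\<in>?W. \<Sum>\<alpha> | \<alpha> \<in> exps s n \<and> ymon s Var \<alpha> = w.
        Const (coeff f \<alpha>) * ymon s Var \<alpha>)"
      unfolding psub_def by (rule sum.image_gen[OF finite_exps])
    also have "\<dots> = (\<Sum>w\<in>?W. Const (c w) * w)"
      by (rule sum.cong) (auto simp: c_def Const_sum sum_distrib_right intro!: sum.cong)
    finally have p: "psub s Var n f = (\<Sum>w\<in>?W. Const (c w) * w)" .
    have "psub s Var n f \<in> R s" unfolding psub_def by (intro R_sum R_mult R_Const ymon_Var_R)
    then have "f - psub s Var n f \<in> J"
      using sub psub_Var_diff[OF f(1)] R_diff[OF f(1)] by blast
    then have "f - (\<Sum>w\<in>?W. Const (c w) * w) \<in> J" by (simp only: p)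
    moreover have "(\<lambda>\<alpha>. \<Sum>b\<in>coeff ` ?W. c (Mps b) * b \<alpha>) = coeff (\<Sum>w\<in>?W. Const (c w) * w)"
    proof
      fix \<alpha>
      have "inj_on coeff ?W" by (rule inj_onI) (simp add: coeff_inject)
      then show "(\<Sum>b\<in>coeff ` ?W. c (Mps b) * b \<alpha>) = coeff (\<Sum>w\<in>?W. Const (c w) * w) \<alpha>"
        by (simp add: sum.reindex Mps_coeff)
    qed
    ultimately have "ps_sub h (\<lambda>\<alpha>. \<Sum>b\<in>coeff ` ?W. c (Mps b) * b \<alpha>) \<in> coeff ` J"
      by (simp add: f(2) coeff_ps_sub coeff_in_image)
    then show "\<exists>c. ps_sub h (\<lambda>\<alpha>. \<Sum>b\<in>coeff ` ?W. c b * b \<alpha>) \<in> coeff ` J"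
      by (rule exI[of _ "\<lambda>b. c (Mps b)"])
  qed
  then show ?thesis unfolding qdim_def by auto
qed

subsection \<open>Determinacy bound\<close>

definition autR :: "nat \<Rightarrow> ('a::field mps \<Rightarrow> 'a mps) \<Rightarrow> bool" where
  "autR s \<sigma> \<longleftrightarrow> bij_betw \<sigma> (R s) (R s) \<and>
     (\<forall>f\<in>R s. \<forall>g\<in>R s. \<sigma> (f + g) = \<sigma> f + \<sigma> g \<and> \<sigma> (f * g) = \<sigma> f * \<sigma> g) \<and>
     (\<forall>c. \<sigma> (Const c) = Const c)"

lemma autR_id: "autR s (\<lambda>f. f)"
  by (auto simp: autR_def bij_betw_def)

lemma autR_subst:
  assumes "\<And>i. i < s \<Longrightarrow> b i \<in> R s \<inter> M s 2"
  shows "autR s (subst s (\<lambda>i. Var i + b i))"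
proof -
  note x = perturbed_Var[of s b, OF assms]
  show ?thesis
    unfolding autR_def
    using subst_bij[of s b] assms subst_add[OF x] subst_mult[OF x] subst_Const[OF x] by auto
qed

lemma right_equivI:
  fixes f :: "'a::field mps"
  assumes "autR s \<sigma>" and f: "f \<in> R s"
  shows "right_equiv s (coeff f) (coeff (\<sigma> f))"
  unfolding right_equiv_def is_aut_def
proof (intro exI conjI ballI allI)
  let ?\<phi> = "\<lambda>F. coeff (\<sigma> (Mps F))"
  have bij: "bij_betw \<sigma> (R s) (R s)" using assms by (simp add: autR_def)
  have "bij_betw (coeff \<circ> \<sigma> \<circ> Mps) (PS s) (PS s)"
  proof (intro bij_betw_trans)
    show "bij_betw Mps (PS s) (R s)"
      by (rule bij_betw_byWitness[where f' = coeff]) (auto simp: coeff_Mps Mps_coeff Mps_R coeff_PS)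
    show "bij_betw \<sigma> (R s) (R s)" by (rule bij)
    show "bij_betw coeff (R s) (PS s)"
      by (rule bij_betw_byWitness[where f' = Mps]) (auto simp: coeff_Mps Mps_coeff Mps_R coeff_PS)
  qed
  then show "bij_betw ?\<phi> (PS s) (PS s)" by (simp add: comp_def)
  fix F G :: "'a ps" assume F: "F \<in> PS s"
  obtain p where p: "p \<in> R s" "F = coeff p" using F by (rule PS_cases)
  show "?\<phi> (ps_smult c F) = ps_smult c (?\<phi> F)" for c
    using assms p by (simp add: autR_def coeff_simps Mps_coeff)
  assume G: "G \<in> PS s"
  obtain q where q: "q \<in> R s" "G = coeff q" using G by (rule PS_cases)
  show "?\<phi> (ps_add F G) = ps_add (?\<phi> F) (?\<phi> G)" "?\<phi> (ps_mult F G) = ps_mult (?\<phi> F) (?\<phi> G)"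
    using assms p q by (simp_all add: autR_def coeff_simps Mps_coeff)
next
  have "\<sigma> 1 = 1" using assms Const_1 by (metis autR_def)
  then show "coeff (\<sigma> (Mps ps_one)) = ps_one" by (simp add: coeff_ps_one Mps_coeff)
qed (simp add: Mps_coeff)

text \<open>As g is a unit times \<sigma>(f), the automorphism maps the ideal of f onto that of g.
  It also serves as the lift in \<open>quot_iso\<close>; being an exact homomorphism, it makes each
  required difference equal to 0.\<close>

lemma contact_equivI:
  fixes f :: "'a::field mps"
  assumes \<sigma>: "autR s \<sigma>" and f: "f \<in> R s" and e: "e \<in> R s" "w \<in> R s" "e * w = 1"
    and g: "g = e * \<sigma> f"
  shows "contact_equiv s (coeff f) (coeff g)"
proof -
  let ?\<psi> = "\<lambda>F. coeff (\<sigma> (Mps F))"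
  have bij: "bij_betw \<sigma> (R s) (R s)" and hom: "\<And>a b. a \<in> R s \<Longrightarrow> b \<in> R s \<Longrightarrow> \<sigma> (a + b) = \<sigma> a + \<sigma> b"
    "\<And>a b. a \<in> R s \<Longrightarrow> b \<in> R s \<Longrightarrow> \<sigma> (a * b) = \<sigma> a * \<sigma> b" "\<And>c. \<sigma> (Const c) = Const c"
    using \<sigma> by (auto simp: autR_def)
  have \<sigma>R: "\<sigma> a \<in> R s" if "a \<in> R s" for a using bij that by (auto simp: bij_betw_def)
  have surj: "\<exists>a\<in>R s. \<sigma> a = b" if "b \<in> R s" for b using bij that by (metis bij_betw_imp_surj_on imageE)
  have one: "\<sigma> 1 = 1" using hom(3)[of 1] by simp
  have gR: "g \<in> R s" unfolding g using e f \<sigma>R by (intro R_mult)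
  have zero: "coeff 0 \<in> coeff ` prin s g"
    unfolding coeff_in_image prin_def by (intro CollectI exI[of _ 0]) simp
  have mem: "\<sigma> a \<in> prin s g \<longleftrightarrow> a \<in> prin s f" if a: "a \<in> R s" for a
  proof
    assume "\<sigma> a \<in> prin s g"
    then obtain c where c: "c \<in> R s" "\<sigma> a = c * (e * \<sigma> f)" unfolding prin_def g by blast
    obtain c' where c': "c' \<in> R s" "\<sigma> c' = c * e" using surj[OF R_mult[OF c(1) e(1)]] by blast
    have "\<sigma> a = \<sigma> (c' * f)" using c c' f hom(2) by (simp add: mult.assoc)
    then have "a = c' * f" using bij a R_mult[OF c'(1) f] by (auto simp: bij_betw_def dest: inj_onD)
    then show "a \<in> prin s f" using c' unfolding prin_def by blast
  next
    assume "a \<in> prin s f"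
    then obtain c where c: "c \<in> R s" "a = c * f" unfolding prin_def by blast
    have "\<sigma> a = \<sigma> c * (e * w) * \<sigma> f" using c f hom(2) e by simp
    then have "\<sigma> a = (\<sigma> c * w) * g" unfolding g by (simp add: mult_ac)
    moreover have "\<sigma> c * w \<in> R s" using c e \<sigma>R by (intro R_mult) auto
    ultimately show "\<sigma> a \<in> prin s g" unfolding prin_def by blast
  qed
  show ?thesis
    unfolding contact_equiv_def quot_iso_def prin_coeff[OF f] prin_coeff[OF gR]
  proof (intro exI[of _ ?\<psi>] conjI ballI allI)
    show "ps_sub (?\<psi> ps_one) ps_one \<in> coeff ` prin s g"
      using zero by (simp add: coeff_simps Mps_coeff one)
    fix F :: "'a ps" assume F: "F \<in> PS s"
    obtain p where p: "p \<in> R s" "F = coeff p" using F by (rule PS_cases)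
    show "?\<psi> F \<in> PS s" using p \<sigma>R by (simp add: Mps_coeff coeff_PS)
    show "ps_sub (?\<psi> (ps_smult c F)) (ps_smult c (?\<psi> F)) \<in> coeff ` prin s g" for c
      using zero p hom by (simp add: coeff_simps Mps_coeff)
    show "?\<psi> F \<in> coeff ` prin s g \<longleftrightarrow> F \<in> coeff ` prin s f"
      using mem[OF p(1)] p by (simp add: coeff_in_image Mps_coeff)
    show "\<exists>a\<in>PS s. ps_sub (?\<psi> a) F \<in> coeff ` prin s g"
    proof -
      obtain a where a: "a \<in> R s" "\<sigma> a = p" using surj[OF p(1)] by blast
      show ?thesis
        by (rule bexI[of _ "coeff a"]) (use a zero p in \<open>auto simp: coeff_simps Mps_coeff coeff_PS\<close>)
    qed
    fix G :: "'a ps" assume G: "G \<in> PS s"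
    obtain q where q: "q \<in> R s" "G = coeff q" using G by (rule PS_cases)
    show "ps_sub (?\<psi> (ps_add F G)) (ps_add (?\<psi> F) (?\<psi> G)) \<in> coeff ` prin s g"
      "ps_sub (?\<psi> (ps_mult F G)) (ps_mult (?\<psi> F) (?\<psi> G)) \<in> coeff ` prin s g"
      using zero p q hom by (simp_all add: coeff_simps Mps_coeff)
  qed
qed

text \<open>Detects the order of an ideal containing m^k; it serves to show that f is nonzero and of
  order at most k + 1.\<close>

lemma Var_power_notin_M:
  assumes "0 < s"
  shows "(Var 0 ^ k :: 'a::field mps) \<notin> M s (Suc k)"
proof -
  have "coeff (Var 0 ^ k :: 'a mps) ((\<lambda>_. 0)(0 := k)) = 1"
  proof (induction k)
    case 0
    then show ?case by (simp add: one_mps.rep_eq ps_one_def fun_upd_idem)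
  next
    case (Suc k)
    then show ?case by (simp add: coeff_Var_mult fun_upd_same del: fun_upd_apply)
  qed
  moreover have "deg s ((\<lambda>_. 0)(0 := k)) = k"
    using assms by (simp add: deg_def sum.remove[of "{..<s}" 0])
  ultimately show ?thesis
    unfolding M_def by (metis (mono_tags, lifting) lessI mem_Collect_eq zero_neq_one)
qed

text \<open>Provides the condition 1 \<le> m \<le> k + 1 of \<open>determinacy\<close> for m = ord
  f. For z = 0 the factor 1 + z a is 1 and the conclusion is right equivalence; for z = 1 it is a
  unit and gives contact equivalence.\<close>

lemma determined_by_codim:
  fixes f g :: "'a::field mps"
  assumes f: "f \<in> R s" "coeff f (\<lambda>_. 0) = 0" and z: "z \<in> R s"
    and sub: "R s \<inter> M s k \<subseteq> tjid s z f"
    and g: "g \<in> R s" "f - g \<in> M s (2 * k + 2 - ps_ord s (coeff f) + 1)"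
  shows "\<exists>\<sigma> a w. autR s \<sigma> \<and> a \<in> R s \<and> w \<in> R s \<and> (1 + z * a) * w = 1 \<and> g = (1 + z * a) * \<sigma> f"
proof (cases "s = 0")
  \<comment> \<open>Without variables every degree is 0 and f = 0, so \<open>ps_ord\<close> is an
    unspecified value. The final + 1 in the hypothesis still forces f - g = 0.\<close>
  case True
  have "f - g = 0"
  proof (rule M_separated)
    fix n
    have "deg s \<alpha> = 0" for \<alpha> using True by (simp add: deg_def)
    then show "f - g \<in> M s n" using g(2) by (simp add: M_def)
  qed
  then show ?thesis using autR_id[of s]
    by (intro exI[of _ "\<lambda>f. f"] exI[of _ 0] exI[of _ 1]) auto
next
  case False
  define m where "m = ps_ord s (coeff f)"
  have fM: "f \<in> M s m"
    unfolding M_def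
  proof (intro CollectI allI impI, rule ccontr)
    fix \<alpha> assume "deg s \<alpha> < m" and nz: "coeff f \<alpha> \<noteq> 0"
    moreover have "\<alpha> \<in> mons s" using nz f by (auto simp: R_def)
    ultimately show False
      unfolding m_def ps_ord_def using not_less_Least by blast
  qed
  have x: "(Var 0 ^ k :: 'a mps) \<in> tjid s z f"
  proof (rule subsetD[OF sub])
    show "(Var 0 ^ k :: 'a mps) \<in> R s \<inter> M s k"
      using False by (auto intro!: R_power M_power simp: M_Var')
  qed
  \<comment> \<open>For f = 0 the ideal would be 0 and could not contain x_0^k. Hence the minimum in
    \<open>ps_ord\<close> is attained.\<close>
  have "f \<noteq> 0"
  proof
    assume "f = 0"
    then have "(Var 0 ^ k :: 'a mps) = 0" using x by (auto simp: tjid_def)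
    then show False using Var_power_notin_M[of s k] False by (metis M_0 neq0_conv)
  qed
  then obtain \<alpha> where "coeff f \<alpha> \<noteq> 0" using mps_eqI[of f 0] by auto
  then have "\<exists>d. \<exists>\<alpha>\<in>mons s. deg s \<alpha> = d \<and> coeff f \<alpha> \<noteq> 0" using f by (auto simp: R_def)
  then have "\<exists>\<alpha>\<in>mons s. deg s \<alpha> = m \<and> coeff f \<alpha> \<noteq> 0"
    unfolding m_def ps_ord_def by (rule LeastI_ex)
  moreover have "f \<in> M s 1" using M_1_iff[OF f(1)] f(2) by simp
  then have "coeff f \<alpha> = 0" if "deg s \<alpha> < 1" for \<alpha> using that unfolding M_def by blast
  ultimately have m1: "1 \<le> m" by (metis not_less)
  \<comment> \<open>Differentiation lowers the order by at most one, so the ideal has order at least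
    m - 1. Since it contains x_0^k, this gives m - 1 \<le> k.\<close>
  have "tjid s z f \<subseteq> M s (m - 1)"
    using fM m1 M_deriv[of _ s f "m - 1"]
    by (auto simp: tjid_def intro!: M_add M_sum M_mult_left intro: M_antimono)
  then have "(Var 0 ^ k :: 'a mps) \<in> M s (m - 1)" using x by blast
  then have mk: "m \<le> k + 1"
    using Var_power_notin_M[of s k] False M_antimono[of "Var 0 ^ k :: 'a mps" s "m - 1" "Suc k"]
    by (metis Suc_eq_plus1 le_diff_conv not_less_eq_eq neq0_conv)
  \<comment> \<open>With truncated subtraction, moving the + 1 inside is legitimate because m \<le>
    k + 1.\<close>
  have "2 * k + 2 - m + 1 = 2 * k + 3 - m" using mk by simp
  then have "f - g \<in> M s (2 * k + 3 - m)" using g(2) unfolding m_def[symmetric] by metis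
  from determinacy[OF f(1) fM m1 mk z sub g(1) this] obtain a b where
    a: "a \<in> R s \<inter> M s 2" and b: "\<forall>i<s. b i \<in> R s \<inter> M s 2"
    and eq: "g = (1 + z * a) * subst s (\<lambda>i. Var i + b i) f" by blast
  have "- (z * a) \<in> R s" "- (z * a) \<in> M s 1"
    using a z M_antimono[of a s 2 1] by (auto intro!: R_uminus R_mult M_uminus M_mult_left)
  from one_minus_inverse[OF this] obtain w where "w \<in> R s" "(1 + z * a) * w = 1" by auto
  then show ?thesis
    using autR_subst[of s b] b a eq by blast
qed

subsection \<open>Determinacy implies finite codimension\<close>

text \<open>Such an f has a linear term in some x_i, and its coefficient is the constant term of the
  derivative in x_i. The factor from differentiation is 1, so the characteristic is
  harmless.\<close>

lemma deriv_unit: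
  assumes f: "f \<in> R s" "coeff f (\<lambda>_. 0) = 0" and n2: "f \<notin> M s 2"
  shows "\<exists>i<s. coeff (deriv i f) (\<lambda>_. 0) \<noteq> 0"
proof -
  obtain \<alpha> where \<alpha>: "deg s \<alpha> < 2" "coeff f \<alpha> \<noteq> 0" using n2 by (auto simp: M_def)
  have am: "\<alpha> \<in> mons s" using \<alpha> f by (auto simp: R_def)
  have "f \<in> M s 1" using M_1_iff[OF f(1)] f(2) by simp
  then have "\<not> deg s \<alpha> < 1" using \<alpha>(2) unfolding M_def by blast
  then have d1: "deg s \<alpha> = 1" using \<alpha>(1) by linarith
  then obtain i where i: "i < s" "\<alpha> i \<noteq> 0" unfolding deg_def
    by (metis lessThan_iff sum.neutral zero_neq_one)
  have "\<alpha> i + (\<Sum>j\<in>{..<s} - {i}. \<alpha> j) = 1"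
    using d1 i by (simp add: deg_def sum.remove[of "{..<s}" i])
  then have ai: "\<alpha> i = 1" "(\<Sum>j\<in>{..<s} - {i}. \<alpha> j) = 0" using i(2) by linarith+
  have "\<alpha> = (\<lambda>_. 0)(i := 1)"
  proof
    fix j
    show "\<alpha> j = ((\<lambda>_. 0)(i := 1)) j"
      using ai am by (cases "j < s"; cases "j = i") (auto simp: mons_def)
  qed
  then have "coeff (deriv i f) (\<lambda>_. 0) \<noteq> 0" using \<alpha>(2) by (simp add: coeff_deriv)
  then show ?thesis using i by blast
qed

lift_definition trunc :: "nat \<Rightarrow> nat \<Rightarrow> 'a::field mps \<Rightarrow> 'a mps"
  is "\<lambda>s n f \<alpha>. if deg s \<alpha> < n then f \<alpha> else 0"
  by (auto split: if_splits)

text \<open>Truncating f at degree k keeps its degree below N, so that the added powers dominate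
  each partial derivative as \<open>milnor_finite_example\<close> requires; the powers themselves
  are too high to disturb the k-jet.\<close>

lemma exists_near_finite_codim:
  fixes f :: "'a::field mps"
  assumes f: "f \<in> R s" "f \<in> M s 2"
  shows "\<exists>g. g \<in> R s \<and> g \<in> M s 2 \<and> f - g \<in> M s (k + 1) \<and>
    (\<forall>z\<in>R s. \<exists>n. R s \<inter> M s n \<subseteq> tjid s z g)"
proof -
  \<comment> \<open>Two consecutive integers cannot both vanish in K: if k + 2 is 0 there, then k +
    3 is 1.\<close>
  have "\<exists>N. k + 2 \<le> N \<and> of_nat N \<noteq> (0::'a)"
  proof (cases "of_nat (k + 2) = (0::'a)")
    case True
    have "of_nat (Suc (k + 2)) \<noteq> (0::'a)" unfolding of_nat_Suc True by simp
    then show ?thesis by (intro exI[of _ "Suc (k + 2)"] conjI) auto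
  qed blast
  then obtain N where N: "k + 2 \<le> N" "of_nat N \<noteq> (0::'a)" by blast
  define f0 where "f0 = trunc s (k + 1) f"
  define g where "g = f0 + (\<Sum>i<s. Var i ^ N)"
  have f0: "f0 \<in> R s" "f0 \<in> M s 2" "f - f0 \<in> M s (k + 1)"
    using f by (auto simp: f0_def R_def M_def trunc.rep_eq)
  have x: "Var i ^ N \<in> M s m" if "i < s" "m \<le> N" for i m
    using M_antimono[OF M_power[of "Var i" s N]] that M_Var' by auto
  have gR: "g \<in> R s" unfolding g_def using f0 by (intro R_add R_sum R_power) auto
  have "g \<in> M s 2" unfolding g_def using f0 N by (intro M_add M_sum x) auto
  moreover have "f - g \<in> M s (k + 1)"
  proof -
    have "f - g = (f - f0) - (\<Sum>i<s. Var i ^ N)" by (simp add: g_def)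
    also have "\<dots> \<in> M s (k + 1)" using N by (intro M_diff[OF f0(3)] M_sum x) auto
    finally show ?thesis .
  qed
  moreover have "\<exists>n. R s \<inter> M s n \<subseteq> tjid s z g" if "z \<in> R s" for z
  proof (rule milnor_finite_example[OF f0(1) _ _ N(2) g_def])
    show "coeff f0 \<alpha> = 0" if "N \<le> deg s \<alpha>" for \<alpha>
      using that N by (auto simp: f0_def trunc.rep_eq)
    show "1 \<le> N" using N by simp
    show "idl s (tjid s z g)" by (rule idl_tjid[OF gR that])
    show "deriv i g \<in> tjid s z g" if "i < s" for i using that by (rule tjid_deriv)
  qed
  ultimately show ?thesis using gR by blast
qed

text \<open>A partial derivative is a unit here. This case is split off because
  \<open>transport\<close> needs the partial derivatives of g to have positive order.\<close>

lemma codim_if_not_M2: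
  assumes f: "f \<in> R s" "coeff f (\<lambda>_. 0) = 0" "f \<notin> M s 2" and z: "z \<in> R s"
  shows "R s \<inter> M s 0 \<subseteq> tjid s z f"
proof -
  obtain i where i: "i < s" "coeff (deriv i f) (\<lambda>_. 0) \<noteq> 0" using deriv_unit[OF f] by blast
  obtain u where "u \<in> R s" "deriv i f * u = 1"
    using unit_inverse[OF R_deriv[OF i(1) f(1)] i(2)] by blast
  then have "1 \<in> tjid s z f"
    using idl_mult'[OF idl_tjid[OF f(1) z] _ tjid_deriv[OF i(1)]] by metis
  then show ?thesis using idl_unit[OF idl_tjid[OF f(1) z]] by blast
qed

text \<open>An automorphism and its inverse are homomorphisms modulo the zero ideal, so this is
  \<open>transport\<close> with both ideals {0} and z = 0.\<close>

lemma right_equiv_codim: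
  fixes f g :: "'a::field mps"
  assumes f: "f \<in> R s" and g: "g \<in> R s" "g \<in> M s 2"
    and eqv: "right_equiv s (coeff f) (coeff g)" and sub: "R s \<inter> M s n \<subseteq> tjid s 0 g"
  shows "R s \<inter> M s n \<subseteq> tjid s 0 f"
proof -
  obtain \<phi> where aut: "is_aut s \<phi>" and \<phi>f: "\<phi> (coeff f) = coeff g"
    using eqv by (auto simp: right_equiv_def)
  have bij: "bij_betw \<phi> (PS s) (PS s)" using aut by (simp add: is_aut_def)
  define \<psi> where "\<psi> a = Mps (\<phi> (coeff a))" for a
  define \<chi> where "\<chi> a = Mps (inv_into (PS s) \<phi> (coeff a))" for a
  have \<phi>PS: "\<phi> F \<in> PS s" if "F \<in> PS s" for F using bij that by (auto simp: bij_betw_def)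
  have invPS: "inv_into (PS s) \<phi> F \<in> PS s" if "F \<in> PS s" for F
    using bij that by (simp add: bij_betw_def inv_into_into)
  have co\<psi>: "coeff (\<psi> a) = \<phi> (coeff a)" and \<psi>R: "\<psi> a \<in> R s" if "a \<in> R s" for a
    using \<phi>PS[OF coeff_PS[OF that]] by (simp_all add: \<psi>_def coeff_Mps Mps_R)
  have co\<chi>: "coeff (\<chi> a) = inv_into (PS s) \<phi> (coeff a)" and \<chi>R: "\<chi> a \<in> R s" if "a \<in> R s" for a
    using invPS[OF coeff_PS[OF that]] by (simp_all add: \<chi>_def coeff_Mps Mps_R)
  have \<psi>\<chi>: "\<psi> (\<chi> a) = a" if "a \<in> R s" for a
  proof -
    have "coeff (\<psi> (\<chi> a)) = coeff a"
      unfolding co\<psi>[OF \<chi>R[OF that]] co\<chi>[OF that] using bij coeff_PS[OF that]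
      by (simp add: bij_betw_inv_into_right)
    then show ?thesis by (simp add: coeff_inject)
  qed
  have \<chi>\<psi>: "\<chi> (\<psi> a) = a" if "a \<in> R s" for a
  proof -
    have "coeff (\<chi> (\<psi> a)) = coeff a"
      unfolding co\<chi>[OF \<psi>R[OF that]] co\<psi>[OF that] using bij coeff_PS[OF that]
      by (simp add: bij_betw_inv_into_left)
    then show ?thesis by (simp add: coeff_inject)
  qed
  have \<psi>hom: "\<psi> (a + b) = \<psi> a + \<psi> b" "\<psi> (a * b) = \<psi> a * \<psi> b" if "a \<in> R s" "b \<in> R s" for a b
    using aut coeff_PS that co\<psi>[OF that(1)] co\<psi>[OF that(2)]
      co\<psi>[OF R_add[OF that]] co\<psi>[OF R_mult[OF that]]
    unfolding is_aut_def by (metis coeff_inject coeff_ps_add, metis coeff_inject coeff_ps_mult)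
  have \<psi>C: "\<psi> (Const c) = Const c" for c
  proof -
    have "\<phi> (ps_smult c ps_one) = ps_smult c ps_one"
      using aut coeff_PS[OF R_1] unfolding is_aut_def by (metis coeff_ps_one)
    then have "coeff (\<psi> (Const c)) = coeff (Const c)"
      unfolding co\<psi>[OF R_Const] by (simp add: coeff_ps_one coeff_ps_smult)
    then show ?thesis by (simp add: coeff_inject)
  qed
  have \<chi>hom: "\<chi> (a + b) = \<chi> a + \<chi> b" "\<chi> (a * b) = \<chi> a * \<chi> b" if "a \<in> R s" "b \<in> R s" for a b
  proof -
    have "\<psi> (\<chi> a + \<chi> b) = a + b" "\<psi> (\<chi> a * \<chi> b) = a * b"
      using that by (simp_all add: \<psi>hom \<chi>R \<psi>\<chi>)
    then show "\<chi> (a + b) = \<chi> a + \<chi> b" "\<chi> (a * b) = \<chi> a * \<chi> b"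
      using \<chi>\<psi>[of "\<chi> a + \<chi> b"] \<chi>\<psi>[of "\<chi> a * \<chi> b"] that \<chi>R R_add R_mult by metis+
  qed
  have \<chi>C: "\<chi> (Const c) = Const c" for c using \<chi>\<psi>[of "Const c"] \<psi>C by simp
  have \<chi>g: "\<chi> g = f" using \<chi>\<psi>[OF f] co\<psi>[OF f] \<phi>f by (metis coeff_inject)
  have i0: "idl s ({0} :: 'a mps set)" by (simp add: idl_def)
  show ?thesis
  proof (rule transport[OF f g R_0, where I\<^sub>f = "{0}" and I\<^sub>g = "{0}" and \<psi> = \<psi> and \<chi> = \<chi>])
    show "homod s {0} \<psi>" using i0 \<psi>R \<psi>hom \<psi>C by (simp add: homod_def)
    show "homod s {0} \<chi>" using i0 \<chi>R \<chi>hom \<chi>C by (simp add: homod_def)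
    show "deriv i (\<chi> g) \<in> tjid s 0 f" if "i < s" for i
      unfolding \<chi>g using that by (rule tjid_deriv)
  qed (use \<psi>\<chi> \<chi>\<psi> \<chi>C[of 0] sub idl_0[OF idl_tjid[OF f R_0]] idl_0[OF idl_tjid[OF g(1) R_0]] in auto)
qed

lemma idl_prin: "f \<in> R s \<Longrightarrow> idl s (prin s f)"
  unfolding idl_def
proof (intro conjI ballI subsetI)
  assume f: "f \<in> R s"
  show "x \<in> R s" if "x \<in> prin s f" for x using that f by (auto simp: prin_def intro: R_mult)
  show "0 \<in> prin s f" unfolding prin_def by (intro CollectI exI[of _ 0]) simp
  fix x assume "x \<in> prin s f"
  then obtain a where a: "x = a * f" "a \<in> R s" by (auto simp: prin_def)
  show "r * x \<in> prin s f" if "r \<in> R s" for r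
    using a that R_mult unfolding prin_def by (metis (mono_tags, lifting) mem_Collect_eq mult.assoc)
  fix y assume "y \<in> prin s f"
  then obtain b where b: "y = b * f" "b \<in> R s" by (auto simp: prin_def)
  show "x + y \<in> prin s f"
    using a b R_add unfolding prin_def by (metis (mono_tags, lifting) distrib_right mem_Collect_eq)
qed

lemma prin_tjid: "x \<in> prin s f \<Longrightarrow> x \<in> tjid s 1 f"
  using tjidI[of _ s "\<lambda>_. 0" 1 f] by (auto simp: prin_def)

text \<open>By the product rule a derivative of a f involves f itself, which is why f belongs to the
  generators in the contact case.\<close>

lemma deriv_prin:
  assumes f: "f \<in> R s" and x: "x \<in> prin s f" and i: "i < s"
  shows "deriv i x \<in> tjid s 1 f"
proof -
  obtain a where a: "x = a * f" "a \<in> R s" using x by (auto simp: prin_def)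
  note J = idl_tjid[OF f R_1]
  have "1 * f \<in> tjid s 1 f" by (rule tjid_f)
  then show ?thesis
    unfolding a(1) deriv_mult[OF a(2) f]
    using a i by (intro idl_add[OF J] idl_mult[OF J] tjid_deriv R_deriv) auto
qed

text \<open>The given lift \<psi> has no inverse on R. A lift \<chi> of the inverse is chosen
  pointwise from surjectivity modulo the ideal of g, and its homomorphism properties modulo the
  ideal of f follow from injectivity on the quotients.\<close>

lemma contact_equiv_codim:
  fixes f g :: "'a::field mps"
  assumes f: "f \<in> R s" "f \<in> M s 1" and g: "g \<in> R s" "g \<in> M s 2"
    and eqv: "contact_equiv s (coeff f) (coeff g)" and sub: "R s \<inter> M s n \<subseteq> tjid s 1 g"
  shows "R s \<inter> M s n \<subseteq> tjid s 1 f"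
proof -
  let ?I = "prin s f" and ?J = "prin s g"
  note iI = idl_prin[OF f(1)] and iJ = idl_prin[OF g(1)]
  have g1: "g \<in> M s 1" using M_antimono[OF g(2)] by simp
  have I1: "?I \<subseteq> M s 1" and J1: "?J \<subseteq> M s 1"
    using f(2) g1 by (auto simp: prin_def intro: M_mult_left)
  obtain \<psi>0 where PS: "\<And>a. a \<in> PS s \<Longrightarrow> \<psi>0 a \<in> PS s"
    and add: "\<And>a b. a \<in> PS s \<Longrightarrow> b \<in> PS s \<Longrightarrow> ps_sub (\<psi>0 (ps_add a b)) (ps_add (\<psi>0 a) (\<psi>0 b)) \<in> coeff ` ?J"
    and mult: "\<And>a b. a \<in> PS s \<Longrightarrow> b \<in> PS s \<Longrightarrow> ps_sub (\<psi>0 (ps_mult a b)) (ps_mult (\<psi>0 a) (\<psi>0 b)) \<in> coeff ` ?J"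
    and smult: "\<And>c a. a \<in> PS s \<Longrightarrow> ps_sub (\<psi>0 (ps_smult c a)) (ps_smult c (\<psi>0 a)) \<in> coeff ` ?J"
    and one: "ps_sub (\<psi>0 ps_one) ps_one \<in> coeff ` ?J"
    and mem: "\<And>a. a \<in> PS s \<Longrightarrow> \<psi>0 a \<in> coeff ` ?J \<longleftrightarrow> a \<in> coeff ` ?I"
    and sur: "\<And>b. b \<in> PS s \<Longrightarrow> \<exists>a\<in>PS s. ps_sub (\<psi>0 a) b \<in> coeff ` ?J"
    using eqv unfolding contact_equiv_def quot_iso_def prin_coeff[OF f(1)] prin_coeff[OF g(1)]
    by (elim exE conjE) blast
  define \<psi> where "\<psi> a = Mps (\<psi>0 (coeff a))" for a
  have co: "\<psi>0 (coeff a) = coeff (\<psi> a)" and \<psi>R: "\<psi> a \<in> R s" if "a \<in> R s" for a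
    using PS[OF coeff_PS[OF that]] by (simp_all add: \<psi>_def coeff_Mps Mps_R)
  have \<psi>add: "\<psi> (a + b) - (\<psi> a + \<psi> b) \<in> ?J" if "a \<in> R s" "b \<in> R s" for a b
    using add[OF coeff_PS[OF that(1)] coeff_PS[OF that(2)]] that
    by (simp add: coeff_simps co R_add coeff_in_image)
  have \<psi>mult: "\<psi> (a * b) - \<psi> a * \<psi> b \<in> ?J" if "a \<in> R s" "b \<in> R s" for a b
    using mult[OF coeff_PS[OF that(1)] coeff_PS[OF that(2)]] that
    by (simp add: coeff_simps co R_mult coeff_in_image)
  have \<psi>mem: "\<psi> a \<in> ?J \<longleftrightarrow> a \<in> ?I" if "a \<in> R s" for a
    using mem[OF coeff_PS[OF that]] that by (simp add: co coeff_in_image)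
  have \<psi>C: "\<psi> (Const c) - Const c \<in> ?J" for c
  proof -
    have "\<psi> (Const c * 1) - Const c * \<psi> 1 \<in> ?J"
      using smult[OF coeff_PS[OF R_1], of c] by (simp add: coeff_simps co R_mult coeff_in_image)
    moreover have "\<psi> 1 - 1 \<in> ?J"
      using one by (simp add: coeff_simps co coeff_in_image)
    then have "Const c * (\<psi> 1 - 1) \<in> ?J" by (rule idl_mult[OF iJ R_Const])
    ultimately have "(\<psi> (Const c * 1) - Const c * \<psi> 1) + Const c * (\<psi> 1 - 1) \<in> ?J"
      by (rule idl_add[OF iJ])
    then show ?thesis by (simp add: right_diff_distrib)
  qed
  have \<psi>: "homod s ?J \<psi>" using iJ \<psi>R \<psi>add \<psi>mult \<psi>C by (simp add: homod_def)
  have "\<forall>b. \<exists>a. b \<in> R s \<longrightarrow> a \<in> R s \<and> \<psi> a - b \<in> ?J"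
  proof
    fix b :: "'a mps"
    have "\<exists>a. a \<in> R s \<and> \<psi> a - b \<in> ?J" if b: "b \<in> R s"
    proof -
      obtain F where F: "F \<in> PS s" "ps_sub (\<psi>0 F) (coeff b) \<in> coeff ` ?J"
        using sur[OF coeff_PS[OF b]] by blast
      obtain a where "a \<in> R s" "F = coeff a" using F(1) by (rule PS_cases)
      then show ?thesis using F(2) by (auto simp: co coeff_ps_sub coeff_in_image)
    qed
    then show "\<exists>a. b \<in> R s \<longrightarrow> a \<in> R s \<and> \<psi> a - b \<in> ?J" by blast
  qed
  then obtain \<chi> where \<chi>R: "\<And>b. b \<in> R s \<Longrightarrow> \<chi> b \<in> R s" and \<psi>\<chi>: "\<And>b. b \<in> R s \<Longrightarrow> \<psi> (\<chi> b) - b \<in> ?J"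
    by metis
  have c\<psi>\<chi>: "ceq s ?J (\<psi> (\<chi> b)) b" if "b \<in> R s" for b
    using that iJ \<psi>R \<chi>R \<psi>\<chi> by (simp add: ceq_def)
  \<comment> \<open>Injectivity of the quotient map: a congruence modulo the ideal of f may be
    checked after applying \<psi>.\<close>
  have inI: "a - b \<in> ?I" if "a \<in> R s" "b \<in> R s" "ceq s ?J (\<psi> a) (\<psi> b)" for a b
  proof -
    have "ceq s ?J (\<psi> (a - b)) (\<psi> a - \<psi> b)" by (rule homod_diff[OF \<psi> J1 that(1,2)])
    moreover have "\<psi> a - \<psi> b \<in> ?J" using that(3) by (simp add: ceq_def)
    ultimately have "\<psi> (a - b) \<in> ?J" by (rule ceq_mem)
    then show ?thesis using \<psi>mem R_diff that by blast
  qed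
  have \<chi>add: "\<chi> (a + b) - (\<chi> a + \<chi> b) \<in> ?I" if "a \<in> R s" "b \<in> R s" for a b
  proof (rule inI)
    have "ceq s ?J (\<psi> (\<chi> (a + b))) (a + b)" by (rule c\<psi>\<chi>[OF R_add[OF that]])
    also have "ceq s ?J (a + b) (\<psi> (\<chi> a) + \<psi> (\<chi> b))"
      using that by (intro ceq_add ceq_sym[OF c\<psi>\<chi>])
    also have "ceq s ?J \<dots> (\<psi> (\<chi> a + \<chi> b))"
      using that by (intro ceq_sym[OF homod_add[OF \<psi> J1]] \<chi>R)
    finally show "ceq s ?J (\<psi> (\<chi> (a + b))) (\<psi> (\<chi> a + \<chi> b))" .
  qed (use that in \<open>auto intro: \<chi>R R_add\<close>)
  have \<chi>mult: "\<chi> (a * b) - \<chi> a * \<chi> b \<in> ?I" if "a \<in> R s" "b \<in> R s" for a b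
  proof (rule inI)
    have "ceq s ?J (\<psi> (\<chi> (a * b))) (a * b)" by (rule c\<psi>\<chi>[OF R_mult[OF that]])
    also have "ceq s ?J (a * b) (\<psi> (\<chi> a) * \<psi> (\<chi> b))"
      using that by (intro ceq_mult ceq_sym[OF c\<psi>\<chi>])
    also have "ceq s ?J \<dots> (\<psi> (\<chi> a * \<chi> b))"
      using that by (intro ceq_sym[OF homod_mult[OF \<psi> J1]] \<chi>R)
    finally show "ceq s ?J (\<psi> (\<chi> (a * b))) (\<psi> (\<chi> a * \<chi> b))" .
  qed (use that in \<open>auto intro: \<chi>R R_mult\<close>)
  have \<chi>C: "\<chi> (Const c) - Const c \<in> ?I" for c
  proof (rule inI)
    show "ceq s ?J (\<psi> (\<chi> (Const c))) (\<psi> (Const c))"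
      by (rule ceq_trans[OF c\<psi>\<chi>[OF R_Const] ceq_sym[OF homod_Const[OF \<psi> J1]]])
  qed (auto intro: \<chi>R)
  have \<chi>: "homod s ?I \<chi>" using iI \<chi>R \<chi>add \<chi>mult \<chi>C by (simp add: homod_def)
  have \<chi>\<psi>: "\<chi> (\<psi> a) - a \<in> ?I" if "a \<in> R s" for a
    by (rule inI[OF \<chi>R[OF \<psi>R[OF that]] that c\<psi>\<chi>[OF \<psi>R[OF that]]])
  have \<chi>J: "\<chi> a \<in> ?I" if "a \<in> ?J" for a
  proof -
    have aR: "a \<in> R s" by (rule idl_R[OF iJ that])
    have "\<psi> (\<chi> a) \<in> ?J" by (rule ceq_mem[OF c\<psi>\<chi>[OF aR] that])
    then show ?thesis using \<psi>mem[OF \<chi>R[OF aR]] by simp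
  qed
  have gJ: "1 * g \<in> ?J" unfolding prin_def using R_1 by blast
  show ?thesis
  proof (rule transport[OF f(1) g R_1, where I\<^sub>f = ?I and I\<^sub>g = ?J and \<psi> = \<psi> and \<chi> = \<chi>])
    show "deriv i (\<chi> g) \<in> tjid s 1 f" if "i < s" for i
      using deriv_prin[OF f(1) \<chi>J[of g] that] gJ by simp
    show "1 * g \<in> ?J" by (rule gJ)
    show "R s \<inter> M s n \<subseteq> tjid s 1 g" by (rule sub)
  qed (use I1 J1 \<psi> \<chi> \<chi>\<psi> \<psi>\<chi> \<chi>J deriv_prin[OF f(1)] deriv_prin[OF g(1)] prin_tjid in auto)
qed

theorem mainTheorem12:
  fixes s :: nat and f :: "('a::field) ps"
  assumes "f \<in> ps_max s"
  shows "(fin_contact_det s f \<longleftrightarrow> tjurina s f < \<infinity>)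
       \<and> (fin_right_det s f \<longleftrightarrow> milnor s f < \<infinity>)
       \<and> (tjurina s f < \<infinity> \<longrightarrow>
            contact_det s f (2 * the_enat (tjurina s f) + 2 - ps_ord s f))
       \<and> (milnor s f < \<infinity> \<longrightarrow>
            right_det s f (2 * the_enat (milnor s f) + 2 - ps_ord s f))"
proof -
  obtain p where p: "p \<in> R s" and fp: "f = coeff p"
    using assms unfolding ps_max_def by (auto elim: PS_cases)
  have p0: "coeff p (\<lambda>_. 0) = 0" using assms by (simp add: ps_max_def fp)
  then have p1: "p \<in> M s 1" using M_1_iff[OF p] by simp
  have contact: "contact_det s f (2 * the_enat (tjurina s f) + 2 - ps_ord s f)"
    if fin: "tjurina s f < \<infinity>"
    unfolding contact_det_def
  proof (intro ballI impI)
    fix g assume "g \<in> PS s" and near: "ps_sub f g \<in> ps_max_pow s (2 * the_enat (tjurina s f) + 2 - ps_ord s f + 1)"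
    then obtain q where q: "q \<in> R s" and gq: "g = coeff q" by (auto elim: PS_cases)
    have sub: "R s \<inter> M s (the_enat (tjurina s f)) \<subseteq> tjid s 1 p"
      using qdim_finite_imp[OF idl_tjid[OF p R_1]] fin by (simp add: fp tjurina_coeff[OF p])
    have "p - q \<in> M s (2 * the_enat (tjurina s f) + 2 - ps_ord s (coeff p) + 1)"
      using near max_pow_coeff[OF R_diff[OF p q]] by (simp add: fp gq coeff_ps_sub)
    from determined_by_codim[OF p p0 R_1 sub q this] obtain \<sigma> a w where
      "autR s \<sigma>" "a \<in> R s" "w \<in> R s" "(1 + 1 * a) * w = 1" "q = (1 + 1 * a) * \<sigma> p" by blast
    then show "contact_equiv s f g"
      unfolding fp gq by (intro contact_equivI[OF _ p, of \<sigma> "1 + 1 * a" w]) (auto intro: R_add)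
  qed
  have right: "right_det s f (2 * the_enat (milnor s f) + 2 - ps_ord s f)"
    if fin: "milnor s f < \<infinity>"
    unfolding right_det_def
  proof (intro ballI impI)
    fix g assume "g \<in> PS s" and near: "ps_sub f g \<in> ps_max_pow s (2 * the_enat (milnor s f) + 2 - ps_ord s f + 1)"
    then obtain q where q: "q \<in> R s" and gq: "g = coeff q" by (auto elim: PS_cases)
    have sub: "R s \<inter> M s (the_enat (milnor s f)) \<subseteq> tjid s 0 p"
      using qdim_finite_imp[OF idl_tjid[OF p R_0]] fin by (simp add: fp milnor_coeff[OF p])
    have "p - q \<in> M s (2 * the_enat (milnor s f) + 2 - ps_ord s (coeff p) + 1)"
      using near max_pow_coeff[OF R_diff[OF p q]] by (simp add: fp gq coeff_ps_sub)
    from determined_by_codim[OF p p0 R_0 sub q this] obtain \<sigma> where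
      "autR s \<sigma>" "q = \<sigma> p" by auto
    then show "right_equiv s f g" unfolding fp gq using right_equivI p by blast
  qed
  have near: "q \<in> R s \<Longrightarrow> p - q \<in> M s (k + 1) \<Longrightarrow> coeff q \<in> PS s \<and> ps_sub f (coeff q) \<in> ps_max_pow s (k + 1)"
    for q k
    using coeff_PS max_pow_coeff[OF R_diff[OF p]] by (simp add: fp coeff_ps_sub)
  have tj: "tjurina s f < \<infinity>" if "contact_det s f k" for k
  proof -
    have "\<exists>n. R s \<inter> M s n \<subseteq> tjid s 1 p"
    \<comment> \<open>A series of order one has the whole ring as its ideal. Inside m^2 the nearby q
      can also be taken in m^2, as the transport along the equivalence demands.\<close>
    proof (cases "p \<in> M s 2")
      case True
      obtain q n where q: "q \<in> R s" "q \<in> M s 2" "p - q \<in> M s (k + 1)" "R s \<inter> M s n \<subseteq> tjid s 1 q"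
        using exists_near_finite_codim[OF p True, of k] R_1 by blast
      have "contact_equiv s (coeff p) (coeff q)"
        using that near[OF q(1,3)] by (simp add: contact_det_def fp)
      from contact_equiv_codim[OF p p1 q(1,2) this q(4)] show ?thesis by blast
    qed (use codim_if_not_M2[OF p p0 _ R_1] in blast)
    then show ?thesis unfolding fp tjurina_coeff[OF p] using qdim_finiteI by blast
  qed
  have mi: "milnor s f < \<infinity>" if "right_det s f k" for k
  proof -
    have "\<exists>n. R s \<inter> M s n \<subseteq> tjid s 0 p"
    proof (cases "p \<in> M s 2")
      case True
      obtain q n where q: "q \<in> R s" "q \<in> M s 2" "p - q \<in> M s (k + 1)" "R s \<inter> M s n \<subseteq> tjid s 0 q"
        using exists_near_finite_codim[OF p True, of k] R_0 by blast
      have "right_equiv s (coeff p) (coeff q)"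
        using that near[OF q(1,3)] by (simp add: right_det_def fp)
      from right_equiv_codim[OF p q(1,2) this q(4)] show ?thesis by blast
    qed (use codim_if_not_M2[OF p p0 _ R_0] in blast)
    then show ?thesis unfolding fp milnor_coeff[OF p] using qdim_finiteI by blast
  qed
  show ?thesis
    using contact right tj mi unfolding fin_contact_det_def fin_right_det_def by blast
qed

end
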